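(* Suppose that $V$ satisfies (V), $K$ satisfies (K) and $f$ satisfies (F1)--(F4) (conditions listed in the context). Suppose moreover that $\mu<0$ and $$V_{loc}(x)>\frac{\mu}{|x|^\alpha}\quad\text{for a.e. }x\in\mathbb{R}^N\setminus\{0\}$$ (in particular, $V_{loc}>0$ is allowed). Then the equation $$(-\Delta)^{\alpha/2}u+\Big(V(x)-\frac{\mu}{|x|^\alpha}\Big)u=f(x,u)-K(x)|u|^{q-2}u\quad\text{on }\mathbb{R}^N\setminus\{0\}$$ has no ground states, i.e. there is no critical point $u\in\mathcal{N}$ of $\mathcal{J}$ with $\mathcal{J}(u)=\inf_{\mathcal{N}}\mathcal{J}$.
   Context: Setting: $\alpha\in(0,2)$, $N\ge 1$ is an integer with $N>\alpha$, $2^*_\alpha:=\frac{2N}{N-\alpha}$, and all functions are real-valued. $H^{\alpha/2}(\mathbb{R}^N)$ is the space of $u\in L^2(\mathbb{R}^N)$ with $\iint_{\mathbb{R}^N\times\mathbb{R}^N}\frac{|u(x)-u(y)|^2}{|x-y|^{N+\alpha}}\,dx\,dy<\infty$, with its usual Hilbert structure. Constant: $$c_{N,\alpha}:=\frac{2^\alpha\,\Gamma\left(\frac{N+\alpha}{2}\right)}{2\pi^{N/2}\,|\Gamma(-\alpha/2)|}.$$ Conditions on $f:\mathbb{R}^N\times\mathbb{R}\to\mathbb{R}$, with $F(x,u):=\int_0^u f(x,s)\,ds$: (F1) $f$ is measurable, $\mathbb{Z}^N$-periodic in $x$ and continuous in $u\in\mathbb{R}$ for a.e. $x$; there are $c>0$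 and $2<q<p<2^*_\alpha$ such that $|f(x,u)|\le c(1+|u|^{p-1})$ for all $u\in\mathbb{R}$, $x\in\mathbb{R}^N$ (this $q$ is the exponent appearing in the equation). (F2) $f(x,u)=o(|u|)$ uniformly in $x$ as $|u|\to0^+$. (F3) $F(x,u)/|u|^q\to\infty$ uniformly in $x$ as $|u|\to\infty$. (F4) $u\mapsto f(x,u)/|u|^{q-1}$ is increasing on $(-\infty,0)$ and on $(0,\infty)$. Condition (K): $K\in L^\infty(\mathbb{R}^N)$ is $\mathbb{Z}^N$-periodic and $K(x)\ge0$ for a.e. $x\in\mathbb{R}^N$. Condition (V): $V\in L^\infty(\mathbb{R}^N)$ is a sum $V=V_{loc}+V_{per}$, where $V_{per}\in L^\infty(\mathbb{R}^N)$ is $\mathbb{Z}^N$-periodic, $V_{loc}(x)\to0$ as $|x|\to\infty$, $V_{loc}\in L^s(\mathbb{R}^N)$ for some $s\ge\frac N\alpha$, and $\operatorname{ess\,inf}_{x\in\mathbb{R}^N}V(x)>0$. Energy functional $\mathcal{J}:H^{\alpha/2}(\mathbb{R}^N)\to\mathbb{R}$ (of class $C^1$; its critical points are the weak solutions of the equation): $$\mathcal{J}(u)=\frac{c_{N,\alpha}}2\iint_{\mathbb{R}^N\times\mathbb{R}^N}\frac{|u(x)-u(y)|^2}{|x-y|^{N+\alpha}}\,dx\,dy+\frac12\int_{\mathbb{R}^N}V(x)|u|^2\,dx-\frac12\int_{\mathbb{R}^N}\frac{\mu}{|x|^\alpha}|u|^2\,dx-\int_{\mathbb{R}^N}\Big(F(x,u)-\frac1qK(x)|u|^q\Big)dx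 .$$ Nehari manifold: $\mathcal{N}:=\{u\in H^{\alpha/2}(\mathbb{R}^N)\setminus\{0\}:\ \mathcal{J}'(u)(u)=0\}$. *)

theory Defs
  imports "HOL-Analysis.Analysis" "HOL-Probability.Essential_Supremum"
begin

text \<open>
  The space \<open>\<real>\<^sup>N\<close> is \<^typ>\<open>real ^ 'n\<close> with \<open>N = CARD('n)\<close>. Elements of Lebesgue and Sobolev
  spaces are represented by functions; the a.e. classes are accounted for by stating
  properties of such functions (periodicity, being zero, sign, size) almost everywhere.
\<close>

definition integer_lattice :: "(real ^ 'n) set" where
  "integer_lattice = {z. \<forall>i. z $ i \<in> \<int>}"

definition L_infinity :: "(real ^ 'n \<Rightarrow> real) set" where
  "L_infinity = {g. g \<in> borel_measurable lebesgue \<and> esssup lebesgue (\<lambda>x. ereal \<bar>g x\<bar>) < \<infinity>}"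

definition L_space :: "real \<Rightarrow> (real ^ 'n \<Rightarrow> real) set" where
  "L_space s = {g. g \<in> borel_measurable lebesgue \<and> integrable lebesgue (\<lambda>x. \<bar>g x\<bar> powr s)}"

definition essinf :: "(real ^ 'n \<Rightarrow> real) \<Rightarrow> ereal" where
  "essinf g = - esssup lebesgue (\<lambda>x. ereal (- g x))"

definition ae_periodic :: "(real ^ 'n \<Rightarrow> real) \<Rightarrow> bool" where
  "ae_periodic g \<longleftrightarrow> (\<forall>z\<in>integer_lattice. AE x in lebesgue. g (x + z) = g x)"

text \<open>The limit at infinity is the essential one, since it is applied to a class in
  \<open>L\<^sup>\<infinity>\<close>; it holds iff some representative tends to \<open>0\<close> in the ordinary sense.\<close>

definition ae_vanishes_at_infinity :: "(real ^ 'n \<Rightarrow> real) \<Rightarrow> bool" where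
  "ae_vanishes_at_infinity g \<longleftrightarrow>
     (\<forall>\<epsilon>>0. \<exists>R. AE x in lebesgue. norm x \<ge> R \<longrightarrow> \<bar>g x\<bar> < \<epsilon>)"


subsection \<open>The fractional Sobolev space\<close>

definition gagliardo_kernel ::
    "real \<Rightarrow> (real ^ 'n \<Rightarrow> real) \<Rightarrow> (real ^ 'n) \<times> (real ^ 'n) \<Rightarrow> real" where
  "gagliardo_kernel \<alpha> u = (\<lambda>(x, y). \<bar>u x - u y\<bar>\<^sup>2 / norm (x - y) powr (real CARD('n) + \<alpha>))"

definition gagliardo :: "real \<Rightarrow> (real ^ 'n \<Rightarrow> real) \<Rightarrow> real" where
  "gagliardo \<alpha> u = (\<integral>p. gagliardo_kernel \<alpha> u p \<partial>(lebesgue \<Otimes>\<^sub>M lebesgue))"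

definition sobolev :: "real \<Rightarrow> (real ^ 'n \<Rightarrow> real) set" where
  "sobolev \<alpha> = {u. u \<in> borel_measurable lebesgue \<and>
      integrable lebesgue (\<lambda>x. \<bar>u x\<bar>\<^sup>2) \<and>
      integrable (lebesgue \<Otimes>\<^sub>M lebesgue) (gagliardo_kernel \<alpha> u)}"

definition sobolev_norm :: "real \<Rightarrow> (real ^ 'n \<Rightarrow> real) \<Rightarrow> real" where
  "sobolev_norm \<alpha> u = sqrt ((\<integral>x. \<bar>u x\<bar>\<^sup>2 \<partial>lebesgue) + gagliardo \<alpha> u)"

text \<open>Frechet derivative on the fractional Sobolev space. The library constant
  \<^const>\<open>has_derivative\<close> needs a normed type, whereas this space depends on the real
  parameter \<open>\<alpha>\<close> and is only given as a set of functions; the definition below is the same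
  condition (bounded linear map with remainder \<open>o(\<parallel>h\<parallel>)\<close>) relative to that set.\<close>

definition has_sobolev_derivative ::
    "real \<Rightarrow> ((real ^ 'n \<Rightarrow> real) \<Rightarrow> real) \<Rightarrow> ((real ^ 'n \<Rightarrow> real) \<Rightarrow> real) \<Rightarrow> (real ^ 'n \<Rightarrow> real) \<Rightarrow> bool"
  where
  "has_sobolev_derivative \<alpha> \<Phi> L u \<longleftrightarrow>
     (\<forall>v\<in>sobolev \<alpha>. \<forall>w\<in>sobolev \<alpha>. \<forall>a b. L (\<lambda>x. a * v x + b * w x) = a * L v + b * L w) \<and>
     (\<exists>C. \<forall>v\<in>sobolev \<alpha>. \<bar>L v\<bar> \<le> C * sobolev_norm \<alpha> v) \<and>
     (\<forall>\<epsilon>>0. \<exists>\<delta>>0. \<forall>h\<in>sobolev \<alpha>. sobolev_norm \<alpha> h < \<delta> \<longrightarrow>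
        \<bar>\<Phi> (\<lambda>x. u x + h x) - \<Phi> u - L h\<bar> \<le> \<epsilon> * sobolev_norm \<alpha> h)"


subsection \<open>Conditions on the data\<close>

definition primitive :: "(real ^ 'n \<Rightarrow> real \<Rightarrow> real) \<Rightarrow> real ^ 'n \<Rightarrow> real \<Rightarrow> real" where
  "primitive f x u = (LINT s=0..u|lebesgue. f x s)"

text \<open>The critical exponent \<open>2\<^sup>*\<^sub>\<alpha>\<close>; the type argument carries the dimension.\<close>

definition critical_exponent :: "'n::finite itself \<Rightarrow> real \<Rightarrow> real" where
  "critical_exponent _ \<alpha> = 2 * real CARD('n) / (real CARD('n) - \<alpha>)"

definition cond_F1 :: "real \<Rightarrow> real \<Rightarrow> (real ^ 'n \<Rightarrow> real \<Rightarrow> real) \<Rightarrow> bool" where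
  "cond_F1 \<alpha> q f \<longleftrightarrow>
     (\<lambda>(x, u). f x u) \<in> borel_measurable (lebesgue :: ((real ^ 'n) \<times> real) measure) \<and>
     (\<forall>z\<in>integer_lattice. \<forall>x u. f (x + z) u = f x u) \<and>
     (AE x in lebesgue. continuous_on UNIV (f x)) \<and>
     (\<exists>c p. c > 0 \<and> 2 < q \<and> q < p \<and> p < critical_exponent TYPE('n) \<alpha> \<and>
        (\<forall>x u. \<bar>f x u\<bar> \<le> c * (1 + \<bar>u\<bar> powr (p - 1))))"

definition cond_F2 :: "(real ^ 'n \<Rightarrow> real \<Rightarrow> real) \<Rightarrow> bool" where
  "cond_F2 f \<longleftrightarrow> uniform_limit UNIV (\<lambda>u x. f x u / \<bar>u\<bar>) (\<lambda>x. 0) (at 0)"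

definition cond_F3 :: "real \<Rightarrow> (real ^ 'n \<Rightarrow> real \<Rightarrow> real) \<Rightarrow> bool" where
  "cond_F3 q f \<longleftrightarrow> (\<forall>M. \<forall>\<^sub>F u in at_infinity. \<forall>x. primitive f x u / \<bar>u\<bar> powr q \<ge> M)"

text \<open>``Increasing'' is read in the weak sense, which includes the strict one.\<close>

definition cond_F4 :: "real \<Rightarrow> (real ^ 'n \<Rightarrow> real \<Rightarrow> real) \<Rightarrow> bool" where
  "cond_F4 q f \<longleftrightarrow> (\<forall>x. mono_on {..<0} (\<lambda>u. f x u / \<bar>u\<bar> powr (q - 1)) \<and>
                        mono_on {0<..} (\<lambda>u. f x u / \<bar>u\<bar> powr (q - 1)))"

definition cond_K :: "(real ^ 'n \<Rightarrow> real) \<Rightarrow> bool" where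
  "cond_K K \<longleftrightarrow> K \<in> L_infinity \<and> ae_periodic K \<and> (AE x in lebesgue. K x \<ge> 0)"

text \<open>The decomposition of \<open>V\<close> is a parameter because later hypotheses refer to \<open>V\<^sub>l\<^sub>o\<^sub>c\<close>.\<close>

definition cond_V ::
    "real \<Rightarrow> (real ^ 'n \<Rightarrow> real) \<Rightarrow> (real ^ 'n \<Rightarrow> real) \<Rightarrow> (real ^ 'n \<Rightarrow> real) \<Rightarrow> bool" where
  "cond_V \<alpha> V Vloc Vper \<longleftrightarrow>
     V \<in> L_infinity \<and> (AE x in lebesgue. V x = Vloc x + Vper x) \<and>
     Vper \<in> L_infinity \<and> ae_periodic Vper \<and>
     ae_vanishes_at_infinity Vloc \<and>
     (\<exists>s \<ge> real CARD('n) / \<alpha>. Vloc \<in> L_space s) \<and>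
     essinf V > 0"


subsection \<open>Energy functional, Nehari manifold, ground states\<close>

definition frac_const :: "'n::finite itself \<Rightarrow> real \<Rightarrow> real" where
  "frac_const _ \<alpha> = 2 powr \<alpha> * Gamma ((real CARD('n) + \<alpha>) / 2) /
     (2 * pi powr (real CARD('n) / 2) * \<bar>Gamma (- \<alpha> / 2)\<bar>)"

definition energy ::
    "real \<Rightarrow> real \<Rightarrow> real \<Rightarrow> (real ^ 'n \<Rightarrow> real) \<Rightarrow> (real ^ 'n \<Rightarrow> real) \<Rightarrow>
     (real ^ 'n \<Rightarrow> real \<Rightarrow> real) \<Rightarrow> (real ^ 'n \<Rightarrow> real) \<Rightarrow> real" where
  "energy \<alpha> \<mu> q V K f u =
     frac_const TYPE('n) \<alpha> / 2 * gagliardo \<alpha> u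
     + 1/2 * (\<integral>x. V x * \<bar>u x\<bar>\<^sup>2 \<partial>lebesgue)
     - 1/2 * (\<integral>x. \<mu> / norm x powr \<alpha> * \<bar>u x\<bar>\<^sup>2 \<partial>lebesgue)
     - (\<integral>x. (primitive f x (u x) - 1/q * K x * \<bar>u x\<bar> powr q) \<partial>lebesgue)"

definition nehari :: "real \<Rightarrow> ((real ^ 'n \<Rightarrow> real) \<Rightarrow> real) \<Rightarrow> (real ^ 'n \<Rightarrow> real) set" where
  "nehari \<alpha> \<Phi> = {u \<in> sobolev \<alpha>. \<not> (AE x in lebesgue. u x = 0) \<and>
     (\<exists>L. has_sobolev_derivative \<alpha> \<Phi> L u \<and> L u = 0)}"

definition critical_point :: "real \<Rightarrow> ((real ^ 'n \<Rightarrow> real) \<Rightarrow> real) \<Rightarrow> (real ^ 'n \<Rightarrow> real) \<Rightarrow> bool" where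
  "critical_point \<alpha> \<Phi> u \<longleftrightarrow> u \<in> sobolev \<alpha> \<and> has_sobolev_derivative \<alpha> \<Phi> (\<lambda>_. 0) u"

text \<open>The infimum is taken in the extended reals, where it needs no side conditions.\<close>

definition ground_state :: "real \<Rightarrow> ((real ^ 'n \<Rightarrow> real) \<Rightarrow> real) \<Rightarrow> (real ^ 'n \<Rightarrow> real) \<Rightarrow> bool" where
  "ground_state \<alpha> \<Phi> u \<longleftrightarrow> critical_point \<alpha> \<Phi> u \<and> u \<in> nehari \<alpha> \<Phi> \<and>
     ereal (\<Phi> u) = (INF v\<in>nehari \<alpha> \<Phi>. ereal (\<Phi> v))"

end

theory Submission
  imports Defs
begin

text \<open>
  Write \<open>J\<close> for the energy and \<open>W(x) = Vloc x - \<mu> / \<bar>x\<bar>\<^sup>\<alpha>\<close>. The quadratic part of \<open>J\<close> is a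
  \<open>\<int>\<^sup>N\<close>-periodic form plus \<open>\<integral>W u\<^sup>2\<close>, and by hypothesis \<open>W > 0\<close> almost everywhere. A nonzero
  function therefore always profits from being moved to infinity along the lattice: the periodic
  part and the nonlinear part of the energy do not change, while \<open>\<integral>W(x) u(z + x)\<^sup>2 dx\<close> tends to
  \<open>0\<close> and hence falls below \<open>\<integral>W u\<^sup>2\<close>. The two energies differ by a multiple of \<open>t\<^sup>2\<close> along the
  whole ray, so the gain is present at every \<open>t > 0\<close> simultaneously.

  Let \<open>u\<close> be a ground state. Condition (F4) makes \<open>t \<mapsto> J(t u)\<close> maximal at \<open>t = 1\<close>
  (\<open>critical_point_maximises_ray\<close>). Choose a lattice point \<open>z\<close> with
  \<open>\<integral>W v\<^sup>2 < \<integral>W u\<^sup>2\<close> for \<open>v(x) = u(z + x)\<close> (\<open>weight_escapes\<close>), and then \<open>t > 0\<close> with \<open>t v\<close> on the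
  Nehari manifold (\<open>ray_meets_nehari\<close>). Then \<open>J(t v) < J(t u) \<le> J(u) \<le> J(t v)\<close>, which is absurd.

  The work lies in the analysis behind this. Membership of \<open>t v\<close> in the Nehari manifold requires
  \<open>J\<close> to be Frechet differentiable on \<open>H\<^bsup>\<alpha>/2\<^esup>\<close>, so the fractional Hardy and Sobolev inequalities are
  both needed, and both come from one elementary device: average
  \<open>u(x)\<^sup>2 \<le> (1 + \<delta>) u(y)\<^sup>2 + (1 + 1/\<delta>) (u(x) - u(y))\<^sup>2\<close> over a set of points \<open>y\<close> at distance at most
  \<open>d\<close> from \<open>x\<close> and bound the last term by \<open>d\<^bsup>N+\<alpha>\<^esup>\<close> times the Gagliardo kernel. Averaging each dyadic
  annulus around \<open>0\<close> over the next larger one gives a geometric recursion, whose sum is Hardy's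
  inequality on the unit ball (\<open>local_Hardy\<close>). Its local form is what makes
  \<open>\<integral>W(x) u(z + x)\<^sup>2 dx\<close> vanish at infinity, and applied around an arbitrary centre it yields the
  Morrey bound \<open>\<integral>\<^bsub>B(z,r)\<^esub> u\<^sup>2 \<le> C r\<^sup>\<alpha> \<parallel>u\<parallel>\<^sup>2\<close>. Averaging over balls \<open>B(x,r)\<close>, inserting the
  Morrey bound and optimising \<open>r\<close> pointwise gives the critical Sobolev inequality
  (\<open>critical_Sobolev\<close>). Differentiability of the nonlinear part is then a statement about
  Caratheodory functions on \<open>L\<^sup>2 \<inter> L\<^sup>p\<close> (\<open>linearisation_error\<close>).
\<close>

section \<open>Lebesgue measure: products and translations\<close>

lemma sigma_finite_lebesgue: "sigma_finite_measure (lebesgue :: (real^'n) measure)"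
proof -
  obtain A :: "(real^'n) set set" where "countable A" "A \<subseteq> sets lborel" "\<Union>A = space lborel" "\<forall>a\<in>A. emeasure lborel a \<noteq> \<infinity>"
    using sigma_finite_lborel unfolding sigma_finite_measure_def by blast
  then show ?thesis
    by (intro sigma_finite_measure.intro exI[of _ A]) auto
qed

interpretation leb: sigma_finite_measure "lebesgue :: (real^'n) measure"
  by (rule sigma_finite_lebesgue)

interpretation leb2: pair_sigma_finite "lebesgue :: (real^'n) measure" "lebesgue :: (real^'n) measure"
  by unfold_locales

lemma id_measurable_lebesgue_borel [measurable]: "(\<lambda>x. x) \<in> lebesgue \<rightarrow>\<^sub>M (borel :: (real^'n) measure)"
  by (rule measurable_completion) simp

lemma distr_lebesgue_translation: "distr lebesgue lebesgue (\<lambda>x. z + x) = (lebesgue :: (real^'n) measure)"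
  using lebesgue_affine_euclidean[of "\<lambda>_. 1" z] by (simp add: euclidean_representation density_1)

lemma translation_measurable [measurable]: "(\<lambda>x. z + x) \<in> lebesgue \<rightarrow>\<^sub>M (lebesgue :: (real^'n) measure)"
  using lebesgue_affine_measurable[of "\<lambda>_. 1" z] by (simp add: euclidean_representation)

lemma nn_integral_lebesgue_translation:
  assumes [measurable]: "g \<in> borel_measurable lebesgue"
  shows "(\<integral>\<^sup>+x. g (z + x) \<partial>lebesgue) = (\<integral>\<^sup>+x. g x \<partial>(lebesgue :: (real^'n) measure))"
  by (subst (2) distr_lebesgue_translation[of z, symmetric]) (simp add: nn_integral_distr)

lemma AE_lebesgue_translation:
  assumes "AE x in lebesgue. P (x :: real^'n)"
  shows "AE x in lebesgue. P (z + x)"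
proof -
  have "AE x in distr lebesgue lebesgue (\<lambda>x. z + x). P x"
    unfolding distr_lebesgue_translation by (rule assms)
  then show ?thesis
    by (rule AE_distrD[OF translation_measurable])
qed

lemma distr_pair_translation:
  "distr (lebesgue \<Otimes>\<^sub>M lebesgue) (lebesgue \<Otimes>\<^sub>M lebesgue) (\<lambda>(x, y). (z + x, z + y))
   = (lebesgue \<Otimes>\<^sub>M lebesgue :: ((real^'n) \<times> (real^'n)) measure)"
  using pair_measure_distr[of "\<lambda>x. z + x" lebesgue lebesgue "\<lambda>x. z + x" lebesgue lebesgue]
  by (simp add: distr_lebesgue_translation sigma_finite_lebesgue)

lemma nn_integral_pair_translation:
  assumes [measurable]: "g \<in> borel_measurable (lebesgue \<Otimes>\<^sub>M lebesgue)"
  shows "(\<integral>\<^sup>+p. g (z + fst p, z + snd p) \<partial>(lebesgue \<Otimes>\<^sub>M lebesgue))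
       = (\<integral>\<^sup>+p. g p \<partial>(lebesgue \<Otimes>\<^sub>M lebesgue :: ((real^'n) \<times> (real^'n)) measure))"
  by (subst (2) distr_pair_translation[of z, symmetric]) (simp add: nn_integral_distr split_beta)

lemma emeasure_lebesgue_ball:
  "r \<ge> 0 \<Longrightarrow> emeasure lebesgue (ball (c :: real^'n) r) = ennreal (unit_ball_vol (CARD('n)) * r ^ CARD('n))"
  by (simp add: emeasure_ball)

section \<open>A local Hardy inequality\<close>

lemma gagliardo_kernel_nonneg [simp]: "0 \<le> gagliardo_kernel \<alpha> u p"
  by (simp add: gagliardo_kernel_def split_beta)

lemma gagliardo_kernel_measurable [measurable]:
  assumes [measurable]: "u \<in> borel_measurable lebesgue"
  shows "gagliardo_kernel \<alpha> u \<in> borel_measurable (lebesgue \<Otimes>\<^sub>M lebesgue)"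
proof -
  have [measurable]: "(\<lambda>p. fst p - snd p) \<in> borel_measurable (lebesgue \<Otimes>\<^sub>M (lebesgue :: (real^'n) measure))"
    by (intro borel_measurable_diff measurable_compose[OF measurable_fst] measurable_compose[OF measurable_snd]) measurable
  show ?thesis
    unfolding gagliardo_kernel_def split_beta by measurable
qed

text \<open>
  The squared Sobolev norm localised to \<open>A\<close>. It takes values in the extended nonnegative
  reals, so that estimates can be stated for measurable functions before any finiteness is known.
\<close>

definition local_energy :: "real \<Rightarrow> (real ^ 'n \<Rightarrow> real) \<Rightarrow> (real ^ 'n) set \<Rightarrow> ennreal" where
  "local_energy \<alpha> u A = (\<integral>\<^sup>+x. ennreal ((u x)\<^sup>2) * indicator A x \<partial>lebesgue)
     + (\<integral>\<^sup>+p. ennreal (gagliardo_kernel \<alpha> u p) * indicator (A \<times> A) p \<partial>(lebesgue \<Otimes>\<^sub>M lebesgue))"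

lemma young_square:
  fixes a b \<delta> :: real
  assumes "\<delta> > 0"
  shows "a\<^sup>2 \<le> (1 + \<delta>) * b\<^sup>2 + (1 + 1 / \<delta>) * \<bar>a - b\<bar>\<^sup>2"
proof -
  have "0 \<le> (\<delta> * b - (a - b))\<^sup>2 / \<delta>" using assms by simp
  also have "\<dots> = (1 + \<delta>) * b\<^sup>2 + (1 + 1 / \<delta>) * \<bar>a - b\<bar>\<^sup>2 - a\<^sup>2"
    using assms by (simp add: field_simps power2_eq_square)
  finally show ?thesis by simp
qed

text \<open>
  The device on which the Hardy and Sobolev inequalities rest: Young's inequality for the square, integrated over
  the points \<open>y \<in> B\<close>. On \<open>B\<close> the difference \<open>(u x - u y)\<^sup>2\<close> is at most \<open>d\<^bsup>N+\<alpha>\<^esup>\<close> times the kernel.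
\<close>

lemma average_square_le:
  fixes u :: "real^'n \<Rightarrow> real" and \<alpha> :: real
  assumes [measurable]: "u \<in> borel_measurable lebesgue" "B \<in> sets lebesgue"
    and "\<delta> > 0" and "real CARD('n) + \<alpha> \<ge> 0" and d: "\<And>y. y \<in> B \<Longrightarrow> norm (x - y) \<le> d"
  shows "emeasure lebesgue B * ennreal ((u x)\<^sup>2) \<le>
      ennreal (1 + \<delta>) * (\<integral>\<^sup>+y. ennreal ((u y)\<^sup>2) * indicator B y \<partial>lebesgue)
      + ennreal ((1 + 1 / \<delta>) * d powr (real CARD('n) + \<alpha>))
        * (\<integral>\<^sup>+y. ennreal (gagliardo_kernel \<alpha> u (x, y)) * indicator B y \<partial>lebesgue)"
proof -
  have pt: "(u x)\<^sup>2 \<le> (1 + \<delta>) * (u y)\<^sup>2 + ((1 + 1 / \<delta>) * d powr (real CARD('n) + \<alpha>)) * gagliardo_kernel \<alpha> u (x, y)"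
    if "y \<in> B" for y
  proof -
    have "\<bar>u x - u y\<bar>\<^sup>2 \<le> d powr (real CARD('n) + \<alpha>) * gagliardo_kernel \<alpha> u (x, y)"
    proof (cases "x = y")
      case False
      then have "\<bar>u x - u y\<bar>\<^sup>2 = norm (x - y) powr (CARD('n) + \<alpha>) * gagliardo_kernel \<alpha> u (x, y)"
        by (simp add: gagliardo_kernel_def)
      also have "\<dots> \<le> d powr (real CARD('n) + \<alpha>) * gagliardo_kernel \<alpha> u (x, y)"
        using d[OF that] assms by (intro mult_right_mono powr_mono2) auto
      finally show ?thesis .
    qed simp
    then have "(1 + 1 / \<delta>) * \<bar>u x - u y\<bar>\<^sup>2 \<le> (1 + 1 / \<delta>) * (d powr (real CARD('n) + \<alpha>) * gagliardo_kernel \<alpha> u (x, y))"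
      using assms by (intro mult_left_mono) auto
    then show ?thesis using young_square[OF \<open>\<delta> > 0\<close>, of "u x" "u y"] by (simp add: mult.assoc)
  qed
  have "emeasure lebesgue B * ennreal ((u x)\<^sup>2) = (\<integral>\<^sup>+y. ennreal ((u x)\<^sup>2) * indicator B y \<partial>lebesgue)"
    by (subst nn_integral_cmult_indicator) (simp_all add: mult.commute del: emeasure_completion)
  also have "\<dots> \<le> (\<integral>\<^sup>+y. ennreal (1 + \<delta>) * (ennreal ((u y)\<^sup>2) * indicator B y)
      + ennreal ((1 + 1 / \<delta>) * d powr (real CARD('n) + \<alpha>)) * (ennreal (gagliardo_kernel \<alpha> u (x, y)) * indicator B y) \<partial>lebesgue)"
    using pt assms
    by (intro nn_integral_mono) (auto split: split_indicator simp flip: ennreal_mult ennreal_plus intro!: ennreal_leI)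
  also have "\<dots> = ennreal (1 + \<delta>) * (\<integral>\<^sup>+y. ennreal ((u y)\<^sup>2) * indicator B y \<partial>lebesgue)
      + ennreal ((1 + 1 / \<delta>) * d powr (real CARD('n) + \<alpha>))
        * (\<integral>\<^sup>+y. ennreal (gagliardo_kernel \<alpha> u (x, y)) * indicator B y \<partial>lebesgue)"
    by (subst nn_integral_add) (auto simp: nn_integral_cmult)
  finally show ?thesis .
qed

text \<open>
  The previous estimate integrated over \<open>x \<in> A\<close>.
\<close>

lemma average_square_le2:
  fixes u :: "real^'n \<Rightarrow> real" and \<alpha> :: real
  assumes [measurable]: "u \<in> borel_measurable lebesgue" "A \<in> sets lebesgue" "B \<in> sets lebesgue"
    and "\<delta> > 0" and "real CARD('n) + \<alpha> \<ge> 0" and d: "\<And>x y. x \<in> A \<Longrightarrow> y \<in> B \<Longrightarrow> norm (x - y) \<le> d"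
  shows "emeasure lebesgue B * (\<integral>\<^sup>+x. ennreal ((u x)\<^sup>2) * indicator A x \<partial>lebesgue) \<le>
      ennreal (1 + \<delta>) * emeasure lebesgue A * (\<integral>\<^sup>+y. ennreal ((u y)\<^sup>2) * indicator B y \<partial>lebesgue)
      + ennreal ((1 + 1 / \<delta>) * d powr (real CARD('n) + \<alpha>))
        * (\<integral>\<^sup>+p. ennreal (gagliardo_kernel \<alpha> u p) * indicator (A \<times> B) p \<partial>(lebesgue \<Otimes>\<^sub>M lebesgue))"
proof -
  let ?U = "\<integral>\<^sup>+y. ennreal ((u y)\<^sup>2) * indicator B y \<partial>lebesgue"
  let ?c = "ennreal ((1 + 1 / \<delta>) * d powr (real CARD('n) + \<alpha>))"
  have "emeasure lebesgue B * (\<integral>\<^sup>+x. ennreal ((u x)\<^sup>2) * indicator A x \<partial>lebesgue)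
      = (\<integral>\<^sup>+x. emeasure lebesgue B * ennreal ((u x)\<^sup>2) * indicator A x \<partial>lebesgue)"
    by (simp add: nn_integral_cmult mult.assoc)
  also have "\<dots> \<le> (\<integral>\<^sup>+x. (ennreal (1 + \<delta>) * ?U) * indicator A x
       + ?c * (\<integral>\<^sup>+y. ennreal (gagliardo_kernel \<alpha> u (x, y)) * indicator (A \<times> B) (x, y) \<partial>lebesgue) \<partial>lebesgue)"
  proof (intro nn_integral_mono)
    fix x
    show "emeasure lebesgue B * ennreal ((u x)\<^sup>2) * indicator A x \<le> (ennreal (1 + \<delta>) * ?U) * indicator A x
       + ?c * (\<integral>\<^sup>+y. ennreal (gagliardo_kernel \<alpha> u (x, y)) * indicator (A \<times> B) (x, y) \<partial>lebesgue)"
    proof (cases "x \<in> A")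
      case True
      have "indicator (A \<times> B) (x, y) = (indicator B y :: ennreal)" for y
        using True by (simp add: indicator_def)
      then show ?thesis
        using True average_square_le[OF assms(1,3,4,5), of x d] d by simp
    qed simp
  qed
  also have "\<dots> = ennreal (1 + \<delta>) * emeasure lebesgue A * ?U
     + ?c * (\<integral>\<^sup>+p. ennreal (gagliardo_kernel \<alpha> u p) * indicator (A \<times> B) p \<partial>(lebesgue \<Otimes>\<^sub>M lebesgue))"
  proof -
    have m: "(\<lambda>p. ennreal (gagliardo_kernel \<alpha> u p) * indicator (A \<times> B) p) \<in> borel_measurable (lebesgue \<Otimes>\<^sub>M lebesgue)"
      by measurable
    then have m2: "(\<lambda>x. \<integral>\<^sup>+y. ennreal (gagliardo_kernel \<alpha> u (x, y)) * indicator (A \<times> B) (x, y) \<partial>lebesgue) \<in> borel_measurable lebesgue"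
      using leb.borel_measurable_nn_integral_fst[OF m] by simp
    have "(\<integral>\<^sup>+x. (ennreal (1 + \<delta>) * ?U) * indicator A x \<partial>lebesgue) = ennreal (1 + \<delta>) * ?U * emeasure lebesgue A"
      by (rule nn_integral_cmult_indicator) simp
    then show ?thesis
      using leb.nn_integral_fst[OF m] m2
      by (subst nn_integral_add) (simp_all add: nn_integral_cmult mult_ac del: emeasure_completion)
  qed
  finally show ?thesis .
qed

definition dyadic_annulus :: "nat \<Rightarrow> (real ^ 'n) set" where
  "dyadic_annulus k = ball 0 ((1/2) ^ k) - ball 0 ((1/2) ^ Suc k)"

lemma dyadic_annulus_measurable [measurable]: "dyadic_annulus k \<in> sets lebesgue"
  by (simp add: dyadic_annulus_def sets.Diff)

lemma disjoint_dyadic_annulus: "disjoint_family (dyadic_annulus :: nat \<Rightarrow> (real^'n) set)"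
proof -
  have "dyadic_annulus i \<inter> dyadic_annulus j = ({} :: (real^'n) set)" if "i < j" for i j
  proof -
    have "(1/2::real) ^ j \<le> (1/2) ^ Suc i"
      using that by (intro power_decreasing) auto
    then show ?thesis by (auto simp: dyadic_annulus_def)
  qed
  then show ?thesis
    unfolding disjoint_family_on_def by (metis Int_commute linorder_neqE_nat)
qed

lemma UN_dyadic_annulus: "(\<Union>k. dyadic_annulus k) = ball 0 1 - {0 :: real^'n}"
proof (intro set_eqI iffI)
  fix x :: "real^'n"
  assume "x \<in> (\<Union>k. dyadic_annulus k)"
  then obtain k where k: "norm x < (1/2) ^ k" "norm x \<ge> (1/2) ^ Suc k"
    by (auto simp: dyadic_annulus_def)
  have "(1/2::real) ^ k \<le> 1" by (rule power_le_one) auto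
  moreover have "0 < norm x"
    by (rule less_le_trans[OF _ k(2)]) simp
  ultimately show "x \<in> ball 0 1 - {0}" using k by auto
next
  fix x :: "real^'n"
  assume x: "x \<in> ball 0 1 - {0}"
  obtain n where n: "(1/2) ^ n < norm x"
    using real_arch_pow_inv[of "norm x" "1/2"] x by auto
  define m where "m = (LEAST n. (1/2::real) ^ n \<le> norm x)"
  have m: "(1/2::real) ^ m \<le> norm x"
    unfolding m_def by (rule LeastI[of _ n]) (use n in simp)
  have "m \<noteq> 0" using m x by (intro notI) auto
  then obtain k where k: "m = Suc k" by (cases m) auto
  have "\<not> (1/2::real) ^ k \<le> norm x"
    by (rule not_less_Least) (use k in \<open>simp add: m_def\<close>)
  then show "x \<in> (\<Union>k. dyadic_annulus k)"
    using m k by (auto simp: dyadic_annulus_def intro!: exI[of _ k])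
qed

lemma emeasure_dyadic_annulus:
  "emeasure lebesgue (dyadic_annulus k :: (real^'n) set)
   = ennreal (unit_ball_vol (CARD('n)) * (1 - (1/2) ^ CARD('n)) * ((1/2) ^ k) ^ CARD('n))"
proof -
  have "emeasure lebesgue (dyadic_annulus k :: (real^'n) set)
      = emeasure lebesgue (ball (0::real^'n) ((1/2)^k)) - emeasure lebesgue (ball (0::real^'n) ((1/2)^Suc k))"
    unfolding dyadic_annulus_def
    using emeasure_lborel_ball_finite[of "0 :: real^'n" "(1/2) ^ Suc k"]
    by (intro emeasure_Diff) (auto intro!: subset_ball)
  also have "\<dots> = ennreal (unit_ball_vol (CARD('n)) * ((1/2) ^ k) ^ CARD('n) 
      - unit_ball_vol (CARD('n)) * ((1/2) ^ Suc k) ^ CARD('n))"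
    by (simp add: emeasure_lebesgue_ball ennreal_minus unit_ball_vol_nonneg del: power_Suc emeasure_completion)
  also have "((1/2::real) ^ Suc k) ^ CARD('n) = (1/2) ^ CARD('n) * ((1/2) ^ k) ^ CARD('n)"
    by (simp add: power_mult_distrib power_divide flip: power_mult)
  finally show ?thesis by (simp add: algebra_simps)
qed

lemma ennreal_mult_mult:
  "0 \<le> a \<Longrightarrow> 0 \<le> b \<Longrightarrow> ennreal a * (ennreal b * Y) = ennreal (a * b) * Y"
  by (simp add: ennreal_mult mult.assoc)

text \<open>
  Summing the recursion and absorbing \<open>\<kappa> \<Sum>H\<close> on the left would need a finite sum. Bounding the
  partial sums by induction avoids this.
\<close>

lemma geometric_recursion_sum:
  fixes H g :: "nat \<Rightarrow> ennreal"
  assumes k: "0 \<le> \<kappa>" "\<kappa> < 1" and step: "\<And>k. H (Suc k) \<le> ennreal \<kappa> * H k + g k"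
  shows "(\<Sum>k. H k) \<le> ennreal (1 / (1 - \<kappa>)) * (H 0 + (\<Sum>k. g k))"
proof (rule suminf_le_const[OF summableI])
  fix n
  let ?T = "H 0 + (\<Sum>k. g k)" and ?c = "ennreal (1 / (1 - \<kappa>))"
  have c: "1 + ennreal \<kappa> * ?c = ?c"
  proof -
    have "1 + ennreal \<kappa> * ?c = ennreal 1 + ennreal (\<kappa> * (1 / (1 - \<kappa>)))"
      using k by (subst ennreal_mult) auto
    also have "\<dots> = ennreal (1 + \<kappa> * (1 / (1 - \<kappa>)))"
      using k by (subst ennreal_plus) auto
    also have "1 + \<kappa> * (1 / (1 - \<kappa>)) = 1 / (1 - \<kappa>)" using k by (simp add: field_simps)
    finally show ?thesis .
  qed
  show "sum H {..<n} \<le> ?c * ?T"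
  proof (induction n)
    case (Suc n)
    have "sum H {..<Suc n} = H 0 + (\<Sum>k<n. H (Suc k))"
      by (rule sum.lessThan_Suc_shift)
    also have "\<dots> \<le> H 0 + (\<Sum>k<n. ennreal \<kappa> * H k + g k)"
      by (intro add_mono sum_mono step order_refl)
    also have "\<dots> = (H 0 + (\<Sum>k<n. g k)) + ennreal \<kappa> * sum H {..<n}"
      by (simp add: sum.distrib sum_distrib_left add_ac)
    also have "\<dots> \<le> ?T + ennreal \<kappa> * (?c * ?T)"
      by (intro add_mono mult_left_mono Suc order_refl sum_le_suminf summableI) auto
    also have "\<dots> = (1 + ennreal \<kappa> * ?c) * ?T" by (simp add: algebra_simps)
    finally show ?case by (simp only: c)
  qed simp
qed

text \<open>
  Let \<open>H k\<close> be \<open>2\<^bsup>k\<alpha>\<^esup>\<close> times the integral of \<open>u\<^sup>2\<close> over the \<open>k\<close>-th annulus; the left-hand side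
  is at most \<open>2\<^sup>\<alpha> \<Sum>H k\<close>. Averaging the annulus \<open>k + 1\<close> over the annulus \<open>k\<close> gives
  \<open>H (k + 1) \<le> (1 + \<delta>) 2\<^bsup>\<alpha>-N\<^esup> H k + C G k\<close>, where the factor \<open>2\<^bsup>-N\<^esup>\<close> is the ratio of the volumes and
  \<open>G k\<close> is the kernel integrated over the product of both annuli. As \<open>\<alpha> < N\<close>, the recursion is
  contractive for small \<open>\<delta>\<close>, and the products of annuli are disjoint, so \<open>\<Sum>G k\<close> is bounded by the
  double integral over the ball.
\<close>

lemma local_Hardy:
  fixes \<alpha> :: real
  assumes \<alpha>: "0 < \<alpha>" "\<alpha> < real CARD('n)"
  shows "\<exists>C\<ge>0. \<forall>u \<in> borel_measurable lebesgue.
     (\<integral>\<^sup>+x. ennreal ((u x)\<^sup>2 / norm x powr \<alpha>) * indicator (ball 0 1) x \<partial>lebesgue)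
       \<le> ennreal C * local_energy \<alpha> u (ball (0 :: real^'n) 1)"
proof -
  define N where "N = real CARD('n)"
  \<comment> \<open>This choice makes the contraction factor \<open>\<kappa>\<close> the square root of \<open>2\<^bsup>\<alpha>-N\<^esup>\<close>.\<close>
  define \<delta> where "\<delta> = 2 powr ((N - \<alpha>) / 2) - 1"
  define \<kappa> where "\<kappa> = 2 powr (- ((N - \<alpha>) / 2))"
  define \<omega> where "\<omega> = unit_ball_vol (CARD('n)) * (1 - (1/2) ^ CARD('n))"
  define C where "C = 2 powr \<alpha> * (1 + 1 / \<delta>) * 2 powr (N + \<alpha>) / \<omega>"
  have N: "\<alpha> < N" "0 < N" using \<alpha> by (simp_all add: N_def)
  have \<delta>: "\<delta> > 0" unfolding \<delta>_def using N gr_one_powr[of 2 "(N - \<alpha>) / 2"] by simp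
  have \<kappa>: "0 \<le> \<kappa>" "\<kappa> < 1"
    using \<delta> unfolding \<kappa>_def \<delta>_def by (auto simp: powr_minus inverse_less_1_iff)
  have \<delta>\<kappa>: "(1 + \<delta>) * 2 powr (\<alpha> - N) = \<kappa>"
  proof -
    have 1: "1 + \<delta> = 2 powr ((N - \<alpha>) / 2)" by (simp add: \<delta>_def)
    show ?thesis
      unfolding 1 \<kappa>_def powr_add[symmetric]
      by (rule arg_cong[where f = "(powr) 2"]) (simp add: field_simps)
  qed
  have \<omega>: "\<omega> > 0" unfolding \<omega>_def by (simp add: power_less_one_iff unit_ball_vol_pos)
  have C: "C > 0" unfolding C_def using \<delta> \<omega> by (intro divide_pos_pos mult_pos_pos add_pos_pos) auto
  define D where "D = 2 powr \<alpha> + C"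
  show ?thesis
  proof (intro exI[of _ "1 / (1 - \<kappa>) * 2 powr \<alpha> * D"] conjI ballI)
    show "0 \<le> 1 / (1 - \<kappa>) * 2 powr \<alpha> * D" using \<kappa> C unfolding D_def by (intro mult_nonneg_nonneg divide_nonneg_nonneg add_nonneg_nonneg) auto
    fix u :: "real^'n \<Rightarrow> real"
    assume [measurable]: "u \<in> borel_measurable lebesgue"
    define X where "X k = (\<integral>\<^sup>+x. ennreal ((u x)\<^sup>2) * indicator (dyadic_annulus k) x \<partial>lebesgue)" for k
    define G where "G k = (\<integral>\<^sup>+p. ennreal (gagliardo_kernel \<alpha> u p) * indicator (dyadic_annulus (Suc k) \<times> dyadic_annulus k) p
       \<partial>(lebesgue \<Otimes>\<^sub>M lebesgue))" for k
    define H where "H k = ennreal (2 powr (real k * \<alpha>)) * X k" for k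
    define r where "r k = (1/2::real) ^ k" for k :: nat
    have r: "r k > 0" "r k = 2 powr (- real k)" for k
      by (simp_all add: r_def powr_minus powr_realpow power_one_over inverse_eq_divide)
    have rN: "r k ^ CARD('n) = 2 powr (- real k * N)" for k
      by (simp add: r powr_realpow[symmetric] N_def powr_powr)
    have e: "emeasure lebesgue (dyadic_annulus k :: (real^'n) set) = ennreal (\<omega> * 2 powr (- real k * N))" for k
      unfolding emeasure_dyadic_annulus \<omega>_def[symmetric] using rN[of k] by (simp add: r_def)
    have step: "H (Suc k) \<le> ennreal \<kappa> * H k + ennreal C * G k" for k
    proof -
      have "norm (x - y) \<le> 2 * r k" if "x \<in> dyadic_annulus (Suc k)" "y \<in> dyadic_annulus k" for x y :: "real^'n"
        using that norm_triangle_ineq4[of x y] by (auto simp: dyadic_annulus_def r_def)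
      from average_square_le2[where A = "dyadic_annulus (Suc k)" and B = "dyadic_annulus k" and \<alpha> = \<alpha>,
          OF \<open>u \<in> _\<close> dyadic_annulus_measurable dyadic_annulus_measurable \<delta> _ this]
      have "ennreal (\<omega> * 2 powr (- real k * N)) * X (Suc k)
        \<le> ennreal (1 + \<delta>) * ennreal (\<omega> * 2 powr (- real (Suc k) * N)) * X k
          + ennreal ((1 + 1 / \<delta>) * (2 * r k) powr (N + \<alpha>)) * G k"
        using \<alpha> unfolding e X_def[symmetric] G_def[symmetric] by (simp only: N_def)
      then have *: "ennreal (2 powr (real (Suc k) * \<alpha>) / (\<omega> * 2 powr (- real k * N)))
          * (ennreal (\<omega> * 2 powr (- real k * N)) * X (Suc k))
        \<le> ennreal (2 powr (real (Suc k) * \<alpha>) / (\<omega> * 2 powr (- real k * N)))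
        * (ennreal (1 + \<delta>) * ennreal (\<omega> * 2 powr (- real (Suc k) * N)) * X k
          + ennreal ((1 + 1 / \<delta>) * (2 * r k) powr (N + \<alpha>)) * G k)"
        by (rule mult_left_mono) simp
      have 1: "2 powr (real (Suc k) * \<alpha>) / (\<omega> * 2 powr (- real k * N)) * (\<omega> * 2 powr (- real k * N)) = 2 powr (real (Suc k) * \<alpha>)"
        using \<omega> by simp
      have 2: "2 powr (real (Suc k) * \<alpha>) / (\<omega> * 2 powr (- real k * N)) * ((1 + \<delta>) * (\<omega> * 2 powr (- real (Suc k) * N)))
           = \<kappa> * 2 powr (real k * \<alpha>)"
      proof -
        have "2 powr (real (Suc k) * \<alpha>) / (\<omega> * 2 powr (- real k * N)) * ((1 + \<delta>) * (\<omega> * 2 powr (- real (Suc k) * N)))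
          = (1 + \<delta>) * (2 powr (real (Suc k) * \<alpha>) / 2 powr (- real k * N) * 2 powr (- real (Suc k) * N))"
        proof -
          have "a / (w * b) * (c * (w * d)) = c * (a / b * d)" if "w > 0" for a b c d w :: real
            using that by simp
          from this[OF \<omega>] show ?thesis .
        qed
        also have "2 powr (real (Suc k) * \<alpha>) / 2 powr (- real k * N) * 2 powr (- real (Suc k) * N) 
           = 2 powr (\<alpha> - N) * 2 powr (real k * \<alpha>)"
          unfolding powr_add[symmetric] powr_diff[symmetric]
          by (rule arg_cong[where f = "(powr) 2"]) (simp add: algebra_simps)
        finally show ?thesis using \<delta>\<kappa> by (simp add: mult.assoc)
      qed
      have 3: "2 powr (real (Suc k) * \<alpha>) / (\<omega> * 2 powr (- real k * N)) * ((1 + 1 / \<delta>) * (2 * r k) powr (N + \<alpha>)) = C"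
      proof -
        have A: "(2 * r k) powr (N + \<alpha>) = 2 powr (N + \<alpha>) * 2 powr (- real k * (N + \<alpha>))"
          by (simp add: r powr_mult powr_powr)
        have B: "2 powr (real (Suc k) * \<alpha>) / 2 powr (- real k * N) * 2 powr (- real k * (N + \<alpha>)) = 2 powr \<alpha>"
          unfolding powr_add[symmetric] powr_diff[symmetric]
          by (rule arg_cong[where f = "(powr) 2"]) (simp add: algebra_simps)
        have "a / (b * c) * (d * (e * f)) = a / c * f * d * e / b" for a b c d e f :: real
          by (simp add: divide_inverse mult_ac)
        then show ?thesis unfolding C_def A B[symmetric] by blast
      qed
      let ?c = "2 powr (real (Suc k) * \<alpha>) / (\<omega> * 2 powr (- real k * N))"
      have c: "?c \<ge> 0" using \<omega> by simp
      have "H (Suc k) = ennreal ?c * (ennreal (\<omega> * 2 powr (- real k * N)) * X (Suc k))"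
        unfolding H_def by (subst ennreal_mult_mult[OF c]) (use \<omega> 1 in auto)
      also have "\<dots> \<le> ennreal ?c * (ennreal ((1 + \<delta>) * (\<omega> * 2 powr (- real (Suc k) * N))) * X k
          + ennreal ((1 + 1 / \<delta>) * (2 * r k) powr (N + \<alpha>)) * G k)"
        using * \<delta> \<omega> by (subst ennreal_mult) auto
      also have "\<dots> = ennreal (\<kappa> * 2 powr (real k * \<alpha>)) * X k + ennreal C * G k"
        unfolding distrib_left by (subst (1 2) ennreal_mult_mult[OF c]) (use \<delta> \<omega> 2 3 in auto)
      finally show ?thesis
        unfolding H_def using \<kappa> by (subst ennreal_mult_mult) auto
    qed
    have "(\<integral>\<^sup>+x. ennreal ((u x)\<^sup>2 / norm x powr \<alpha>) * indicator (ball 0 1) x \<partial>lebesgue)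
       \<le> (\<integral>\<^sup>+x. (\<Sum>k. ennreal (2 powr \<alpha>) * (ennreal (2 powr (real k * \<alpha>)) * (ennreal ((u x)\<^sup>2) * indicator (dyadic_annulus k) x))) \<partial>lebesgue)"
    proof (intro nn_integral_mono)
      fix x :: "real^'n"
      show "ennreal ((u x)\<^sup>2 / norm x powr \<alpha>) * indicator (ball 0 1) x
        \<le> (\<Sum>k. ennreal (2 powr \<alpha>) * (ennreal (2 powr (real k * \<alpha>)) * (ennreal ((u x)\<^sup>2) * indicator (dyadic_annulus k) x)))"
        (is "_ \<le> suminf ?f")
      proof (cases "x \<in> ball 0 1 - {0}")
        case True
        then obtain k where k: "x \<in> dyadic_annulus k" using UN_dyadic_annulus by blast
        then have rk: "norm x \<ge> r (Suc k)" by (auto simp: dyadic_annulus_def r_def)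
        have "2 powr (- real (Suc k) * \<alpha>) = r (Suc k) powr \<alpha>" unfolding r powr_powr ..
        also have "\<dots> \<le> norm x powr \<alpha>" using rk r[of "Suc k"] \<alpha> by (intro powr_mono2) auto
        finally have "(u x)\<^sup>2 / norm x powr \<alpha> \<le> (u x)\<^sup>2 / 2 powr (- real (Suc k) * \<alpha>)"
          by (intro divide_left_mono) (use True in auto)
        also have "\<dots> = 2 powr \<alpha> * (2 powr (real k * \<alpha>) * (u x)\<^sup>2)"
        proof -
          have "2 powr (real (Suc k) * \<alpha>) = 2 powr \<alpha> * 2 powr (real k * \<alpha>)"
            by (simp add: powr_add distrib_right)
          then show ?thesis
            unfolding mult_minus_left powr_minus by (simp add: divide_inverse del: of_nat_Suc)
        qed
        finally have "ennreal ((u x)\<^sup>2 / norm x powr \<alpha>) * indicator (ball 0 1) x \<le> ?f k"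
          using True k by (simp flip: ennreal_mult add: ennreal_leI)
        also have "\<dots> \<le> suminf ?f" using sum_le_suminf[OF summableI, of "{k}" ?f] by simp
        finally show ?thesis .
      qed auto
    qed
    also have "\<dots> = ennreal (2 powr \<alpha>) * (\<Sum>k. H k)"
      by (simp add: nn_integral_suminf nn_integral_cmult H_def X_def)
    finally have I1: "(\<integral>\<^sup>+x. ennreal ((u x)\<^sup>2 / norm x powr \<alpha>) * indicator (ball 0 1) x \<partial>lebesgue)
      \<le> ennreal (2 powr \<alpha>) * (\<Sum>k. H k)" .
    have I2: "(\<Sum>k. H k) \<le> ennreal (1 / (1 - \<kappa>)) * (H 0 + (\<Sum>k. ennreal C * G k))"
      by (rule geometric_recursion_sum[where g = "\<lambda>k. ennreal C * G k", OF \<kappa> step])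
    have "(\<Sum>k. G k) = (\<integral>\<^sup>+p. ennreal (gagliardo_kernel \<alpha> u p) * (\<Sum>k. indicator (dyadic_annulus (Suc k) \<times> dyadic_annulus k) p)
       \<partial>(lebesgue \<Otimes>\<^sub>M lebesgue))"
      unfolding G_def ennreal_suminf_cmult[symmetric] by (rule nn_integral_suminf[symmetric]) measurable
    also have "\<dots> \<le> (\<integral>\<^sup>+p. ennreal (gagliardo_kernel \<alpha> u p) * indicator (ball 0 1 \<times> ball 0 1) p \<partial>(lebesgue \<Otimes>\<^sub>M lebesgue))"
    proof (intro nn_integral_mono mult_left_mono)
      fix p :: "(real^'n) \<times> (real^'n)"
      have "disjoint_family (\<lambda>k. dyadic_annulus (Suc k) \<times> (dyadic_annulus k :: (real^'n) set))"
        using disjoint_dyadic_annulus unfolding disjoint_family_on_def by blast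
      then have "(\<Sum>k. indicator (dyadic_annulus (Suc k) \<times> dyadic_annulus k) p) 
         = (indicator (\<Union>k. dyadic_annulus (Suc k) \<times> dyadic_annulus k) p :: ennreal)"
        by (rule suminf_indicator)
      also have "\<dots> \<le> indicator (ball 0 1 \<times> ball 0 1) p"
        using UN_dyadic_annulus[where 'n='n] by (intro indicator_leI) blast
      finally show "(\<Sum>k. indicator (dyadic_annulus (Suc k) \<times> dyadic_annulus k) p) \<le> (indicator (ball 0 1 \<times> ball 0 1) p :: ennreal)" .
    qed simp
    finally have I3: "(\<Sum>k. G k) \<le> (\<integral>\<^sup>+p. ennreal (gagliardo_kernel \<alpha> u p) * indicator (ball 0 1 \<times> ball 0 1) p \<partial>(lebesgue \<Otimes>\<^sub>M lebesgue))" .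
    have I4: "H 0 \<le> ennreal (2 powr \<alpha>) * (\<integral>\<^sup>+x. ennreal ((u x)\<^sup>2) * indicator (ball 0 1) x \<partial>lebesgue)"
    proof -
      have "H 0 \<le> (\<integral>\<^sup>+x. ennreal ((u x)\<^sup>2) * indicator (ball 0 1) x \<partial>lebesgue)"
      proof -
        have "dyadic_annulus 0 \<subseteq> ball (0::real^'n) 1" by (auto simp: dyadic_annulus_def)
        then have "X 0 \<le> (\<integral>\<^sup>+x. ennreal ((u x)\<^sup>2) * indicator (ball 0 1) x \<partial>lebesgue)"
          unfolding X_def by (intro nn_integral_mono mult_left_mono indicator_leI) auto
        then show ?thesis by (simp add: H_def)
      qed
      also have "\<dots> \<le> ennreal (2 powr \<alpha>) * (\<integral>\<^sup>+x. ennreal ((u x)\<^sup>2) * indicator (ball 0 1) x \<partial>lebesgue)"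
      proof -
        have "(1::ennreal) \<le> ennreal (2 powr \<alpha>)"
          using ennreal_leI[of 1 "2 powr \<alpha>"] \<alpha> by (simp add: ge_one_powr_ge_zero)
        from mult_right_mono[OF this] show ?thesis by simp
      qed
      finally show ?thesis .
    qed
    have "H 0 + (\<Sum>k. ennreal C * G k) \<le> ennreal D * local_energy \<alpha> u (ball 0 1)"
    proof -
      have "H 0 \<le> ennreal D * (\<integral>\<^sup>+x. ennreal ((u x)\<^sup>2) * indicator (ball 0 1) x \<partial>lebesgue)"
        using C by (intro order_trans[OF I4] mult_right_mono ennreal_leI) (auto simp: D_def)
      moreover have "(\<Sum>k. ennreal C * G k) \<le> ennreal D * (\<integral>\<^sup>+p. ennreal (gagliardo_kernel \<alpha> u p) * indicator (ball 0 1 \<times> ball 0 1) p \<partial>(lebesgue \<Otimes>\<^sub>M lebesgue))"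
        unfolding ennreal_suminf_cmult by (intro mult_mono ennreal_leI I3) (auto simp: D_def)
      ultimately show ?thesis
        unfolding local_energy_def distrib_left by (rule add_mono)
    qed
    then have "ennreal (2 powr \<alpha>) * (\<Sum>k. H k) \<le> ennreal (2 powr \<alpha>) * (ennreal (1 / (1 - \<kappa>)) * (ennreal D * local_energy \<alpha> u (ball 0 1)))"
      by (intro mult_left_mono order_trans[OF I2]) auto
    also have "\<dots> = ennreal (1 / (1 - \<kappa>) * 2 powr \<alpha> * D) * local_energy \<alpha> u (ball 0 1)"
          proof -
      have "0 \<le> D" using C by (simp add: D_def)
      then show ?thesis using \<kappa> by (simp add: ennreal_mult_mult mult_ac)
    qed
    finally show "(\<integral>\<^sup>+x. ennreal ((u x)\<^sup>2 / norm x powr \<alpha>) * indicator (ball 0 1) x \<partial>lebesgue)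
       \<le> ennreal (1 / (1 - \<kappa>) * 2 powr \<alpha> * D) * local_energy \<alpha> u (ball 0 1)"
      by (rule order_trans[OF I1])
  qed
qed

section \<open>Morrey and Sobolev estimates\<close>

lemma ball_sets_lebesgue [measurable]: "ball z r \<in> sets (lebesgue :: (real^'n) measure)"
  by simp

lemma local_energy_mono:
  assumes "A \<subseteq> B"
  shows "local_energy \<alpha> u A \<le> local_energy \<alpha> u B"
  unfolding local_energy_def
  using assms by (intro add_mono nn_integral_mono mult_left_mono indicator_leI) auto

lemma local_energy_translation:
  fixes u :: "real^'n \<Rightarrow> real"
  assumes [measurable]: "u \<in> borel_measurable lebesgue" "A \<in> sets lebesgue"
  shows "local_energy \<alpha> (\<lambda>x. u (z + x)) {x. z + x \<in> A} = local_energy \<alpha> u A"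
proof -
  have "(\<integral>\<^sup>+x. ennreal ((u (z + x))\<^sup>2) * indicator {x. z + x \<in> A} x \<partial>lebesgue)
     = (\<integral>\<^sup>+x. (\<lambda>x. ennreal ((u x)\<^sup>2) * indicator A x) (z + x) \<partial>lebesgue)"
    by (simp add: indicator_def)
  also have "\<dots> = (\<integral>\<^sup>+x. ennreal ((u x)\<^sup>2) * indicator A x \<partial>lebesgue)"
    by (rule nn_integral_lebesgue_translation) measurable
  finally have 1: "(\<integral>\<^sup>+x. ennreal ((u (z + x))\<^sup>2) * indicator {x. z + x \<in> A} x \<partial>lebesgue)
     = (\<integral>\<^sup>+x. ennreal ((u x)\<^sup>2) * indicator A x \<partial>lebesgue)" .
  have "(\<integral>\<^sup>+p. ennreal (gagliardo_kernel \<alpha> (\<lambda>x. u (z + x)) p) * indicator ({x. z + x \<in> A} \<times> {x. z + x \<in> A}) p \<partial>(lebesgue \<Otimes>\<^sub>M lebesgue))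
    = (\<integral>\<^sup>+p. (\<lambda>p. ennreal (gagliardo_kernel \<alpha> u p) * indicator (A \<times> A) p) (z + fst p, z + snd p) \<partial>(lebesgue \<Otimes>\<^sub>M lebesgue))"
    by (intro nn_integral_cong) (auto simp: gagliardo_kernel_def indicator_def)
  also have "\<dots> = (\<integral>\<^sup>+p. ennreal (gagliardo_kernel \<alpha> u p) * indicator (A \<times> A) p \<partial>(lebesgue \<Otimes>\<^sub>M lebesgue))"
    by (rule nn_integral_pair_translation) measurable
  finally show ?thesis using 1 by (simp add: local_energy_def)
qed

lemma translate_ball: "{x. z + x \<in> ball z r} = ball (0 :: real^'n) r"
  by (auto simp: dist_norm)

lemma measurable_lebesgue_translate [measurable (raw)]:
  fixes u :: "real^'n \<Rightarrow> real"
  assumes "u \<in> borel_measurable lebesgue"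
  shows "(\<lambda>x. u (z + x)) \<in> borel_measurable lebesgue"
  using measurable_compose[OF translation_measurable assms] .

text \<open>
  For \<open>r \<le> 1\<close> this is Hardy's inequality centred at \<open>z\<close>, because \<open>1 \<le> r\<^sup>\<alpha> / \<bar>x - z\<bar>\<^sup>\<alpha>\<close> on the
  ball; for \<open>r > 1\<close> it is trivial.
\<close>

lemma Morrey_bound:
  fixes \<alpha> :: real
  assumes \<alpha>: "0 < \<alpha>" "\<alpha> < real CARD('n)"
  shows "\<exists>C\<ge>1. \<forall>u \<in> borel_measurable lebesgue. \<forall>z r. r > 0 \<longrightarrow>
     (\<integral>\<^sup>+x. ennreal ((u x)\<^sup>2) * indicator (ball z r) x \<partial>lebesgue)
       \<le> ennreal (C * r powr \<alpha>) * local_energy \<alpha> u (UNIV :: (real^'n) set)"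
proof -
  obtain C where C: "C \<ge> 0" and hardy: "\<And>u. u \<in> borel_measurable lebesgue \<Longrightarrow>
     (\<integral>\<^sup>+x. ennreal ((u x)\<^sup>2 / norm x powr \<alpha>) * indicator (ball 0 1) x \<partial>lebesgue)
       \<le> ennreal C * local_energy \<alpha> u (ball (0 :: real^'n) 1)"
    using local_Hardy[OF \<alpha>] by blast
  show ?thesis
  proof (intro exI[of _ "max 1 C"] conjI ballI allI impI)
    fix u :: "real^'n \<Rightarrow> real" and z :: "real^'n" and r :: real
    assume u[measurable]: "u \<in> borel_measurable lebesgue" and r: "r > 0"
    let ?E = "local_energy \<alpha> u UNIV"
    show "(\<integral>\<^sup>+x. ennreal ((u x)\<^sup>2) * indicator (ball z r) x \<partial>lebesgue) \<le> ennreal (max 1 C * r powr \<alpha>) * ?E"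
    proof (cases "r \<le> 1")
      case True
      let ?v = "\<lambda>x. u (z + x)"
      have "(\<integral>\<^sup>+x. ennreal ((u x)\<^sup>2) * indicator (ball z r) x \<partial>lebesgue)
          = (\<integral>\<^sup>+x. ennreal ((?v x)\<^sup>2) * indicator (ball z r) (z + x) \<partial>lebesgue)"
        by (rule nn_integral_lebesgue_translation[symmetric]) measurable
      also have "\<dots> \<le> (\<integral>\<^sup>+x. ennreal (r powr \<alpha>) * (ennreal ((?v x)\<^sup>2 / norm x powr \<alpha>) * indicator (ball 0 1) x) \<partial>lebesgue)"
      proof (rule nn_integral_mono_AE)
        have "AE x in lebesgue. x \<noteq> (0::real^'n)"
          using AE_lborel_singleton[of "0::real^'n"] by (rule AE_completion)
        then show "AE x in lebesgue. ennreal ((?v x)\<^sup>2) * indicator (ball z r) (z + x)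
           \<le> ennreal (r powr \<alpha>) * (ennreal ((?v x)\<^sup>2 / norm x powr \<alpha>) * indicator (ball 0 1) x)"
        proof eventually_elim
          case (elim x)
          show ?case
          proof (cases "norm x < r")
            case x: True
            have "norm x powr \<alpha> \<le> r powr \<alpha>" using x \<alpha> by (intro powr_mono2) auto
            then have "(?v x)\<^sup>2 * norm x powr \<alpha> \<le> (?v x)\<^sup>2 * r powr \<alpha>"
              by (rule mult_left_mono) simp
            then have "(?v x)\<^sup>2 \<le> r powr \<alpha> * ((?v x)\<^sup>2 / norm x powr \<alpha>)"
              using elim by (simp add: field_simps)
            then show ?thesis using x True r
              by (simp add: dist_norm ennreal_leI flip: ennreal_mult)
          qed (simp add: dist_norm)
        qed
      qed
      also have "\<dots> = ennreal (r powr \<alpha>) * (\<integral>\<^sup>+x. ennreal ((?v x)\<^sup>2 / norm x powr \<alpha>) * indicator (ball 0 1) x \<partial>lebesgue)"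
        by (rule nn_integral_cmult) measurable
      also have "\<dots> \<le> ennreal (r powr \<alpha>) * (ennreal C * local_energy \<alpha> ?v (ball 0 1))"
        by (intro mult_left_mono hardy) auto
      also have "local_energy \<alpha> ?v (ball 0 1) = local_energy \<alpha> u (ball z 1)"
        using local_energy_translation[OF u, of "ball z 1" \<alpha> z, unfolded translate_ball] by simp
      also have "ennreal (r powr \<alpha>) * (ennreal C * local_energy \<alpha> u (ball z 1)) \<le> ennreal (r powr \<alpha>) * (ennreal (max 1 C) * ?E)"
        by (intro mult_left_mono mult_mono ennreal_leI local_energy_mono) auto
      finally show ?thesis using C by (simp add: ennreal_mult_mult mult_ac)
    next
      case False
      have "(\<integral>\<^sup>+x. ennreal ((u x)\<^sup>2) * indicator (ball z r) x \<partial>lebesgue) \<le> (\<integral>\<^sup>+x. ennreal ((u x)\<^sup>2) \<partial>lebesgue)"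
        by (intro nn_integral_mono) (auto split: split_indicator)
      also have "\<dots> \<le> ?E" unfolding local_energy_def by simp
      also have "\<dots> = 1 * ?E" by simp
      also have "\<dots> \<le> ennreal (max 1 C * r powr \<alpha>) * ?E"
      proof (rule mult_right_mono)
        have "1 * 1 \<le> max 1 C * r powr \<alpha>"
          using False \<alpha> by (intro mult_mono ge_one_powr_ge_zero) auto
        then show "1 \<le> ennreal (max 1 C * r powr \<alpha>)"
          using ennreal_leI by fastforce
      qed simp
      finally show ?thesis .
    qed
  qed simp
qed

text \<open>
  For \<open>g > 0\<close> the radius \<open>r = (e / g)\<^bsup>1/N\<^esup>\<close> balances the two terms; for \<open>g = 0\<close> let
  \<open>r \<rightarrow> \<infinity>\<close>.
\<close>

lemma optimise_radius:
  fixes a A e g N \<alpha> :: real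
  assumes "0 < \<alpha>" "\<alpha> < N" "0 < A" "0 < e" "0 \<le> g" "0 \<le> a"
    and le: "\<And>r. r > 0 \<Longrightarrow> a \<le> A * (r powr (\<alpha> - N) * e + r powr \<alpha> * g)"
  shows "a powr (N / (N - \<alpha>)) \<le> (2 * A) powr (N / (N - \<alpha>)) * e powr (\<alpha> / (N - \<alpha>)) * g"
proof (cases "g = 0")
  case True
  have "a \<le> 0"
  proof (rule tendsto_lowerbound)
    have "((\<lambda>r. r powr (\<alpha> - N)) \<longlongrightarrow> 0) at_top"
      using assms by (intro tendsto_neg_powr filterlim_ident) auto
    from tendsto_mult_left[OF tendsto_mult_right[OF this, of e], of A]
    show "((\<lambda>r. A * (r powr (\<alpha> - N) * e)) \<longlongrightarrow> 0) at_top" by simp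
    show "\<forall>\<^sub>F r in at_top. a \<le> A * (r powr (\<alpha> - N) * e)"
      using eventually_gt_at_top[of 0] by eventually_elim (use le True in simp)
  qed simp
  then show ?thesis using assms True by simp
next
  case False
  then have g: "g > 0" using assms by simp
  define r where "r = (e / g) powr (1 / N)"
  have N: "N > 0" using assms by simp
  have "r > 0" using g assms by (simp add: r_def)
  have 1: "r powr \<alpha> * g = e powr (\<alpha> / N) * g powr (1 - \<alpha> / N)"
    using g assms N by (simp add: r_def powr_powr powr_divide powr_diff)
  have 2: "r powr (\<alpha> - N) * e = e powr (\<alpha> / N) * g powr (1 - \<alpha> / N)"
  proof -
    have "r powr (\<alpha> - N) = e powr (\<alpha> / N - 1) / g powr (\<alpha> / N - 1)"
      using g assms N by (simp add: r_def powr_powr powr_divide diff_divide_distrib)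
    then show ?thesis using g assms by (simp add: powr_diff)
  qed
  have "a \<le> 2 * A * (e powr (\<alpha> / N) * g powr (1 - \<alpha> / N))"
    using le[OF \<open>r > 0\<close>] unfolding 1 2 by simp
  then have "a powr (N / (N - \<alpha>)) \<le> (2 * A * (e powr (\<alpha> / N) * g powr (1 - \<alpha> / N))) powr (N / (N - \<alpha>))"
    using assms by (intro powr_mono2) auto
  also have "\<dots> = (2 * A) powr (N / (N - \<alpha>)) * (e powr (\<alpha> / N * (N / (N - \<alpha>))) * g powr ((1 - \<alpha> / N) * (N / (N - \<alpha>))))"
    using assms g by (simp add: powr_mult powr_powr)
  also have "\<alpha> / N * (N / (N - \<alpha>)) = \<alpha> / (N - \<alpha>)" using N by simp
  also have "(1 - \<alpha> / N) * (N / (N - \<alpha>)) = 1" using N assms by (simp add: field_simps)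
  finally show ?thesis using g by (simp add: mult.assoc)
qed

text \<open>
  A pointwise argument in the style of Hedberg: with \<open>G x\<close> the kernel integrated over the second
  variable, averaging over \<open>ball x r\<close> and the Morrey bound give
  \<open>(u x)\<^sup>2 \<le> A (r\<^bsup>\<alpha>-N\<^esup> e + r\<^sup>\<alpha> G x)\<close> for every \<open>r > 0\<close>. The best radius turns this into
  \<open>\<bar>u x\<bar>\<^bsup>2*\<^esup> \<le> K e\<^bsup>\<alpha>/(N-\<alpha>)\<^esup> G x\<close>, and \<open>G\<close> integrates to at most \<open>e\<close>.
\<close>

lemma critical_Sobolev:
  fixes \<alpha> :: real
  assumes \<alpha>: "0 < \<alpha>" "\<alpha> < real CARD('n)"
  shows "\<exists>C\<ge>0. \<forall>u \<in> borel_measurable lebesgue. \<forall>e>0. local_energy \<alpha> u (UNIV :: (real^'n) set) \<le> ennreal e \<longrightarrow>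
     (\<integral>\<^sup>+x. ennreal (\<bar>u x\<bar> powr critical_exponent TYPE('n) \<alpha>) \<partial>lebesgue)
       \<le> ennreal (C * e powr (critical_exponent TYPE('n) \<alpha> / 2))"
proof -
  define N where "N = real CARD('n)"
  have N: "\<alpha> < N" "0 < N" using \<alpha> by (simp_all add: N_def)
  obtain C where C: "C \<ge> 1" and morrey: "\<And>u z r. u \<in> borel_measurable lebesgue \<Longrightarrow> r > 0 \<Longrightarrow>
     (\<integral>\<^sup>+x. ennreal ((u x)\<^sup>2) * indicator (ball z r) x \<partial>lebesgue)
       \<le> ennreal (C * r powr \<alpha>) * local_energy \<alpha> u (UNIV :: (real^'n) set)"
    using Morrey_bound[OF \<alpha>] by blast
  define \<omega> where "\<omega> = unit_ball_vol (CARD('n))"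
  have \<omega>: "\<omega> > 0" by (simp add: \<omega>_def)
  define A where "A = 2 * C / \<omega>"
  have A: "A > 0" using C \<omega> by (simp add: A_def)
  define s where "s = N / (N - \<alpha>)"
  have s: "s > 0" "critical_exponent TYPE('n) \<alpha> = 2 * s"
    using N by (simp_all add: s_def critical_exponent_def N_def)
  define K where "K = (2 * A) powr s"
  have K: "K > 0" using A by (simp add: K_def)
  have main: "(\<integral>\<^sup>+x. ennreal (\<bar>u x\<bar> powr (2 * s)) \<partial>lebesgue) \<le> ennreal (K * e powr s)"
    if u[measurable]: "u \<in> borel_measurable lebesgue" and e: "e > 0"
      and E: "local_energy \<alpha> u (UNIV :: (real^'n) set) \<le> ennreal e" for u :: "real^'n \<Rightarrow> real" and e
  proof -
    define G where "G x = (\<integral>\<^sup>+y. ennreal (gagliardo_kernel \<alpha> u (x, y)) \<partial>lebesgue)" for x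
    have pt: "ennreal (\<bar>u x\<bar> powr (2 * s)) \<le> ennreal (K * e powr (\<alpha> / (N - \<alpha>))) * G x" for x
    proof (cases "G x = \<infinity>")
      case True
      then show ?thesis using K e by (simp add: ennreal_mult_top)
    next
      case False
      then obtain g where g: "g \<ge> 0" "G x = ennreal g" by (cases "G x") auto
      have "(u x)\<^sup>2 \<le> A * (r powr (\<alpha> - N) * e + r powr \<alpha> * g)" if r: "r > 0" for r
      proof -
        have rN: "r ^ CARD('n) = r powr N" using r by (simp add: N_def powr_realpow)
        have "ennreal (\<omega> * r powr N) * ennreal ((u x)\<^sup>2) = emeasure lebesgue (ball x r) * ennreal ((u x)\<^sup>2)"
          using r by (simp add: emeasure_lebesgue_ball \<omega>_def rN del: emeasure_completion)
        also have "\<dots> \<le> ennreal (1 + 1) * (\<integral>\<^sup>+y. ennreal ((u y)\<^sup>2) * indicator (ball x r) y \<partial>lebesgue)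
          + ennreal ((1 + 1 / 1) * r powr (real CARD('n) + \<alpha>))
           * (\<integral>\<^sup>+y. ennreal (gagliardo_kernel \<alpha> u (x, y)) * indicator (ball x r) y \<partial>lebesgue)"
          using \<alpha> by (intro average_square_le u) (auto simp: dist_norm)
        also have "\<dots> \<le> ennreal 2 * (ennreal (C * r powr \<alpha>) * ennreal e) + ennreal (2 * r powr (N + \<alpha>)) * ennreal g"
        proof (intro add_mono mult_mono)
          show "(\<integral>\<^sup>+y. ennreal ((u y)\<^sup>2) * indicator (ball x r) y \<partial>lebesgue) \<le> ennreal (C * r powr \<alpha>) * ennreal e"
            by (intro order_trans[OF morrey[OF u r]] mult_left_mono E) simp
          have "(\<integral>\<^sup>+y. ennreal (gagliardo_kernel \<alpha> u (x, y)) * indicator (ball x r) y \<partial>lebesgue) \<le> G x"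
            unfolding G_def by (intro nn_integral_mono) (auto split: split_indicator)
          then show "(\<integral>\<^sup>+y. ennreal (gagliardo_kernel \<alpha> u (x, y)) * indicator (ball x r) y \<partial>lebesgue) \<le> ennreal g"
            by (simp only: g)
        qed (auto simp: N_def)
        also have "\<dots> = ennreal (2 * (C * r powr \<alpha> * e) + 2 * r powr (N + \<alpha>) * g)"
          using C e g by (simp add: ennreal_mult ennreal_plus)
        finally have "\<omega> * r powr N * (u x)\<^sup>2 \<le> 2 * (C * r powr \<alpha> * e) + 2 * r powr (N + \<alpha>) * g"
          using C e g \<omega> by (simp flip: ennreal_mult add: ennreal_le_iff del: ennreal_plus)
        also have "\<dots> \<le> 2 * (C * r powr \<alpha> * e) + 2 * (C * r powr (N + \<alpha>) * g)"
        proof -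
          have "1 * (r powr (N + \<alpha>) * g) \<le> C * (r powr (N + \<alpha>) * g)"
            using C g by (intro mult_right_mono) auto
          then show ?thesis by (simp add: mult.assoc)
        qed
        also have "\<dots> = \<omega> * r powr N * (A * (r powr (\<alpha> - N) * e + r powr \<alpha> * g))"
        proof -
          have 1: "r powr \<alpha> = r powr N * r powr (\<alpha> - N)" by (simp flip: powr_add)
          have 2: "r powr (N + \<alpha>) = r powr N * r powr \<alpha>" by (simp add: powr_add)
          have "\<omega> * A = 2 * C" using \<omega> by (simp add: A_def)
          then have "2 * (C * (b * c) * e) + 2 * (C * (b * d) * g) = \<omega> * b * (A * (c * e + d * g))" for b c d
            by algebra
          from this[of "r powr N" "r powr (\<alpha> - N)" "r powr \<alpha>"] show ?thesis
            unfolding 2 1[symmetric] .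
        qed
        finally show ?thesis using \<omega> r by simp
      qed
      from optimise_radius[OF \<alpha>(1) N(1) A e g(1) _ this]
      have "((u x)\<^sup>2) powr s \<le> K * e powr (\<alpha> / (N - \<alpha>)) * g"
        by (simp add: s_def K_def)
      moreover have "((u x)\<^sup>2) powr s = \<bar>u x\<bar> powr (2 * s)"
        by (cases "u x = 0") (simp_all flip: powr_powr add: powr_realpow[of "\<bar>u x\<bar>" 2, simplified])
      ultimately show ?thesis
        using K e g by (simp flip: ennreal_mult add: ennreal_leI)
    qed
    have "(\<integral>\<^sup>+x. ennreal (\<bar>u x\<bar> powr (2 * s)) \<partial>lebesgue) \<le> (\<integral>\<^sup>+x. ennreal (K * e powr (\<alpha> / (N - \<alpha>))) * G x \<partial>lebesgue)"
      by (intro nn_integral_mono pt)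
    also have "\<dots> = ennreal (K * e powr (\<alpha> / (N - \<alpha>))) * (\<integral>\<^sup>+x. G x \<partial>lebesgue)"
      unfolding G_def by (rule nn_integral_cmult) measurable
    also have "(\<integral>\<^sup>+x. G x \<partial>lebesgue) = (\<integral>\<^sup>+p. ennreal (gagliardo_kernel \<alpha> u p) \<partial>(lebesgue \<Otimes>\<^sub>M lebesgue))"
      unfolding G_def by (rule leb.nn_integral_fst) measurable
    also have "\<dots> \<le> local_energy \<alpha> u UNIV"
      unfolding local_energy_def by simp
    also have "\<dots> \<le> ennreal e" by (rule E)
    finally have "(\<integral>\<^sup>+x. ennreal (\<bar>u x\<bar> powr (2 * s)) \<partial>lebesgue) \<le> ennreal (K * e powr (\<alpha> / (N - \<alpha>))) * ennreal e"
      by (simp add: mult_left_mono)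
    also have "\<dots> = ennreal (K * e powr s)"
    proof -
      have "s = \<alpha> / (N - \<alpha>) + 1" using N by (simp add: s_def field_simps)
      then have "e powr s = e powr (\<alpha> / (N - \<alpha>)) * e" using e by (simp add: powr_add)
      then show ?thesis using K e by (simp flip: ennreal_mult add: mult.assoc)
    qed
    finally show ?thesis .
  qed
  show ?thesis
    by (rule exI[of _ K]) (use main K s in auto)
qed

lemma powr_le_add_powr:
  fixes t q r p :: real
  assumes "0 \<le> t" "r \<le> q" "q \<le> p"
  shows "t powr q \<le> t powr r + t powr p"
proof (cases "t \<le> 1")
  case True
  then have "t powr q \<le> t powr r" using assms by (intro powr_mono') auto
  then show ?thesis by (simp add: add_increasing2)
next
  case False
  then have "t powr q \<le> t powr p" using assms by (intro powr_mono) auto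
  then show ?thesis by (simp add: add_increasing)
qed

text \<open>
  Interpolation: \<open>r\<^sup>p \<le> r\<^sup>2 + r\<^bsup>2*\<^esup>\<close>, applied to \<open>\<bar>u\<bar>\<close> divided by \<open>\<surd>e\<close>, so that
  the bound has the right homogeneity in \<open>e\<close>.
\<close>

lemma Sobolev_embedding:
  fixes \<alpha> p :: real
  assumes \<alpha>: "0 < \<alpha>" "\<alpha> < real CARD('n)" and p: "2 \<le> p" "p \<le> critical_exponent TYPE('n) \<alpha>"
  shows "\<exists>C\<ge>0. \<forall>u \<in> borel_measurable lebesgue. \<forall>e>0. local_energy \<alpha> u (UNIV :: (real^'n) set) \<le> ennreal e \<longrightarrow>
     (\<integral>\<^sup>+x. ennreal (\<bar>u x\<bar> powr p) \<partial>lebesgue) \<le> ennreal (C * e powr (p / 2))"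
proof -
  let ?s = "critical_exponent TYPE('n) \<alpha>"
  obtain C where C: "C \<ge> 0" and crit: "\<And>u e. u \<in> borel_measurable lebesgue \<Longrightarrow> e > 0 \<Longrightarrow> local_energy \<alpha> u (UNIV :: (real^'n) set) \<le> ennreal e \<Longrightarrow>
     (\<integral>\<^sup>+x. ennreal (\<bar>u x\<bar> powr ?s) \<partial>lebesgue) \<le> ennreal (C * e powr (?s / 2))"
    using critical_Sobolev[OF \<alpha>] by blast
  show ?thesis
  proof (intro exI[of _ "1 + C"] conjI ballI allI impI)
    fix u :: "real^'n \<Rightarrow> real" and e :: real
    assume u[measurable]: "u \<in> borel_measurable lebesgue" and e: "e > 0"
      and E: "local_energy \<alpha> u (UNIV :: (real^'n) set) \<le> ennreal e"
    have pt: "\<bar>t\<bar> powr p \<le> e powr (p / 2) * (t\<^sup>2 / e) + e powr (p / 2) / e powr (?s / 2) * \<bar>t\<bar> powr ?s" for t :: real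
    proof -
      define w where "w = \<bar>t\<bar> / sqrt e"
      have w: "w \<ge> 0" using e by (simp add: w_def)
      have "w powr p \<le> w powr 2 + w powr ?s"
        using w p by (rule powr_le_add_powr)
      then have "e powr (p / 2) * w powr p \<le> e powr (p / 2) * (w powr 2 + w powr ?s)"
        by (intro mult_left_mono) auto
      moreover have "w powr q = \<bar>t\<bar> powr q / e powr (q / 2)" for q
        using e by (simp add: w_def powr_divide powr_half_sqrt[symmetric] powr_powr)
      ultimately show ?thesis
        using e by (simp add: distrib_left)
    qed
    have "(\<integral>\<^sup>+x. ennreal (\<bar>u x\<bar> powr p) \<partial>lebesgue) 
      \<le> (\<integral>\<^sup>+x. ennreal (e powr (p / 2) / e) * ennreal ((u x)\<^sup>2)
         + ennreal (e powr (p / 2) / e powr (?s / 2)) * ennreal (\<bar>u x\<bar> powr ?s) \<partial>lebesgue)"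
    proof (intro nn_integral_mono)
      fix x
      show "ennreal (\<bar>u x\<bar> powr p) \<le> ennreal (e powr (p / 2) / e) * ennreal ((u x)\<^sup>2)
         + ennreal (e powr (p / 2) / e powr (?s / 2)) * ennreal (\<bar>u x\<bar> powr ?s)"
        using pt[of "u x"] e by (simp flip: ennreal_mult ennreal_plus add: ennreal_leI)
    qed
    also have "\<dots> = ennreal (e powr (p / 2) / e) * (\<integral>\<^sup>+x. ennreal ((u x)\<^sup>2) \<partial>lebesgue)
        + ennreal (e powr (p / 2) / e powr (?s / 2)) * (\<integral>\<^sup>+x. ennreal (\<bar>u x\<bar> powr ?s) \<partial>lebesgue)"
      by (subst nn_integral_add) (auto simp: nn_integral_cmult)
    also have "\<dots> \<le> ennreal (e powr (p / 2) / e) * ennreal e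
        + ennreal (e powr (p / 2) / e powr (?s / 2)) * ennreal (C * e powr (?s / 2))"
    proof (intro add_mono mult_left_mono crit u e E)
      have "(\<integral>\<^sup>+x. ennreal ((u x)\<^sup>2) \<partial>lebesgue) \<le> local_energy \<alpha> u UNIV"
        unfolding local_energy_def by simp
      then show "(\<integral>\<^sup>+x. ennreal ((u x)\<^sup>2) \<partial>lebesgue) \<le> ennreal e" using E by simp
    qed auto
    also have "\<dots> = ennreal ((1 + C) * e powr (p / 2))"
    proof -
      have "e powr (p / 2) / e * e + e powr (p / 2) / e powr (?s / 2) * (C * e powr (?s / 2)) = (1 + C) * e powr (p / 2)"
        using e by (simp add: distrib_right)
      then show ?thesis
        using e C by (simp flip: ennreal_mult ennreal_plus)
    qed
    finally show "(\<integral>\<^sup>+x. ennreal (\<bar>u x\<bar> powr p) \<partial>lebesgue) \<le> ennreal ((1 + C) * e powr (p / 2))" .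
  qed (use C in simp)
qed

section \<open>Differentiability of superposition functionals\<close>

lemma powr_add_le:
  fixes s t r p :: real
  assumes "0 \<le> s" "0 \<le> t" "0 < r" "r \<le> p"
  shows "(s + t) powr r \<le> 2 powr p * (s powr r + t powr r)"
proof -
  have "(s + t) powr r \<le> (2 * max s t) powr r"
    using assms by (intro powr_mono2) auto
  also have "\<dots> = 2 powr r * max s t powr r" using assms by (simp add: powr_mult)
  also have "\<dots> \<le> 2 powr p * (s powr r + t powr r)"
    using assms by (intro mult_mono powr_mono) (auto simp: max_def)
  finally show ?thesis .
qed

text \<open>
  The gauge \<open>min (d\<^sup>2) (d\<^bsup>p'\<^esup>)\<close> with \<open>p' = p/(p-1)\<close> is, up to constants, conjugate to
  \<open>b\<^sup>2 + b\<^sup>p\<close>, so this plays the role of Hoelder's inequality between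
  \<open>L\<^sup>2 \<inter> L\<^sup>p\<close> and its dual \<open>L\<^sup>2 + L\<^bsup>p'\<^esup>\<close>.
\<close>

lemma young_dual_pair:
  fixes p \<kappa> :: real
  assumes p: "p > 1" and \<kappa>: "\<kappa> > 0"
  shows "\<exists>C\<ge>0. \<forall>b\<ge>0. \<forall>d\<ge>0. b * d \<le> \<kappa> * (b\<^sup>2 + b powr p) + C * min (d\<^sup>2) (d powr (p / (p - 1)))"
proof (intro exI[of _ "max (1 / \<kappa>) (\<kappa> powr (- 1 / (p - 1)))"] conjI allI impI)
  let ?C = "max (1 / \<kappa>) (\<kappa> powr (- 1 / (p - 1)))"
  fix b d :: real
  assume b: "0 \<le> b" and d: "0 \<le> d"
  have 1: "b * d \<le> \<kappa> * b\<^sup>2 + ?C * d\<^sup>2"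
  proof (cases "d \<le> \<kappa> * b")
    case True
    then have "b * d \<le> b * (\<kappa> * b)" using b by (rule mult_left_mono)
    moreover have "0 \<le> ?C * d\<^sup>2" using \<kappa> by (intro mult_nonneg_nonneg) (auto simp: le_max_iff_disj)
    moreover have "b * (\<kappa> * b) = \<kappa> * b\<^sup>2" by (simp add: power2_eq_square)
    ultimately show ?thesis by linarith
  next
    case False
    then have "b \<le> 1 / \<kappa> * d" using \<kappa> by (simp add: field_simps)
    then have "b * d \<le> 1 / \<kappa> * d * d" using d by (rule mult_right_mono)
    also have "\<dots> \<le> ?C * d\<^sup>2" unfolding power2_eq_square mult.assoc using d by (intro mult_right_mono) auto
    finally show ?thesis using \<kappa> by (simp add: add_increasing)
  qed
  have 2: "b * d \<le> \<kappa> * b powr p + ?C * d powr (p / (p - 1))"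
  proof (cases "d \<le> \<kappa> * b powr (p - 1)")
    case True
    then have "b * d \<le> b * (\<kappa> * b powr (p - 1))" using b by (rule mult_left_mono)
    also have "\<dots> = \<kappa> * b powr p" using b by (cases "b = 0") (simp_all add: powr_diff)
    moreover have "0 \<le> ?C * d powr (p / (p - 1))" by (intro mult_nonneg_nonneg) (auto simp: le_max_iff_disj)
    ultimately show ?thesis by linarith
  next
    case False
    have "b = (b powr (p - 1)) powr (1 / (p - 1))" using b p by (simp add: powr_powr)
    also have "\<dots> \<le> (d / \<kappa>) powr (1 / (p - 1))"
      using False \<kappa> p by (intro powr_mono2) (auto simp: field_simps)
    also have "\<dots> = \<kappa> powr (- 1 / (p - 1)) * d powr (1 / (p - 1))"
      using d \<kappa> by (simp add: powr_divide powr_minus_divide)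
    finally have "b * d \<le> \<kappa> powr (- 1 / (p - 1)) * d powr (1 / (p - 1)) * d"
      using d by (rule mult_right_mono)
    also have "\<dots> = \<kappa> powr (- 1 / (p - 1)) * d powr (p / (p - 1))"
    proof -
      have "p / (p - 1) = 1 / (p - 1) + 1" using p by (simp add: field_simps)
      then show ?thesis using d by (simp add: powr_add)
    qed
    also have "\<dots> \<le> ?C * d powr (p / (p - 1))" by (intro mult_right_mono) auto
    finally show ?thesis using \<kappa> by (simp add: add_increasing)
  qed
  have "0 \<le> \<kappa> * b\<^sup>2" "0 \<le> \<kappa> * b powr p" using \<kappa> by auto
  then show "b * d \<le> \<kappa> * (b\<^sup>2 + b powr p) + ?C * min (d\<^sup>2) (d powr (p / (p - 1)))"
    using 1 2 by (simp add: min_def distrib_left)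
qed (simp add: le_max_iff_disj)

text \<open>
  A function of growth \<open>\<sigma> + \<sigma>\<^bsup>p-1\<^esup>\<close> has its conjugate gauge controlled by \<open>\<sigma>\<^sup>2 + \<sigma>\<^sup>p\<close>. The first
  term dominates for \<open>\<sigma> \<le> 1\<close> and the second one for \<open>\<sigma> > 1\<close>.
\<close>

lemma dual_growth:
  fixes p c \<sigma> d :: real
  assumes p: "p > 2" and c: "0 \<le> c" and \<sigma>: "0 \<le> \<sigma>" and d: "0 \<le> d" "d \<le> c * (\<sigma> + \<sigma> powr (p - 1))"
  shows "min (d\<^sup>2) (d powr (p / (p - 1))) \<le> ((2 * c)\<^sup>2 + (2 * c) powr (p / (p - 1))) * (\<sigma>\<^sup>2 + \<sigma> powr p)"
proof (cases "\<sigma> \<le> 1")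
  case True
  have "\<sigma> powr (p - 1) \<le> \<sigma>" using powr_mono'[of 1 "p - 1" \<sigma>] True \<sigma> p by simp
  then have "d \<le> c * (\<sigma> + \<sigma>)" using d(2) c by (meson add_left_mono mult_left_mono order_trans)
  then have "d\<^sup>2 \<le> (2 * c * \<sigma>)\<^sup>2" using d by (intro power_mono) auto
  also have "\<dots> = (2 * c)\<^sup>2 * \<sigma>\<^sup>2" by (simp add: power_mult_distrib)
  also have "\<dots> \<le> ((2 * c)\<^sup>2 + (2 * c) powr (p / (p - 1))) * (\<sigma>\<^sup>2 + \<sigma> powr p)"
    by (intro mult_mono) auto
  finally show ?thesis by simp
next
  case False
  have "\<sigma> \<le> \<sigma> powr (p - 1)" using powr_mono[of 1 "p - 1" \<sigma>] False \<sigma> p by simp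
  then have "d \<le> c * (\<sigma> powr (p - 1) + \<sigma> powr (p - 1))" using d(2) c by (meson add_right_mono mult_left_mono order_trans)
  then have "d powr (p / (p - 1)) \<le> (2 * c * \<sigma> powr (p - 1)) powr (p / (p - 1))"
    using d p by (intro powr_mono2) auto
  also have "\<dots> = (2 * c) powr (p / (p - 1)) * \<sigma> powr p"
    using c \<sigma> p by (simp add: powr_mult powr_powr)
  also have "\<dots> \<le> ((2 * c)\<^sup>2 + (2 * c) powr (p / (p - 1))) * (\<sigma>\<^sup>2 + \<sigma> powr p)"
    by (intro mult_mono) auto
  finally show ?thesis by simp
qed

definition Lebesgue2p :: "'a measure \<Rightarrow> real \<Rightarrow> ('a \<Rightarrow> real) set" where
  "Lebesgue2p M p = {u \<in> borel_measurable M. integrable M (\<lambda>x. (u x)\<^sup>2) \<and> integrable M (\<lambda>x. \<bar>u x\<bar> powr p)}"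

lemma Lebesgue2pD:
  assumes "u \<in> Lebesgue2p M p"
  shows "u \<in> borel_measurable M" "integrable M (\<lambda>x. (u x)\<^sup>2)" "integrable M (\<lambda>x. \<bar>u x\<bar> powr p)"
  using assms by (auto simp: Lebesgue2p_def)

lemma mult_powr_le:
  fixes s t p :: real
  assumes "0 \<le> s" "0 \<le> t" "1 \<le> p"
  shows "s powr (p - 1) * t \<le> s powr p + t powr p"
proof (cases "s \<le> t")
  case True
  then have "s powr (p - 1) * t \<le> t powr (p - 1) * t"
    using assms by (intro mult_right_mono powr_mono2) auto
  also have "\<dots> = t powr p" using assms by (cases "t = 0") (simp_all add: powr_diff)
  finally show ?thesis by (simp add: add_increasing)
next
  case False
  then have "s powr (p - 1) * t \<le> s powr (p - 1) * s"
    using assms by (intro mult_left_mono) auto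
  also have "\<dots> = s powr p" using assms by (cases "s = 0") (simp_all add: powr_diff)
  finally show ?thesis by (simp add: add_increasing2)
qed

lemma abs_mult_le: "\<bar>s * t\<bar> \<le> s\<^sup>2 + t\<^sup>2" for s t :: real
proof -
  have "0 \<le> (\<bar>s\<bar> - \<bar>t\<bar>)\<^sup>2" by simp
  also have "\<dots> = s\<^sup>2 + t\<^sup>2 - 2 * \<bar>s * t\<bar>" by (simp add: power2_eq_square algebra_simps abs_mult)
  finally show ?thesis by (smt (verit) abs_ge_zero)
qed

text \<open>
  The functional \<open>u \<mapsto> \<integral>G x (u x)\<close> for a Caratheodory function \<open>G\<close> with derivative \<open>g\<close> of
  at most linear growth at \<open>0\<close> and growth of order \<open>p - 1\<close> at infinity. Both superposition
  operators are assumed to preserve measurability, which does not follow from the almost everywhere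
  conditions on a general measure space.
\<close>

locale superposition =
  fixes M :: "'a measure" and G g :: "'a \<Rightarrow> real \<Rightarrow> real" and a p :: real
  assumes p: "2 < p" and a: "0 \<le> a"
    and deriv: "AE x in M. \<forall>s. (G x has_real_derivative g x s) (at s)"
    and growth: "AE x in M. \<forall>s. \<bar>g x s\<bar> \<le> a * (\<bar>s\<bar> + \<bar>s\<bar> powr (p - 1))"
    and zero: "AE x in M. G x 0 = 0"
    and meas_G: "\<And>u. u \<in> borel_measurable M \<Longrightarrow> (\<lambda>x. G x (u x)) \<in> borel_measurable M"
    and meas_g: "\<And>u. u \<in> borel_measurable M \<Longrightarrow> (\<lambda>x. g x (u x)) \<in> borel_measurable M"
begin

lemma increment_bound:
  "AE x in M. \<forall>s h. \<bar>G x (s + h) - G x s\<bar> \<le> a * ((\<bar>s\<bar> + \<bar>h\<bar>) + (\<bar>s\<bar> + \<bar>h\<bar>) powr (p - 1)) * \<bar>h\<bar>"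
  using deriv growth
proof eventually_elim
  case (elim x)
  show ?case
  proof (intro allI)
    fix s h :: real
    let ?B = "a * ((\<bar>s\<bar> + \<bar>h\<bar>) + (\<bar>s\<bar> + \<bar>h\<bar>) powr (p - 1))"
    have "norm (G x (s + h) - G x s) \<le> ?B * norm ((s + h) - s)"
    proof (rule field_differentiable_bound[of "cball s \<bar>h\<bar>"])
      fix z assume "z \<in> cball s \<bar>h\<bar>"
      then have z: "\<bar>z\<bar> \<le> \<bar>s\<bar> + \<bar>h\<bar>" by (auto simp: dist_real_def)
      show "norm (g x z) \<le> ?B"
      proof -
        have "\<bar>z\<bar> powr (p - 1) \<le> (\<bar>s\<bar> + \<bar>h\<bar>) powr (p - 1)"
          using z p by (intro powr_mono2) auto
        then have "a * (\<bar>z\<bar> + \<bar>z\<bar> powr (p - 1)) \<le> ?B"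
          using z a by (intro mult_left_mono add_mono) auto
        then show ?thesis using elim(2)[rule_format, of z] by simp
      qed
      show "(G x has_field_derivative g x z) (at z within cball s \<bar>h\<bar>)"
        using elim(1)[rule_format, of z] by (rule has_field_derivative_at_within)
    qed (auto simp: dist_real_def)
    then show "\<bar>G x (s + h) - G x s\<bar> \<le> ?B * \<bar>h\<bar>" by simp
  qed
qed

lemma integrable_G:
  assumes u: "u \<in> Lebesgue2p M p"
  shows "integrable M (\<lambda>x. G x (u x))"
proof (rule Bochner_Integration.integrable_bound)
  show "integrable M (\<lambda>x. a * ((u x)\<^sup>2 + \<bar>u x\<bar> powr p))"
    using Lebesgue2pD[OF u] by auto
  show "(\<lambda>x. G x (u x)) \<in> borel_measurable M" by (intro meas_G Lebesgue2pD(1)[OF u])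
  show "AE x in M. norm (G x (u x)) \<le> norm (a * ((u x)\<^sup>2 + \<bar>u x\<bar> powr p))"
    using increment_bound zero
  proof eventually_elim
    case (elim x)
    have "\<bar>G x (u x)\<bar> \<le> a * (\<bar>u x\<bar> + \<bar>u x\<bar> powr (p - 1)) * \<bar>u x\<bar>"
      using elim(1)[rule_format, of 0 "u x"] elim(2) by simp
    also have "\<dots> = a * ((u x)\<^sup>2 + \<bar>u x\<bar> powr p)"
      by (cases "u x = 0") (simp_all add: powr_diff power2_eq_square algebra_simps)
    finally show ?case using a by simp
  qed
qed

lemma g_mult_bound:
  "AE x in M. \<forall>s t. \<bar>g x s * t\<bar> \<le> a * (s\<^sup>2 + t\<^sup>2 + \<bar>s\<bar> powr p + \<bar>t\<bar> powr p)"
  using growth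
proof eventually_elim
  case (elim x)
  show ?case
  proof (intro allI)
    fix s t :: real
    have "\<bar>g x s * t\<bar> \<le> a * (\<bar>s\<bar> + \<bar>s\<bar> powr (p - 1)) * \<bar>t\<bar>"
      unfolding abs_mult using elim by (intro mult_right_mono) auto
    also have "\<dots> = a * (\<bar>s * t\<bar> + \<bar>s\<bar> powr (p - 1) * \<bar>t\<bar>)"
      by (simp add: algebra_simps abs_mult)
    also have "\<dots> \<le> a * ((s\<^sup>2 + t\<^sup>2) + (\<bar>s\<bar> powr p + \<bar>t\<bar> powr p))"
      using a p by (intro mult_left_mono add_mono abs_mult_le mult_powr_le) auto
    finally show "\<bar>g x s * t\<bar> \<le> a * (s\<^sup>2 + t\<^sup>2 + \<bar>s\<bar> powr p + \<bar>t\<bar> powr p)"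
      by (simp add: add_ac)
  qed
qed

lemma integrable_g_mult:
  assumes u: "u \<in> Lebesgue2p M p" and h: "h \<in> Lebesgue2p M p"
  shows "integrable M (\<lambda>x. g x (u x) * h x)"
    and "\<bar>\<integral>x. g x (u x) * h x \<partial>M\<bar> \<le> a * ((\<integral>x. (u x)\<^sup>2 \<partial>M) + (\<integral>x. (h x)\<^sup>2 \<partial>M)
        + (\<integral>x. \<bar>u x\<bar> powr p \<partial>M) + (\<integral>x. \<bar>h x\<bar> powr p \<partial>M))"
proof -
  let ?B = "\<lambda>x. a * ((u x)\<^sup>2 + (h x)\<^sup>2 + \<bar>u x\<bar> powr p + \<bar>h x\<bar> powr p)"
  have B: "integrable M ?B" using Lebesgue2pD[OF u] Lebesgue2pD[OF h] by auto
  have le: "AE x in M. norm (g x (u x) * h x) \<le> ?B x"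
    using g_mult_bound by eventually_elim simp
  have m: "(\<lambda>x. g x (u x) * h x) \<in> borel_measurable M"
    using Lebesgue2pD(1)[OF u] Lebesgue2pD(1)[OF h] by (intro borel_measurable_times meas_g) auto
  show int: "integrable M (\<lambda>x. g x (u x) * h x)"
    by (rule Bochner_Integration.integrable_bound[OF B m]) (use le in eventually_elim, simp)
  have "norm (\<integral>x. g x (u x) * h x \<partial>M) \<le> (\<integral>x. norm (g x (u x) * h x) \<partial>M)"
    by (rule integral_norm_bound)
  also have "\<dots> \<le> (\<integral>x. ?B x \<partial>M)"
    by (intro integral_mono_AE B le) (use int in auto)
  also have "\<dots> = a * ((\<integral>x. (u x)\<^sup>2 \<partial>M) + (\<integral>x. (h x)\<^sup>2 \<partial>M)
        + (\<integral>x. \<bar>u x\<bar> powr p \<partial>M) + (\<integral>x. \<bar>h x\<bar> powr p \<partial>M))"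
    using Lebesgue2pD[OF u] Lebesgue2pD[OF h] by simp
  finally show "\<bar>\<integral>x. g x (u x) * h x \<partial>M\<bar> \<le> a * ((\<integral>x. (u x)\<^sup>2 \<partial>M) + (\<integral>x. (h x)\<^sup>2 \<partial>M)
        + (\<integral>x. \<bar>u x\<bar> powr p \<partial>M) + (\<integral>x. \<bar>h x\<bar> powr p \<partial>M))" by simp
qed

lemma Lebesgue2p_add:
  assumes u: "u \<in> Lebesgue2p M p" and h: "h \<in> Lebesgue2p M p"
  shows "(\<lambda>x. u x + h x) \<in> Lebesgue2p M p"
  unfolding Lebesgue2p_def
proof (intro CollectI conjI)
  have [measurable]: "u \<in> borel_measurable M" using u by (rule Lebesgue2pD(1))
  have [measurable]: "h \<in> borel_measurable M" using h by (rule Lebesgue2pD(1))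
  show "(\<lambda>x. u x + h x) \<in> borel_measurable M" by measurable
  show "integrable M (\<lambda>x. (u x + h x)\<^sup>2)"
  proof (rule Bochner_Integration.integrable_bound)
    show "integrable M (\<lambda>x. 2 * (u x)\<^sup>2 + 2 * (h x)\<^sup>2)"
      using Lebesgue2pD(2)[OF u] Lebesgue2pD(2)[OF h] by auto
    have "(s + t)\<^sup>2 \<le> 2 * s\<^sup>2 + 2 * t\<^sup>2" for s t :: real
      using sum_squares_bound[of s t] by (simp add: power2_sum)
    then show "AE x in M. norm ((u x + h x)\<^sup>2) \<le> norm (2 * (u x)\<^sup>2 + 2 * (h x)\<^sup>2)" by simp
  qed measurable
  show "integrable M (\<lambda>x. \<bar>u x + h x\<bar> powr p)"
  proof (rule Bochner_Integration.integrable_bound)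
    show "integrable M (\<lambda>x. 2 powr p * (\<bar>u x\<bar> powr p + \<bar>h x\<bar> powr p))"
      using Lebesgue2pD(3)[OF u] Lebesgue2pD(3)[OF h] by auto
    have "\<bar>s + t\<bar> powr p \<le> 2 powr p * (\<bar>s\<bar> powr p + \<bar>t\<bar> powr p)" for s t :: real
    proof -
      have "\<bar>s + t\<bar> powr p \<le> (\<bar>s\<bar> + \<bar>t\<bar>) powr p" using p by (intro powr_mono2) auto
      also have "\<dots> \<le> 2 powr p * (\<bar>s\<bar> powr p + \<bar>t\<bar> powr p)" using p by (intro powr_add_le) auto
      finally show ?thesis .
    qed
    then show "AE x in M. norm (\<bar>u x + h x\<bar> powr p) \<le> norm (2 powr p * (\<bar>u x\<bar> powr p + \<bar>h x\<bar> powr p))" by simp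
  qed measurable
qed

text \<open>
  Otherwise there are \<open>h n\<close> and \<open>\<rho> n \<rightarrow> 0\<close> violating the bound. Passing to a subsequence,
  \<open>h n \<rightarrow> 0\<close> almost everywhere, and the remainder is \<open>R n = \<bar>h n\<bar> D n\<close> with a difference quotient
  \<open>D n\<close> tending to \<open>0\<close> pointwise. Young's inequality for the gauge \<open>\<Psi>\<close>, applied to \<open>\<bar>h n\<bar> / \<rho> n\<close>
  and \<open>D n\<close>, bounds \<open>\<integral>\<bar>R n\<bar> / \<rho> n\<close> by \<open>\<epsilon>/2\<close> plus a multiple of \<open>\<integral>\<Psi>(D n)\<close>, and the last
  integral tends to \<open>0\<close> by dominated convergence. The separate radius \<open>\<rho>\<close> bounds both norms of
  \<open>h\<close> at once and is later taken proportional to the Sobolev norm.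
\<close>

lemma linearisation_error:
  assumes u: "u \<in> Lebesgue2p M p" and \<epsilon>: "\<epsilon> > 0"
  shows "\<exists>\<delta>>0. \<forall>h \<in> Lebesgue2p M p. \<forall>\<rho>. 0 < \<rho> \<longrightarrow> \<rho> \<le> \<delta> \<longrightarrow>
    (\<integral>x. (h x)\<^sup>2 \<partial>M) \<le> \<rho>\<^sup>2 \<longrightarrow> (\<integral>x. \<bar>h x\<bar> powr p \<partial>M) \<le> \<rho> powr p \<longrightarrow>
    \<bar>(\<integral>x. G x (u x + h x) \<partial>M) - (\<integral>x. G x (u x) \<partial>M) - (\<integral>x. g x (u x) * h x \<partial>M)\<bar> \<le> \<epsilon> * \<rho>"
proof (rule ccontr)
  assume neg: "\<not> ?thesis"
  define Q where "Q n q \<longleftrightarrow> (case q of (h, \<rho>) \<Rightarrow>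
     h \<in> Lebesgue2p M p \<and> 0 < \<rho> \<and> \<rho> \<le> 1 / Suc n \<and> (\<integral>x. (h x)\<^sup>2 \<partial>M) \<le> \<rho>\<^sup>2 \<and> (\<integral>x. \<bar>h x\<bar> powr p \<partial>M) \<le> \<rho> powr p
     \<and> \<epsilon> * \<rho> < \<bar>(\<integral>x. G x (u x + h x) \<partial>M) - (\<integral>x. G x (u x) \<partial>M) - (\<integral>x. g x (u x) * h x \<partial>M)\<bar>)" for n q
  have "\<exists>q. Q n q" for n
  proof (rule ccontr)
    assume c: "\<not> ?thesis"
    have "\<forall>h \<in> Lebesgue2p M p. \<forall>\<rho>. 0 < \<rho> \<longrightarrow> \<rho> \<le> 1 / Suc n \<longrightarrow>
      (\<integral>x. (h x)\<^sup>2 \<partial>M) \<le> \<rho>\<^sup>2 \<longrightarrow> (\<integral>x. \<bar>h x\<bar> powr p \<partial>M) \<le> \<rho> powr p \<longrightarrow>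
      \<bar>(\<integral>x. G x (u x + h x) \<partial>M) - (\<integral>x. G x (u x) \<partial>M) - (\<integral>x. g x (u x) * h x \<partial>M)\<bar> \<le> \<epsilon> * \<rho>"
    proof (intro ballI allI impI, rule ccontr)
      fix h \<rho>
      assume "h \<in> Lebesgue2p M p" "0 < \<rho>" "\<rho> \<le> 1 / Suc n"
        "(\<integral>x. (h x)\<^sup>2 \<partial>M) \<le> \<rho>\<^sup>2" "(\<integral>x. \<bar>h x\<bar> powr p \<partial>M) \<le> \<rho> powr p"
        "\<not> \<bar>(\<integral>x. G x (u x + h x) \<partial>M) - (\<integral>x. G x (u x) \<partial>M) - (\<integral>x. g x (u x) * h x \<partial>M)\<bar> \<le> \<epsilon> * \<rho>"
      then have "Q n (h, \<rho>)" unfolding not_le by (simp only: Q_def prod.case simp_thms)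
      then show False using c by blast
    qed
    moreover have "(0::real) < 1 / Suc n" by simp
    ultimately show False using neg by blast
  qed
  then obtain q where q: "\<And>n. Q n (q n)" using choice[of Q] by blast
  define h0 where "h0 n = fst (q n)" for n
  define \<rho>0 where "\<rho>0 n = snd (q n)" for n
  have "Q n (h0 n, \<rho>0 n)" for n using q[of n] by (simp add: h0_def \<rho>0_def)
  then have h0: "\<And>n. h0 n \<in> Lebesgue2p M p" and \<rho>0: "\<And>n. 0 < \<rho>0 n" "\<And>n. \<rho>0 n \<le> 1 / Suc n"
    and h0_2: "\<And>n. (\<integral>x. (h0 n x)\<^sup>2 \<partial>M) \<le> (\<rho>0 n)\<^sup>2" and h0_p: "\<And>n. (\<integral>x. \<bar>h0 n x\<bar> powr p \<partial>M) \<le> \<rho>0 n powr p"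
    and big0: "\<And>n. \<epsilon> * \<rho>0 n < \<bar>(\<integral>x. G x (u x + h0 n x) \<partial>M) - (\<integral>x. G x (u x) \<partial>M) - (\<integral>x. g x (u x) * h0 n x \<partial>M)\<bar>"
    by (simp_all only: Q_def prod.case)
  define m where "m t = t\<^sup>2 + \<bar>t\<bar> powr p" for t :: real
  have m_nonneg: "m t \<ge> 0" for t by (simp add: m_def)
  have int_m: "integrable M (\<lambda>x. m (v x))" if "v \<in> Lebesgue2p M p" for v
    unfolding m_def using Lebesgue2pD[OF that] by auto
  have int_m_le: "(\<integral>x. m (h0 n x) \<partial>M) \<le> (\<rho>0 n)\<^sup>2 + \<rho>0 n powr p" for n
    using Lebesgue2pD[OF h0[of n]] h0_2[of n] h0_p[of n] by (simp add: m_def)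
  have \<rho>0_lim: "\<rho>0 \<longlonglongrightarrow> 0"
    by (rule tendsto_sandwich[OF _ _ tendsto_const LIMSEQ_Suc[OF lim_1_over_n]])
       (use \<rho>0 in \<open>auto simp: less_imp_le simp del: of_nat_Suc\<close>)
  have "(\<lambda>n. \<rho>0 n powr p) \<longlonglongrightarrow> 0"
    using p \<rho>0(1) by (intro tendsto_zero_powrI[OF \<rho>0_lim tendsto_const]) (auto simp: less_imp_le)
  from tendsto_add[OF tendsto_power[OF \<rho>0_lim, of 2] this]
  have lim_bound: "(\<lambda>n. (\<rho>0 n)\<^sup>2 + \<rho>0 n powr p) \<longlonglongrightarrow> 0" by simp
  have lim_m0: "(\<lambda>n. (\<integral>x. m (h0 n x) \<partial>M)) \<longlonglongrightarrow> 0"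
    by (rule tendsto_sandwich[OF _ _ tendsto_const lim_bound]) (use int_m_le m_nonneg in auto)
  obtain r :: "nat \<Rightarrow> nat" where r: "strict_mono r" "AE x in M. (\<lambda>n. m (h0 (r n) x)) \<longlonglongrightarrow> 0"
    using tendsto_L1_AE_subseq[of M "\<lambda>n x. m (h0 n x)"] int_m[OF h0] lim_m0 m_nonneg by auto
  define h where "h n = h0 (r n)" for n
  define \<rho> where "\<rho> n = \<rho>0 (r n)" for n
  have h: "h n \<in> Lebesgue2p M p" for n by (simp add: h_def h0)
  have \<rho>: "\<rho> n > 0" for n by (simp add: \<rho>_def \<rho>0)
  have lim_m: "(\<lambda>n. (\<integral>x. m (h n x) \<partial>M)) \<longlonglongrightarrow> 0"
    using LIMSEQ_subseq_LIMSEQ[OF lim_m0 r(1)] by (simp add: h_def o_def)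
  have h_AE: "AE x in M. (\<lambda>n. h n x) \<longlonglongrightarrow> 0"
    using r(2)
  proof eventually_elim
    case (elim x)
    have "(\<lambda>n. (h n x)\<^sup>2) \<longlonglongrightarrow> 0"
      by (rule tendsto_sandwich[OF _ _ tendsto_const elim]) (auto simp: m_def h_def)
    then have "(\<lambda>n. sqrt ((h n x)\<^sup>2)) \<longlonglongrightarrow> sqrt 0" by (rule tendsto_real_sqrt)
    then have "(\<lambda>n. \<bar>h n x\<bar>) \<longlonglongrightarrow> 0" by simp
    then show ?case by (rule tendsto_rabs_zero_cancel)
  qed
  have [measurable]: "u \<in> borel_measurable M" using u by (rule Lebesgue2pD(1))
  have [measurable]: "h n \<in> borel_measurable M" for n using h by (rule Lebesgue2pD(1))
  have [measurable]: "(\<lambda>x. G x (u x + h n x)) \<in> borel_measurable M" for n by (rule meas_G) measurable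
  have [measurable]: "(\<lambda>x. G x (u x)) \<in> borel_measurable M" by (rule meas_G) measurable
  have [measurable]: "(\<lambda>x. g x (u x)) \<in> borel_measurable M" by (rule meas_g) measurable
  define R where "R n x = G x (u x + h n x) - G x (u x) - g x (u x) * h n x" for n x
  define D where "D n x = \<bar>R n x\<bar> / \<bar>h n x\<bar>" for n x
  have [measurable]: "R n \<in> borel_measurable M" for n unfolding R_def by measurable
  have [measurable]: "D n \<in> borel_measurable M" for n unfolding D_def by measurable
  define \<Psi> where "\<Psi> d = min (d\<^sup>2) (d powr (p / (p - 1)))" for d :: real
  have [measurable]: "\<Psi> \<in> borel_measurable borel" unfolding \<Psi>_def by measurable
  have D_nonneg: "D n x \<ge> 0" for n x by (simp add: D_def)
  have R_D: "\<bar>R n x\<bar> = \<bar>h n x\<bar> * D n x" for n x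
    by (cases "h n x = 0") (simp_all add: D_def R_def)
  have int_R: "integrable M (R n)" for n
    unfolding R_def
    by (intro Bochner_Integration.integrable_diff integrable_G integrable_g_mult Lebesgue2p_add u h)
  have big: "\<epsilon> * \<rho> n < (\<integral>x. \<bar>R n x\<bar> \<partial>M)" for n
  proof -
    have "(\<integral>x. G x (u x + h n x) \<partial>M) - (\<integral>x. G x (u x) \<partial>M) - (\<integral>x. g x (u x) * h n x \<partial>M) = (\<integral>x. R n x \<partial>M)"
      unfolding R_def
      using integrable_G[OF Lebesgue2p_add[OF u h[of n]]] integrable_G[OF u] integrable_g_mult(1)[OF u h[of n]] by simp
    then have "\<epsilon> * \<rho> n < \<bar>\<integral>x. R n x \<partial>M\<bar>"
      using big0[of "r n"] by (simp add: h_def \<rho>_def)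
    also have "\<dots> \<le> (\<integral>x. \<bar>R n x\<bar> \<partial>M)" by (rule integral_abs_bound)
    finally show ?thesis .
  qed
  have D_lim: "AE x in M. (\<lambda>n. \<Psi> (D n x)) \<longlonglongrightarrow> 0"
    using h_AE deriv
  proof eventually_elim
    case (elim x)
    from elim(2)[rule_format, of "u x"] obtain k where
      k: "\<And>z. G x z - G x (u x) = k z * (z - u x)" "isCont k (u x)" "k (u x) = g x (u x)"
      unfolding CARAT_DERIV by blast
    have "(\<lambda>n. k (u x + h n x)) \<longlonglongrightarrow> k (u x)"
      by (rule isCont_tendsto_compose[OF k(2)]) (use tendsto_add[OF tendsto_const elim(1), of "u x"] in simp)
    then have "(\<lambda>n. k (u x + h n x) - k (u x)) \<longlonglongrightarrow> 0" by (simp add: LIM_zero)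
    then have *: "(\<lambda>n. (k (u x + h n x) - k (u x))\<^sup>2) \<longlonglongrightarrow> 0"
      using tendsto_power[of _ 0 _ 2] by fastforce
    have D_le: "(D n x)\<^sup>2 \<le> (k (u x + h n x) - k (u x))\<^sup>2" for n
    proof (cases "h n x = 0")
      case False
      have "R n x = (k (u x + h n x) - k (u x)) * h n x"
        using k(1)[of "u x + h n x"] by (simp add: R_def k(3) algebra_simps)
      then show ?thesis using False by (simp add: D_def abs_mult)
    qed (simp add: D_def)
    show ?case
    proof (rule tendsto_sandwich[OF _ _ tendsto_const *])
      show "\<forall>\<^sub>F n in sequentially. \<Psi> (D n x) \<le> (k (u x + h n x) - k (u x))\<^sup>2"
        using D_le by (auto simp: \<Psi>_def intro!: always_eventually min.coboundedI1)
      show "\<forall>\<^sub>F n in sequentially. 0 \<le> \<Psi> (D n x)" by (simp add: \<Psi>_def)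
    qed
  qed
  define B where "B = ((2 * (2 * a))\<^sup>2 + (2 * (2 * a)) powr (p / (p - 1))) * 2 powr p"
  have B: "B \<ge> 0" by (simp add: B_def)
  have D_bound: "AE x in M. \<forall>n. \<Psi> (D n x) \<le> B * m (u x) + B * m (h n x)"
    using increment_bound growth
  proof eventually_elim
    case (elim x)
    show ?case
    proof
      fix n
      define \<sigma> where "\<sigma> = \<bar>u x\<bar> + \<bar>h n x\<bar>"
      have \<sigma>: "\<sigma> \<ge> 0" by (simp add: \<sigma>_def)
      have "D n x \<le> 2 * a * (\<sigma> + \<sigma> powr (p - 1))"
      proof (cases "h n x = 0")
        case True
        then show ?thesis using a \<sigma> by (simp add: D_def)
      next
        case False
        have "\<bar>g x (u x)\<bar> \<le> a * (\<sigma> + \<sigma> powr (p - 1))"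
        proof -
          have "\<bar>u x\<bar> powr (p - 1) \<le> \<sigma> powr (p - 1)" using p by (intro powr_mono2) (auto simp: \<sigma>_def)
          then have "a * (\<bar>u x\<bar> + \<bar>u x\<bar> powr (p - 1)) \<le> a * (\<sigma> + \<sigma> powr (p - 1))"
            using a by (intro mult_left_mono add_mono) (auto simp: \<sigma>_def)
          then show ?thesis using elim(2)[rule_format, of "u x"] by simp
        qed
        then have "\<bar>g x (u x) * h n x\<bar> \<le> a * (\<sigma> + \<sigma> powr (p - 1)) * \<bar>h n x\<bar>"
          unfolding abs_mult by (rule mult_right_mono) simp
        moreover have "\<bar>G x (u x + h n x) - G x (u x)\<bar> \<le> a * (\<sigma> + \<sigma> powr (p - 1)) * \<bar>h n x\<bar>"
          using elim(1) by (simp add: \<sigma>_def)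
        ultimately have "\<bar>R n x\<bar> \<le> 2 * a * (\<sigma> + \<sigma> powr (p - 1)) * \<bar>h n x\<bar>"
          unfolding R_def by linarith
        then show ?thesis using False by (simp add: D_def pos_divide_le_eq)
      qed
      then have "\<Psi> (D n x) \<le> ((2 * (2 * a))\<^sup>2 + (2 * (2 * a)) powr (p / (p - 1))) * (\<sigma>\<^sup>2 + \<sigma> powr p)"
        unfolding \<Psi>_def using a by (intro dual_growth p \<sigma> D_nonneg) auto
      also have "\<dots> \<le> ((2 * (2 * a))\<^sup>2 + (2 * (2 * a)) powr (p / (p - 1))) * (2 powr p * (m (u x) + m (h n x)))"
      proof (rule mult_left_mono)
        have "\<sigma>\<^sup>2 \<le> 2 powr p * ((u x)\<^sup>2 + (h n x)\<^sup>2)"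
          using powr_add_le[of "\<bar>u x\<bar>" "\<bar>h n x\<bar>" 2 p] p by (simp add: \<sigma>_def)
        moreover have "\<sigma> powr p \<le> 2 powr p * (\<bar>u x\<bar> powr p + \<bar>h n x\<bar> powr p)"
          using powr_add_le[of "\<bar>u x\<bar>" "\<bar>h n x\<bar>" p p] p by (simp add: \<sigma>_def)
        ultimately show "\<sigma>\<^sup>2 + \<sigma> powr p \<le> 2 powr p * (m (u x) + m (h n x))"
          by (simp add: m_def distrib_left)
      qed simp
      also have "\<dots> = B * m (u x) + B * m (h n x)" by (simp add: B_def algebra_simps)
      finally show "\<Psi> (D n x) \<le> B * m (u x) + B * m (h n x)" .
    qed
  qed
  have \<Psi>_nonneg: "\<Psi> d \<ge> 0" for d by (simp add: \<Psi>_def)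
  have [measurable]: "m \<in> borel_measurable borel" unfolding m_def by measurable
  have int_\<Psi>: "integrable M (\<lambda>x. \<Psi> (D n x))" for n
  proof (rule Bochner_Integration.integrable_bound)
    show "integrable M (\<lambda>x. B * m (u x) + B * m (h n x))" using int_m[OF u] int_m[OF h] by auto
    show "AE x in M. norm (\<Psi> (D n x)) \<le> norm (B * m (u x) + B * m (h n x))"
      using D_bound by eventually_elim (use \<Psi>_nonneg in \<open>auto intro!: order_trans[OF _ abs_ge_self]\<close>)
  qed measurable
  \<comment> \<open>The bound on \<open>\<Psi>(D n)\<close> involves \<open>m(h n)\<close>, whose integral tends to \<open>0\<close>; subtracting it leaves the fixed majorant \<open>B m(u)\<close>.\<close>
  define Z where "Z n x = max 0 (\<Psi> (D n x) - B * m (h n x))" for n x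
  have [measurable]: "Z n \<in> borel_measurable M" for n unfolding Z_def by measurable
  have "(\<lambda>n. \<integral>x. Z n x \<partial>M) \<longlonglongrightarrow> (\<integral>x. 0 \<partial>M)"
  proof (rule integral_dominated_convergence[where w = "\<lambda>x. B * m (u x)"])
    show "integrable M (\<lambda>x. B * m (u x))" using int_m[OF u] by simp
    show "AE x in M. (\<lambda>n. Z n x) \<longlonglongrightarrow> 0"
      using D_lim
    proof eventually_elim
      case (elim x)
      show ?case
        by (rule tendsto_sandwich[OF _ _ tendsto_const elim])
           (auto simp: Z_def \<Psi>_nonneg B m_nonneg)
    qed
    show "AE x in M. norm (Z n x) \<le> B * m (u x)" for n
      using D_bound
    proof eventually_elim
      case (elim x)
      then show ?case using B m_nonneg[of "u x"] by (auto simp: Z_def algebra_simps dest: spec[of _ n])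
    qed
  qed auto
  then have lim_Z: "(\<lambda>n. (\<integral>x. Z n x \<partial>M) + B * (\<integral>x. m (h n x) \<partial>M)) \<longlonglongrightarrow> 0"
    using tendsto_add[OF _ tendsto_mult_left[OF lim_m, of B]] by fastforce
  have int_Z: "integrable M (Z n)" for n
    unfolding Z_def using int_\<Psi>[of n] int_m[OF h[of n]] by (intro integrable_max) auto
  have \<Psi>_le: "(\<integral>x. \<Psi> (D n x) \<partial>M) \<le> (\<integral>x. Z n x \<partial>M) + B * (\<integral>x. m (h n x) \<partial>M)" for n
  proof -
    have "(\<integral>x. \<Psi> (D n x) \<partial>M) \<le> (\<integral>x. Z n x + B * m (h n x) \<partial>M)"
      by (intro integral_mono int_\<Psi> Bochner_Integration.integrable_add int_Z integrable_mult_right int_m h)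
         (auto simp: Z_def)
    then show ?thesis using int_Z[of n] int_m[OF h[of n]] by simp
  qed
  have lim_\<Psi>: "(\<lambda>n. \<integral>x. \<Psi> (D n x) \<partial>M) \<longlonglongrightarrow> 0"
    by (rule tendsto_sandwich[OF _ _ tendsto_const lim_Z]) (use \<Psi>_le \<Psi>_nonneg in auto)
  obtain C where C: "C \<ge> 0" and young: "\<And>b d. 0 \<le> b \<Longrightarrow> 0 \<le> d \<Longrightarrow> b * d \<le> \<epsilon> / 4 * (b\<^sup>2 + b powr p) + C * \<Psi> d"
    using young_dual_pair[of p "\<epsilon> / 4"] p \<epsilon> unfolding \<Psi>_def by auto
  have "\<epsilon> / 2 \<le> C * (\<integral>x. \<Psi> (D n x) \<partial>M)" for n
  proof -
    let ?w = "\<lambda>x. \<bar>h n x\<bar> / \<rho> n"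
    have w2: "integrable M (\<lambda>x. (?w x)\<^sup>2)" "(\<integral>x. (?w x)\<^sup>2 \<partial>M) \<le> 1"
      using Lebesgue2pD(2)[OF h[of n]] h0_2[of "r n"] \<rho>[of n] by (auto simp: power_divide h_def \<rho>_def)
    have wp: "integrable M (\<lambda>x. ?w x powr p)" "(\<integral>x. ?w x powr p \<partial>M) \<le> 1"
      using Lebesgue2pD(3)[OF h[of n]] h0_p[of "r n"] \<rho>[of n] by (auto simp: powr_divide h_def \<rho>_def)
    have "\<epsilon> < (\<integral>x. \<bar>R n x\<bar> \<partial>M) / \<rho> n" using big[of n] \<rho>[of n] by (simp add: field_simps)
    also have "\<dots> = (\<integral>x. \<bar>R n x\<bar> / \<rho> n \<partial>M)" by simp
    also have "\<dots> \<le> (\<integral>x. \<epsilon> / 4 * ((?w x)\<^sup>2 + ?w x powr p) + C * \<Psi> (D n x) \<partial>M)"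
    proof (rule integral_mono)
      show "integrable M (\<lambda>x. \<bar>R n x\<bar> / \<rho> n)" using int_R[of n] by auto
      show "integrable M (\<lambda>x. \<epsilon> / 4 * ((?w x)\<^sup>2 + ?w x powr p) + C * \<Psi> (D n x))"
        using w2(1) wp(1) int_\<Psi>[of n] by auto
      show "\<bar>R n x\<bar> / \<rho> n \<le> \<epsilon> / 4 * ((?w x)\<^sup>2 + ?w x powr p) + C * \<Psi> (D n x)" for x
        using young[of "?w x" "D n x"] D_nonneg \<rho>[of n] by (simp add: R_D)
    qed
    also have "\<dots> = \<epsilon> / 4 * ((\<integral>x. (?w x)\<^sup>2 \<partial>M) + (\<integral>x. ?w x powr p \<partial>M)) + C * (\<integral>x. \<Psi> (D n x) \<partial>M)"
      using w2(1) wp(1) int_\<Psi>[of n] by simp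
    also have "\<dots> \<le> \<epsilon> / 4 * (1 + 1) + C * (\<integral>x. \<Psi> (D n x) \<partial>M)"
      using w2(2) wp(2) \<epsilon> by (intro add_right_mono mult_left_mono add_mono) auto
    finally show ?thesis by simp
  qed
  then have "\<epsilon> / 2 \<le> C * 0"
    by (intro tendsto_lowerbound[OF tendsto_mult_left[OF lim_\<Psi>]]) auto
  then show False using \<epsilon> by simp
qed

end

section \<open>The fractional Sobolev space and quadratic forms on it\<close>

lemma integrable_lebesgue_translation:
  fixes g :: "real^'n \<Rightarrow> real"
  assumes [measurable]: "g \<in> borel_measurable lebesgue"
  shows "integrable lebesgue (\<lambda>x. g (z + x)) \<longleftrightarrow> integrable lebesgue g"
    and "(\<integral>x. g (z + x) \<partial>lebesgue) = (\<integral>x. g x \<partial>lebesgue)"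
proof -
  show "integrable lebesgue (\<lambda>x. g (z + x)) \<longleftrightarrow> integrable lebesgue g"
    using integrable_distr_eq[OF translation_measurable assms, of z]
    by (simp add: distr_lebesgue_translation)
  show "(\<integral>x. g (z + x) \<partial>lebesgue) = (\<integral>x. g x \<partial>lebesgue)"
    using integral_distr[OF translation_measurable assms, of z]
    by (simp add: distr_lebesgue_translation)
qed

lemma sobolevD:
  assumes "u \<in> sobolev \<alpha>"
  shows "u \<in> borel_measurable lebesgue" "integrable lebesgue (\<lambda>x. (u x)\<^sup>2)"
    "integrable (lebesgue \<Otimes>\<^sub>M lebesgue) (gagliardo_kernel \<alpha> u)"
  using assms by (auto simp: sobolev_def)

lemma gagliardo_nonneg: "gagliardo \<alpha> u \<ge> 0"
  unfolding gagliardo_def by (intro Bochner_Integration.integral_nonneg) simp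

lemma sobolev_norm_nonneg: "sobolev_norm \<alpha> u \<ge> 0"
  unfolding sobolev_norm_def by (intro real_sqrt_ge_zero add_nonneg_nonneg Bochner_Integration.integral_nonneg gagliardo_nonneg) auto

lemma sobolev_norm_sq: "(sobolev_norm \<alpha> u)\<^sup>2 = (\<integral>x. (u x)\<^sup>2 \<partial>lebesgue) + gagliardo \<alpha> u"
  unfolding sobolev_norm_def by (subst real_sqrt_pow2) (auto intro!: add_nonneg_nonneg Bochner_Integration.integral_nonneg gagliardo_nonneg)

lemma sobolev_translation:
  fixes u :: "real^'n \<Rightarrow> real"
  assumes u: "u \<in> sobolev \<alpha>"
  shows "(\<lambda>x. u (z + x)) \<in> sobolev \<alpha>" "gagliardo \<alpha> (\<lambda>x. u (z + x)) = gagliardo \<alpha> u"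
proof -
  note [measurable] = sobolevD(1)[OF u]
  let ?T = "\<lambda>(x, y). (z + x, z + y)"
  have k: "gagliardo_kernel \<alpha> (\<lambda>x. u (z + x)) = (\<lambda>p. gagliardo_kernel \<alpha> u (?T p))"
    by (auto simp: gagliardo_kernel_def)
  have T: "?T \<in> lebesgue \<Otimes>\<^sub>M lebesgue \<rightarrow>\<^sub>M (lebesgue \<Otimes>\<^sub>M (lebesgue :: (real^'n) measure))"
    by measurable
  have m: "gagliardo_kernel \<alpha> u \<in> borel_measurable (lebesgue \<Otimes>\<^sub>M lebesgue)" by measurable
  have "integrable (lebesgue \<Otimes>\<^sub>M lebesgue) (gagliardo_kernel \<alpha> (\<lambda>x. u (z + x)))"
    unfolding k using integrable_distr_eq[OF T m] sobolevD(3)[OF u] by (simp add: distr_pair_translation)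
  moreover have "integrable lebesgue (\<lambda>x. (u (z + x))\<^sup>2)"
    using integrable_lebesgue_translation(1)[of "\<lambda>x. (u x)\<^sup>2" z] sobolevD(2)[OF u] by simp
  ultimately show "(\<lambda>x. u (z + x)) \<in> sobolev \<alpha>" by (simp add: sobolev_def)
  show "gagliardo \<alpha> (\<lambda>x. u (z + x)) = gagliardo \<alpha> u"
    unfolding gagliardo_def k using integral_distr[OF T m] by (simp add: distr_pair_translation)
qed

definition gagliardo_form_kernel ::
    "real \<Rightarrow> (real ^ 'n \<Rightarrow> real) \<Rightarrow> (real ^ 'n \<Rightarrow> real) \<Rightarrow> (real ^ 'n) \<times> (real ^ 'n) \<Rightarrow> real" where
  "gagliardo_form_kernel \<alpha> u h = (\<lambda>(x, y). (u x - u y) * (h x - h y) / norm (x - y) powr (real CARD('n) + \<alpha>))"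

lemma gagliardo_form_kernel_measurable [measurable]:
  assumes [measurable]: "u \<in> borel_measurable lebesgue" "h \<in> borel_measurable lebesgue"
  shows "gagliardo_form_kernel \<alpha> u h \<in> borel_measurable (lebesgue \<Otimes>\<^sub>M (lebesgue :: (real^'n) measure))"
proof -
  have [measurable]: "(\<lambda>p. fst p - snd p) \<in> borel_measurable (lebesgue \<Otimes>\<^sub>M (lebesgue :: (real^'n) measure))"
    by (intro borel_measurable_diff measurable_compose[OF measurable_fst] measurable_compose[OF measurable_snd]) measurable
  show ?thesis
    unfolding gagliardo_form_kernel_def split_beta by measurable
qed

lemma gagliardo_kernel_lincomb:
  "gagliardo_kernel \<alpha> (\<lambda>x. a * u x + b * h x) p
   = a\<^sup>2 * gagliardo_kernel \<alpha> u p + 2 * a * b * gagliardo_form_kernel \<alpha> u h p + b\<^sup>2 * gagliardo_kernel \<alpha> h p"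
proof -
  obtain x y where p: "p = (x, y)" by (cases p)
  have "\<bar>(a * u x + b * h x) - (a * u y + b * h y)\<bar>\<^sup>2
     = a\<^sup>2 * \<bar>u x - u y\<bar>\<^sup>2 + 2 * a * b * ((u x - u y) * (h x - h y)) + b\<^sup>2 * \<bar>h x - h y\<bar>\<^sup>2"
    by (simp add: power2_eq_square algebra_simps)
  then show ?thesis
    unfolding p gagliardo_kernel_def gagliardo_form_kernel_def prod.case by (simp only: add_divide_distrib times_divide_eq_right)
qed

lemma gagliardo_form_kernel_self: "gagliardo_form_kernel \<alpha> u u = gagliardo_kernel \<alpha> u"
  by (auto simp: gagliardo_form_kernel_def gagliardo_kernel_def power2_eq_square)

lemma gagliardo_form_kernel_bound:
  "\<bar>gagliardo_form_kernel \<alpha> u h p\<bar> \<le> gagliardo_kernel \<alpha> u p + gagliardo_kernel \<alpha> h p"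
proof -
  obtain x y where p: "p = (x, y)" by (cases p)
  let ?d = "norm (x - y) powr (real CARD('a) + \<alpha>)"
  have "\<bar>(u x - u y) * (h x - h y)\<bar> / ?d \<le> (\<bar>u x - u y\<bar>\<^sup>2 + \<bar>h x - h y\<bar>\<^sup>2) / ?d"
    using abs_mult_le[of "u x - u y" "h x - h y"] by (intro divide_right_mono) auto
  then show ?thesis
    unfolding p gagliardo_kernel_def gagliardo_form_kernel_def prod.case
    by (simp add: add_divide_distrib)
qed

lemma integrable_gagliardo_form_kernel:
  assumes u: "u \<in> sobolev \<alpha>" and h: "h \<in> sobolev \<alpha>"
  shows "integrable (lebesgue \<Otimes>\<^sub>M lebesgue) (gagliardo_form_kernel \<alpha> u h)"
proof (rule Bochner_Integration.integrable_bound)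
  show "integrable (lebesgue \<Otimes>\<^sub>M lebesgue) (\<lambda>p. gagliardo_kernel \<alpha> u p + gagliardo_kernel \<alpha> h p)"
    using sobolevD(3)[OF u] sobolevD(3)[OF h] by simp
  show "gagliardo_form_kernel \<alpha> u h \<in> borel_measurable (lebesgue \<Otimes>\<^sub>M lebesgue)"
    using sobolevD(1)[OF u] sobolevD(1)[OF h] by (rule gagliardo_form_kernel_measurable)
qed (simp add: gagliardo_form_kernel_bound)

lemma sobolev_lincomb:
  assumes u: "u \<in> sobolev \<alpha>" and h: "h \<in> sobolev \<alpha>"
  shows "(\<lambda>x. a * u x + b * h x) \<in> sobolev \<alpha>"
  unfolding sobolev_def
proof (intro CollectI conjI)
  note [measurable] = sobolevD(1)[OF u] sobolevD(1)[OF h]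
  show "(\<lambda>x. a * u x + b * h x) \<in> borel_measurable lebesgue" by measurable
  show "integrable lebesgue (\<lambda>x. \<bar>a * u x + b * h x\<bar>\<^sup>2)"
  proof (rule Bochner_Integration.integrable_bound)
    show "integrable lebesgue (\<lambda>x. 2 * a\<^sup>2 * (u x)\<^sup>2 + 2 * b\<^sup>2 * (h x)\<^sup>2)"
      using sobolevD(2)[OF u] sobolevD(2)[OF h] by auto
    have "(a * s + b * t)\<^sup>2 \<le> 2 * a\<^sup>2 * s\<^sup>2 + 2 * b\<^sup>2 * t\<^sup>2" for s t :: real
      using sum_squares_bound[of "a * s" "b * t"] by (simp add: power2_sum power_mult_distrib)
    then show "AE x in lebesgue. norm (\<bar>a * u x + b * h x\<bar>\<^sup>2) \<le> norm (2 * a\<^sup>2 * (u x)\<^sup>2 + 2 * b\<^sup>2 * (h x)\<^sup>2)" by simp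
  qed measurable
  show "integrable (lebesgue \<Otimes>\<^sub>M lebesgue) (gagliardo_kernel \<alpha> (\<lambda>x. a * u x + b * h x))"
    unfolding gagliardo_kernel_lincomb[abs_def]
    using sobolevD(3)[OF u] sobolevD(3)[OF h] integrable_gagliardo_form_kernel[OF u h] by auto
qed

lemma sobolev_add: "u \<in> sobolev \<alpha> \<Longrightarrow> h \<in> sobolev \<alpha> \<Longrightarrow> (\<lambda>x. u x + h x) \<in> sobolev \<alpha>"
  using sobolev_lincomb[of u \<alpha> h 1 1] by simp

lemma sobolev_scale: "u \<in> sobolev \<alpha> \<Longrightarrow> (\<lambda>x. a * u x) \<in> sobolev \<alpha>"
  using sobolev_lincomb[of u \<alpha> u a 0] by simp

lemma sobolev_norm_scale:
  shows "sobolev_norm \<alpha> (\<lambda>x. a * u x) = \<bar>a\<bar> * sobolev_norm \<alpha> u"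
proof -
  have "gagliardo \<alpha> (\<lambda>x. a * u x) = a\<^sup>2 * gagliardo \<alpha> u"
    using gagliardo_kernel_lincomb[of \<alpha> a u 0 u] by (simp add: gagliardo_def)
  then have "(sobolev_norm \<alpha> (\<lambda>x. a * u x))\<^sup>2 = (\<bar>a\<bar> * sobolev_norm \<alpha> u)\<^sup>2"
    by (simp add: sobolev_norm_sq power_mult_distrib distrib_left)
  then show ?thesis
    by (rule power2_eq_imp_eq) (auto simp: sobolev_norm_nonneg)
qed

lemma integral_square_le_sobolev_norm:
  "(\<integral>x. (u x)\<^sup>2 \<partial>lebesgue) \<le> (sobolev_norm \<alpha> u)\<^sup>2"
  using gagliardo_nonneg[of \<alpha> u] by (simp add: sobolev_norm_sq)

lemma local_energy_UNIV:
  assumes u: "u \<in> sobolev \<alpha>"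
  shows "local_energy \<alpha> u UNIV = ennreal ((sobolev_norm \<alpha> u)\<^sup>2)"
proof -
  have "(\<integral>\<^sup>+x. ennreal ((u x)\<^sup>2) \<partial>lebesgue) = ennreal (\<integral>x. (u x)\<^sup>2 \<partial>lebesgue)"
    by (rule nn_integral_eq_integral) (use sobolevD(2)[OF u] in auto)
  moreover have "(\<integral>\<^sup>+p. ennreal (gagliardo_kernel \<alpha> u p) \<partial>(lebesgue \<Otimes>\<^sub>M lebesgue)) = ennreal (gagliardo \<alpha> u)"
    unfolding gagliardo_def by (rule nn_integral_eq_integral) (use sobolevD(3)[OF u] in auto)
  ultimately show ?thesis
    by (simp add: local_energy_def sobolev_norm_sq ennreal_plus gagliardo_nonneg)
qed

lemma sobolev_norm_zero_imp:
  assumes u: "u \<in> sobolev \<alpha>" and "sobolev_norm \<alpha> u = 0"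
  shows "AE x in lebesgue. u x = 0"
proof -
  have "(\<integral>x. (u x)\<^sup>2 \<partial>lebesgue) \<le> 0" using integral_square_le_sobolev_norm[of u \<alpha>] assms(2) by simp
  moreover have "(\<integral>x. (u x)\<^sup>2 \<partial>lebesgue) \<ge> 0" by (rule Bochner_Integration.integral_nonneg) simp
  ultimately have "(\<integral>x. (u x)\<^sup>2 \<partial>lebesgue) = 0" by simp
  then have "AE x in lebesgue. (u x)\<^sup>2 = 0"
    using integral_nonneg_eq_0_iff_AE[OF sobolevD(2)[OF u]] by simp
  then show ?thesis by simp
qed

lemma sobolev_in_Lebesgue2p:
  fixes \<alpha> p :: real
  assumes \<alpha>: "0 < \<alpha>" "\<alpha> < real CARD('n)" and p: "2 \<le> p" "p \<le> critical_exponent TYPE('n) \<alpha>"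
  shows "\<exists>C\<ge>0. \<forall>u \<in> sobolev \<alpha>. u \<in> Lebesgue2p (lebesgue :: (real^'n) measure) p \<and>
     (\<integral>x. \<bar>u x\<bar> powr p \<partial>lebesgue) \<le> C * sobolev_norm \<alpha> u powr p"
proof -
  obtain C where C: "C \<ge> 0" and emb: "\<And>u e. u \<in> borel_measurable lebesgue \<Longrightarrow> e > 0 \<Longrightarrow>
     local_energy \<alpha> u (UNIV :: (real^'n) set) \<le> ennreal e \<Longrightarrow>
     (\<integral>\<^sup>+x. ennreal (\<bar>u x\<bar> powr p) \<partial>lebesgue) \<le> ennreal (C * e powr (p / 2))"
    using Sobolev_embedding[OF \<alpha> p] by blast
  show ?thesis
  proof (intro exI[of _ C] conjI ballI C)
    fix u :: "real^'n \<Rightarrow> real"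
    assume u: "u \<in> sobolev \<alpha>"
    note [measurable] = sobolevD(1)[OF u]
    let ?e = "(sobolev_norm \<alpha> u)\<^sup>2"
    have "integrable lebesgue (\<lambda>x. \<bar>u x\<bar> powr p) \<and> (\<integral>x. \<bar>u x\<bar> powr p \<partial>lebesgue) \<le> C * sobolev_norm \<alpha> u powr p"
    proof (cases "sobolev_norm \<alpha> u = 0")
      case True
      have z: "AE x in lebesgue. \<bar>u x\<bar> powr p = 0"
        using sobolev_norm_zero_imp[OF u True] by eventually_elim simp
      have "integrable lebesgue (\<lambda>x. \<bar>u x\<bar> powr p)"
        using integrable_cong_AE[THEN iffD2, OF _ _ z] by simp
      moreover have "(\<integral>x. \<bar>u x\<bar> powr p \<partial>lebesgue) = 0"
        using integral_cong_AE[OF _ _ z] by simp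
      ultimately show ?thesis using True by simp
    next
      case False
      then have pos: "sobolev_norm \<alpha> u > 0" using sobolev_norm_nonneg[of \<alpha> u] by simp
      then have e: "?e powr (p / 2) = sobolev_norm \<alpha> u powr p"
        using powr_powr[of "sobolev_norm \<alpha> u" 2 "p / 2"] by (simp add: powr_realpow)
      have le: "(\<integral>\<^sup>+x. ennreal (\<bar>u x\<bar> powr p) \<partial>lebesgue) \<le> ennreal (C * sobolev_norm \<alpha> u powr p)"
        using emb[OF sobolevD(1)[OF u], of ?e] pos by (simp add: local_energy_UNIV[OF u] e)
      have int: "integrable lebesgue (\<lambda>x. \<bar>u x\<bar> powr p)"
        by (rule integrableI_bounded) (use le in \<open>auto intro: le_less_trans\<close>)
      then have "ennreal (\<integral>x. \<bar>u x\<bar> powr p \<partial>lebesgue) \<le> ennreal (C * sobolev_norm \<alpha> u powr p)"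
        using le by (subst nn_integral_eq_integral[symmetric]) auto
      then show ?thesis using int C by (simp add: ennreal_le_iff)
    qed
    then show "u \<in> Lebesgue2p lebesgue p" "(\<integral>x. \<bar>u x\<bar> powr p \<partial>lebesgue) \<le> C * sobolev_norm \<alpha> u powr p"
      using sobolevD(2)[OF u] by (auto simp: Lebesgue2p_def)
  qed
qed

lemma Hardy_inequality:
  fixes \<alpha> :: real
  assumes \<alpha>: "0 < \<alpha>" "\<alpha> < real CARD('n)"
  shows "\<exists>C\<ge>0. \<forall>u \<in> sobolev \<alpha>. integrable lebesgue (\<lambda>x :: real^'n. (u x)\<^sup>2 / norm x powr \<alpha>) \<and>
     (\<integral>x. (u x)\<^sup>2 / norm x powr \<alpha> \<partial>lebesgue) \<le> C * (sobolev_norm \<alpha> u)\<^sup>2"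
proof -
  obtain C where C: "C \<ge> 0" and hardy: "\<And>u. u \<in> borel_measurable lebesgue \<Longrightarrow>
     (\<integral>\<^sup>+x. ennreal ((u x)\<^sup>2 / norm x powr \<alpha>) * indicator (ball 0 1) x \<partial>lebesgue)
       \<le> ennreal C * local_energy \<alpha> u (ball (0 :: real^'n) 1)"
    using local_Hardy[OF \<alpha>] by blast
  show ?thesis
  proof (intro exI[of _ "C + 1"] conjI ballI)
    fix u :: "real^'n \<Rightarrow> real"
    assume u: "u \<in> sobolev \<alpha>"
    note [measurable] = sobolevD(1)[OF u]
    let ?e = "(sobolev_norm \<alpha> u)\<^sup>2"
    have pt: "ennreal ((u x)\<^sup>2 / norm x powr \<alpha>) \<le>
        ennreal ((u x)\<^sup>2 / norm x powr \<alpha>) * indicator (ball 0 1) x + ennreal ((u x)\<^sup>2)" for x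
    proof (cases "norm x < 1")
      case False
      then have "1 \<le> norm x powr \<alpha>" using \<alpha> by (intro ge_one_powr_ge_zero) auto
      then have "(u x)\<^sup>2 / norm x powr \<alpha> \<le> (u x)\<^sup>2"
        using mult_left_mono[of 1 "norm x powr \<alpha>" "(u x)\<^sup>2"] by (subst pos_divide_le_eq) auto
      then show ?thesis using False by (simp add: ennreal_leI)
    qed simp
    have "(\<integral>\<^sup>+x. ennreal ((u x)\<^sup>2 / norm x powr \<alpha>) \<partial>lebesgue)
      \<le> (\<integral>\<^sup>+x. ennreal ((u x)\<^sup>2 / norm x powr \<alpha>) * indicator (ball 0 1) x + ennreal ((u x)\<^sup>2) \<partial>lebesgue)"
      by (intro nn_integral_mono pt)
    also have "\<dots> = (\<integral>\<^sup>+x. ennreal ((u x)\<^sup>2 / norm x powr \<alpha>) * indicator (ball 0 1) x \<partial>lebesgue) + (\<integral>\<^sup>+x. ennreal ((u x)\<^sup>2) \<partial>lebesgue)"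
      by (rule nn_integral_add) measurable
    also have "\<dots> \<le> ennreal C * ennreal ?e + ennreal ?e"
    proof (rule add_mono)
      show "(\<integral>\<^sup>+x. ennreal ((u x)\<^sup>2 / norm x powr \<alpha>) * indicator (ball 0 1) x \<partial>lebesgue) \<le> ennreal C * ennreal ?e"
        unfolding local_energy_UNIV[OF u, symmetric]
        by (intro order_trans[OF hardy] mult_left_mono local_energy_mono sobolevD[OF u]) auto
      show "(\<integral>\<^sup>+x. ennreal ((u x)\<^sup>2) \<partial>lebesgue) \<le> ennreal ?e"
        unfolding local_energy_UNIV[OF u, symmetric] local_energy_def by simp
    qed
    also have "\<dots> = ennreal ((C + 1) * ?e)"
      using C by (simp add: ennreal_mult ennreal_plus distrib_right)
    finally have le: "(\<integral>\<^sup>+x. ennreal ((u x)\<^sup>2 / norm x powr \<alpha>) \<partial>lebesgue) \<le> ennreal ((C + 1) * ?e)" .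
    show int: "integrable lebesgue (\<lambda>x. (u x)\<^sup>2 / norm x powr \<alpha>)"
      by (rule integrableI_bounded) (use le in \<open>auto intro: le_less_trans\<close>)
    have "ennreal (\<integral>x. (u x)\<^sup>2 / norm x powr \<alpha> \<partial>lebesgue) \<le> ennreal ((C + 1) * ?e)"
      using le int by (subst nn_integral_eq_integral[symmetric]) auto
    then show "(\<integral>x. (u x)\<^sup>2 / norm x powr \<alpha> \<partial>lebesgue) \<le> (C + 1) * ?e"
      using C by (simp add: ennreal_le_iff)
  qed (use C in simp)
qed

text \<open>
  The weight may have an inverse power singularity of order \<open>\<alpha>\<close> at the origin, which is exactly
  what Hardy's inequality can absorb.
\<close>

locale schroedinger_form =
  fixes \<alpha> c B :: real and w :: "real^'n \<Rightarrow> real"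
  assumes \<alpha>: "0 < \<alpha>" "\<alpha> < real CARD('n)"
    and w_meas [measurable]: "w \<in> borel_measurable lebesgue"
    and B: "0 \<le> B" and w_bound: "AE x in lebesgue. \<bar>w x\<bar> \<le> B * (1 + 1 / norm x powr \<alpha>)"
begin

definition bilinear :: "(real^'n \<Rightarrow> real) \<Rightarrow> (real^'n \<Rightarrow> real) \<Rightarrow> real" where
  "bilinear u h = c * (\<integral>p. gagliardo_form_kernel \<alpha> u h p \<partial>(lebesgue \<Otimes>\<^sub>M lebesgue)) + (\<integral>x. w x * (u x * h x) \<partial>lebesgue)"

lemma bilinear_self: "bilinear u u = c * gagliardo \<alpha> u + (\<integral>x. w x * (u x)\<^sup>2 \<partial>lebesgue)"
  by (simp add: bilinear_def gagliardo_form_kernel_self gagliardo_def power2_eq_square)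

lemma weight_bound:
  "AE x in lebesgue. \<forall>s t. \<bar>w x * (s * t)\<bar> \<le> B * (s\<^sup>2 + t\<^sup>2 + s\<^sup>2 / norm x powr \<alpha> + t\<^sup>2 / norm x powr \<alpha>)"
  using w_bound
proof eventually_elim
  case (elim x)
  show ?case
  proof (intro allI)
    fix s t :: real
    have "\<bar>w x * (s * t)\<bar> \<le> (B * (1 + 1 / norm x powr \<alpha>)) * (s\<^sup>2 + t\<^sup>2)"
      unfolding abs_mult[of "w x"] using elim B by (intro mult_mono abs_mult_le) auto
    also have "\<dots> = B * (s\<^sup>2 + t\<^sup>2 + s\<^sup>2 / norm x powr \<alpha> + t\<^sup>2 / norm x powr \<alpha>)"
      by (simp add: algebra_simps add_divide_distrib)
    finally show "\<bar>w x * (s * t)\<bar> \<le> B * (s\<^sup>2 + t\<^sup>2 + s\<^sup>2 / norm x powr \<alpha> + t\<^sup>2 / norm x powr \<alpha>)" .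
  qed
qed

lemma integrable_weight:
  assumes u: "u \<in> sobolev \<alpha>" and h: "h \<in> sobolev \<alpha>"
  shows "integrable lebesgue (\<lambda>x. w x * (u x * h x))"
proof -
  note [measurable] = sobolevD(1)[OF u] sobolevD(1)[OF h]
  have "integrable lebesgue (\<lambda>x. (u x)\<^sup>2 / norm x powr \<alpha>)" "integrable lebesgue (\<lambda>x. (h x)\<^sup>2 / norm x powr \<alpha>)"
    using Hardy_inequality[OF \<alpha>] u h by blast+
  then have int: "integrable lebesgue (\<lambda>x. B * ((u x)\<^sup>2 + (h x)\<^sup>2 + (u x)\<^sup>2 / norm x powr \<alpha> + (h x)\<^sup>2 / norm x powr \<alpha>))"
    using sobolevD(2)[OF u] sobolevD(2)[OF h] by auto
  show ?thesis
    by (rule Bochner_Integration.integrable_bound[OF int]) (measurable, use weight_bound in eventually_elim, auto intro: order_trans[OF _ abs_ge_self])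
qed

lemma bilinear_bound:
  "\<exists>C\<ge>0. \<forall>u \<in> sobolev \<alpha>. \<forall>h \<in> sobolev \<alpha>. \<bar>bilinear u h\<bar> \<le> C * ((sobolev_norm \<alpha> u)\<^sup>2 + (sobolev_norm \<alpha> h)\<^sup>2)"
proof -
  obtain H where H: "H \<ge> 0" and hardy: "\<And>u. u \<in> sobolev \<alpha> \<Longrightarrow> integrable lebesgue (\<lambda>x :: real^'n. (u x)\<^sup>2 / norm x powr \<alpha>)"
     "\<And>u :: real^'n \<Rightarrow> real. u \<in> sobolev \<alpha> \<Longrightarrow> (\<integral>x. (u x)\<^sup>2 / norm x powr \<alpha> \<partial>lebesgue) \<le> H * (sobolev_norm \<alpha> u)\<^sup>2"
    using Hardy_inequality[OF \<alpha>] by blast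
  show ?thesis
  proof (intro exI[of _ "\<bar>c\<bar> + B * (1 + H)"] conjI ballI)
    fix u h :: "real^'n \<Rightarrow> real"
    assume u: "u \<in> sobolev \<alpha>" and h: "h \<in> sobolev \<alpha>"
    let ?n = "(sobolev_norm \<alpha> u)\<^sup>2 + (sobolev_norm \<alpha> h)\<^sup>2"
    have "\<bar>\<integral>p. gagliardo_form_kernel \<alpha> u h p \<partial>(lebesgue \<Otimes>\<^sub>M lebesgue)\<bar>
        \<le> (\<integral>p. \<bar>gagliardo_form_kernel \<alpha> u h p\<bar> \<partial>(lebesgue \<Otimes>\<^sub>M lebesgue))"
      by (rule integral_abs_bound)
    also have "\<dots> \<le> (\<integral>p. gagliardo_kernel \<alpha> u p + gagliardo_kernel \<alpha> h p \<partial>(lebesgue \<Otimes>\<^sub>M lebesgue))"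
      by (intro integral_mono Bochner_Integration.integrable_add sobolevD u h integrable_abs integrable_gagliardo_form_kernel gagliardo_form_kernel_bound)
    also have "\<dots> = gagliardo \<alpha> u + gagliardo \<alpha> h"
      using sobolevD(3)[OF u] sobolevD(3)[OF h] by (simp add: gagliardo_def)
    also have "\<dots> \<le> ?n"
      unfolding sobolev_norm_sq by (simp add: add_increasing2 Bochner_Integration.integral_nonneg add_mono)
    finally have 1: "\<bar>c * (\<integral>p. gagliardo_form_kernel \<alpha> u h p \<partial>(lebesgue \<Otimes>\<^sub>M lebesgue))\<bar> \<le> \<bar>c\<bar> * ?n"
      unfolding abs_mult by (rule mult_left_mono) simp
    have "\<bar>\<integral>x. w x * (u x * h x) \<partial>lebesgue\<bar> \<le> (\<integral>x. \<bar>w x * (u x * h x)\<bar> \<partial>lebesgue)"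
      by (rule integral_abs_bound)
    also have "\<dots> \<le> (\<integral>x. B * ((u x)\<^sup>2 + (h x)\<^sup>2 + (u x)\<^sup>2 / norm x powr \<alpha> + (h x)\<^sup>2 / norm x powr \<alpha>) \<partial>lebesgue)"
    proof (rule integral_mono_AE)
      show "integrable lebesgue (\<lambda>x. \<bar>w x * (u x * h x)\<bar>)" using integrable_weight[OF u h] by (rule integrable_abs)
      show "integrable lebesgue (\<lambda>x. B * ((u x)\<^sup>2 + (h x)\<^sup>2 + (u x)\<^sup>2 / norm x powr \<alpha> + (h x)\<^sup>2 / norm x powr \<alpha>))"
        using hardy(1) u h sobolevD(2)[OF u] sobolevD(2)[OF h] by auto
      show "AE x in lebesgue. \<bar>w x * (u x * h x)\<bar> \<le> B * ((u x)\<^sup>2 + (h x)\<^sup>2 + (u x)\<^sup>2 / norm x powr \<alpha> + (h x)\<^sup>2 / norm x powr \<alpha>)"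
        using weight_bound by eventually_elim blast
    qed
    also have "\<dots> = B * ((\<integral>x. (u x)\<^sup>2 \<partial>lebesgue) + (\<integral>x. (h x)\<^sup>2 \<partial>lebesgue)
        + (\<integral>x. (u x)\<^sup>2 / norm x powr \<alpha> \<partial>lebesgue) + (\<integral>x. (h x)\<^sup>2 / norm x powr \<alpha> \<partial>lebesgue))"
      using hardy(1)[OF u] hardy(1)[OF h] sobolevD(2)[OF u] sobolevD(2)[OF h] by simp
    also have "\<dots> \<le> B * ((sobolev_norm \<alpha> u)\<^sup>2 + (sobolev_norm \<alpha> h)\<^sup>2 + H * (sobolev_norm \<alpha> u)\<^sup>2 + H * (sobolev_norm \<alpha> h)\<^sup>2)"
      by (intro mult_left_mono add_mono integral_square_le_sobolev_norm hardy u h B)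
    also have "\<dots> = B * (1 + H) * ?n" by (simp add: algebra_simps)
    finally have 2: "\<bar>\<integral>x. w x * (u x * h x) \<partial>lebesgue\<bar> \<le> B * (1 + H) * ?n" .
    show "\<bar>bilinear u h\<bar> \<le> (\<bar>c\<bar> + B * (1 + H)) * ?n"
      unfolding bilinear_def distrib_right[of "\<bar>c\<bar>"] using 1 2 by linarith
  qed (use B H in simp)
qed

lemma bilinear_lincomb_right:
  assumes u: "u \<in> sobolev \<alpha>" and v: "v \<in> sobolev \<alpha>" and h: "h \<in> sobolev \<alpha>"
  shows "bilinear u (\<lambda>x. a * v x + b * h x) = a * bilinear u v + b * bilinear u h"
proof -
  have "gagliardo_form_kernel \<alpha> u (\<lambda>x. a * v x + b * h x) p
      = a * gagliardo_form_kernel \<alpha> u v p + b * gagliardo_form_kernel \<alpha> u h p" for p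
    by (cases p) (simp add: gagliardo_form_kernel_def add_divide_distrib[symmetric], simp add: algebra_simps)
  moreover have "w x * (u x * (a * v x + b * h x)) = a * (w x * (u x * v x)) + b * (w x * (u x * h x))" for x
    by (simp add: algebra_simps)
  ultimately show ?thesis
    using integrable_gagliardo_form_kernel[OF u v] integrable_gagliardo_form_kernel[OF u h]
      integrable_weight[OF u v] integrable_weight[OF u h]
    by (simp add: bilinear_def algebra_simps)
qed

lemma bilinear_add_self:
  assumes u: "u \<in> sobolev \<alpha>" and h: "h \<in> sobolev \<alpha>"
  shows "bilinear (\<lambda>x. u x + h x) (\<lambda>x. u x + h x) = bilinear u u + 2 * bilinear u h + bilinear h h"
proof -
  have "gagliardo \<alpha> (\<lambda>x. u x + h x) = gagliardo \<alpha> u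
     + 2 * (\<integral>p. gagliardo_form_kernel \<alpha> u h p \<partial>(lebesgue \<Otimes>\<^sub>M lebesgue)) + gagliardo \<alpha> h"
    using gagliardo_kernel_lincomb[of \<alpha> 1 u 1 h] integrable_gagliardo_form_kernel[OF u h] sobolevD(3)[OF u] sobolevD(3)[OF h]
    by (simp add: gagliardo_def)
  moreover have "(\<integral>x. w x * (u x + h x)\<^sup>2 \<partial>lebesgue)
     = (\<integral>x. w x * (u x * u x) + 2 * (w x * (u x * h x)) + w x * (h x * h x) \<partial>lebesgue)"
    by (rule Bochner_Integration.integral_cong) (simp_all add: power2_eq_square algebra_simps)
  then have "(\<integral>x. w x * (u x + h x)\<^sup>2 \<partial>lebesgue)
     = (\<integral>x. w x * (u x)\<^sup>2 \<partial>lebesgue) + 2 * (\<integral>x. w x * (u x * h x) \<partial>lebesgue) + (\<integral>x. w x * (h x)\<^sup>2 \<partial>lebesgue)"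
    using integrable_weight[OF u h] integrable_weight[OF u u] integrable_weight[OF h h] by (simp add: power2_eq_square)
  ultimately show ?thesis
    unfolding bilinear_self by (simp add: bilinear_def algebra_simps)
qed

end

text \<open>
  A homogeneous functional bounded on the unit ball is bounded by a multiple of the norm; this also
  covers functions of norm \<open>0\<close>, since all their multiples lie in the unit ball. It
  reduces boundedness of the derivative to the pointwise inequality \<open>\<bar>s t\<bar> \<le> s\<^sup>2 + t\<^sup>2\<close>.
\<close>

lemma homogeneous_bounded:
  fixes L :: "(real^'n \<Rightarrow> real) \<Rightarrow> real"
  assumes hom: "\<And>v a. v \<in> sobolev \<alpha> \<Longrightarrow> L (\<lambda>x. a * v x) = a * L v"
    and bound: "\<And>v. v \<in> sobolev \<alpha> \<Longrightarrow> sobolev_norm \<alpha> v \<le> 1 \<Longrightarrow> \<bar>L v\<bar> \<le> C"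
    and v: "v \<in> sobolev \<alpha>"
  shows "\<bar>L v\<bar> \<le> C * sobolev_norm \<alpha> v"
proof (cases "sobolev_norm \<alpha> v = 0")
  case False
  let ?n = "sobolev_norm \<alpha> v"
  have n: "?n > 0" using False sobolev_norm_nonneg[of \<alpha> v] by simp
  have "\<bar>L (\<lambda>x. (1 / ?n) * v x)\<bar> \<le> C"
    using n by (intro bound sobolev_scale v) (subst sobolev_norm_scale, simp)
  then have "\<bar>L v\<bar> / ?n \<le> C" using n hom[OF v, of "1 / ?n"] by (simp add: abs_mult)
  then show ?thesis using n by (simp add: pos_divide_le_eq)
next
  case True
  have "\<bar>t * L v\<bar> \<le> C" for t
    using bound[OF sobolev_scale[OF v, of t]] by (simp add: sobolev_norm_scale True hom[OF v])
  from this[of "(C + 1) / L v"] this[of 0] have "L v = 0" by (cases "L v = 0") auto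
  then show ?thesis using True by simp
qed

locale semilinear = schroedinger_form \<alpha> c B w + superposition lebesgue G g a p
  for \<alpha> c B :: real and w :: "real^'n \<Rightarrow> real" and G g :: "real^'n \<Rightarrow> real \<Rightarrow> real" and a p :: real +
  assumes subcritical: "p \<le> critical_exponent TYPE('n) \<alpha>"
begin

definition functional :: "(real^'n \<Rightarrow> real) \<Rightarrow> real" where
  "functional u = 1/2 * bilinear u u - (\<integral>x. G x (u x) \<partial>lebesgue)"

definition derivative :: "(real^'n \<Rightarrow> real) \<Rightarrow> (real^'n \<Rightarrow> real) \<Rightarrow> real" where
  "derivative u h = bilinear u h - (\<integral>x. g x (u x) * h x \<partial>lebesgue)"

lemma sobolev_Lebesgue2p: "(u :: real^'n \<Rightarrow> real) \<in> sobolev \<alpha> \<Longrightarrow> u \<in> Lebesgue2p lebesgue p"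
  using sobolev_in_Lebesgue2p[OF \<alpha> _ subcritical] p by auto

lemma derivative_lincomb:
  assumes u: "u \<in> sobolev \<alpha>" and v: "v \<in> sobolev \<alpha>" and h: "h \<in> sobolev \<alpha>"
  shows "derivative u (\<lambda>x. r * v x + s * h x) = r * derivative u v + s * derivative u h"
proof -
  have "g x (u x) * (r * v x + s * h x) = r * (g x (u x) * v x) + s * (g x (u x) * h x)" for x
    by (simp add: algebra_simps)
  then show ?thesis
    using integrable_g_mult(1)[OF sobolev_Lebesgue2p[OF u] sobolev_Lebesgue2p[OF v]]
      integrable_g_mult(1)[OF sobolev_Lebesgue2p[OF u] sobolev_Lebesgue2p[OF h]]
    by (simp add: derivative_def bilinear_lincomb_right[OF u v h] algebra_simps)
qed

lemma derivative_bounded: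
  assumes u: "u \<in> sobolev \<alpha>"
  shows "\<exists>C. \<forall>v \<in> sobolev \<alpha>. \<bar>derivative u v\<bar> \<le> C * sobolev_norm \<alpha> v"
proof -
  obtain C1 where C1: "C1 \<ge> 0" "\<And>v. v \<in> sobolev \<alpha> \<Longrightarrow> \<bar>bilinear u v\<bar> \<le> C1 * ((sobolev_norm \<alpha> u)\<^sup>2 + (sobolev_norm \<alpha> v)\<^sup>2)"
    using bilinear_bound u by blast
  obtain C2 where C2: "C2 \<ge> 0" "\<And>v :: real^'n \<Rightarrow> real. v \<in> sobolev \<alpha> \<Longrightarrow> (\<integral>x. \<bar>v x\<bar> powr p \<partial>lebesgue) \<le> C2 * sobolev_norm \<alpha> v powr p"
    using sobolev_in_Lebesgue2p[OF \<alpha> _ subcritical] p by auto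
  let ?C = "C1 * ((sobolev_norm \<alpha> u)\<^sup>2 + 1) + a * ((\<integral>x. (u x)\<^sup>2 \<partial>lebesgue) + 1 + (\<integral>x. \<bar>u x\<bar> powr p \<partial>lebesgue) + C2)"
  have "\<bar>derivative u v\<bar> \<le> ?C" if v: "v \<in> sobolev \<alpha>" and n: "sobolev_norm \<alpha> v \<le> 1" for v
  proof -
    have n2: "(sobolev_norm \<alpha> v)\<^sup>2 \<le> 1" using n sobolev_norm_nonneg[of \<alpha> v] by (simp add: power_le_one)
    have np: "sobolev_norm \<alpha> v powr p \<le> 1"
      using powr_mono2[of p "sobolev_norm \<alpha> v" 1] n sobolev_norm_nonneg[of \<alpha> v] p by simp
    have "\<bar>bilinear u v\<bar> \<le> C1 * ((sobolev_norm \<alpha> u)\<^sup>2 + 1)"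
      using C1(2)[OF v] mult_left_mono[OF add_left_mono[OF n2], OF C1(1)] by (rule order_trans)
    moreover have "\<bar>\<integral>x. g x (u x) * v x \<partial>lebesgue\<bar> \<le> a * ((\<integral>x. (u x)\<^sup>2 \<partial>lebesgue) + 1 + (\<integral>x. \<bar>u x\<bar> powr p \<partial>lebesgue) + C2)"
    proof (rule order_trans[OF integrable_g_mult(2)[OF sobolev_Lebesgue2p[OF u] sobolev_Lebesgue2p[OF v]]])
      have "(\<integral>x. (v x)\<^sup>2 \<partial>lebesgue) \<le> 1" using integral_square_le_sobolev_norm[of v \<alpha>] n2 by linarith
      moreover have "(\<integral>x. \<bar>v x\<bar> powr p \<partial>lebesgue) \<le> C2"
        using C2(2)[OF v] mult_left_mono[OF np C2(1)] by simp
      ultimately show "a * ((\<integral>x. (u x)\<^sup>2 \<partial>lebesgue) + (\<integral>x. (v x)\<^sup>2 \<partial>lebesgue) + (\<integral>x. \<bar>u x\<bar> powr p \<partial>lebesgue) + (\<integral>x. \<bar>v x\<bar> powr p \<partial>lebesgue))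
         \<le> a * ((\<integral>x. (u x)\<^sup>2 \<partial>lebesgue) + 1 + (\<integral>x. \<bar>u x\<bar> powr p \<partial>lebesgue) + C2)"
        using a by (intro mult_left_mono) auto
    qed
    ultimately show ?thesis unfolding derivative_def by linarith
  qed
  moreover have "derivative u (\<lambda>x. r * v x) = r * derivative u v" if "v \<in> sobolev \<alpha>" for v r
    using derivative_lincomb[OF u that that, of r 0] by simp
  ultimately show ?thesis
    using homogeneous_bounded[of \<alpha> "derivative u" ?C] by blast
qed

text \<open>
  The quadratic form contributes the remainder \<open>bilinear h h / 2 = O(\<parallel>h\<parallel>\<^sup>2)\<close>. For the integral
  term, the embedding bounds the \<open>L\<^sup>2\<close> and \<open>L\<^sup>p\<close> norms of \<open>h\<close> by \<open>\<rho> = k \<parallel>h\<parallel>\<close> with one constant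
  \<open>k\<close>.
\<close>

lemma has_sobolev_derivative_functional:
  assumes u: "u \<in> sobolev \<alpha>"
  shows "has_sobolev_derivative \<alpha> functional (derivative u) u"
  unfolding has_sobolev_derivative_def
proof (intro conjI allI impI ballI)
  show "derivative u (\<lambda>x. r * v x + s * h x) = r * derivative u v + s * derivative u h"
    if "v \<in> sobolev \<alpha>" "h \<in> sobolev \<alpha>" for v h r s
    using derivative_lincomb u that by blast
  show "\<exists>C. \<forall>v \<in> sobolev \<alpha>. \<bar>derivative u v\<bar> \<le> C * sobolev_norm \<alpha> v"
    by (rule derivative_bounded[OF u])
  fix \<epsilon> :: real
  assume \<epsilon>: "\<epsilon> > 0"
  obtain C1 where C1: "C1 \<ge> 0" "\<And>u v. u \<in> sobolev \<alpha> \<Longrightarrow> v \<in> sobolev \<alpha> \<Longrightarrow> \<bar>bilinear u v\<bar> \<le> C1 * ((sobolev_norm \<alpha> u)\<^sup>2 + (sobolev_norm \<alpha> v)\<^sup>2)"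
    using bilinear_bound by blast
  obtain C2 where C2: "C2 \<ge> 0" "\<And>v :: real^'n \<Rightarrow> real. v \<in> sobolev \<alpha> \<Longrightarrow> (\<integral>x. \<bar>v x\<bar> powr p \<partial>lebesgue) \<le> C2 * sobolev_norm \<alpha> v powr p"
    using sobolev_in_Lebesgue2p[OF \<alpha> _ subcritical] p by auto
  \<comment> \<open>At least \<open>1\<close> for the \<open>L\<^sup>2\<close> norm, and \<open>k\<^sup>p \<ge> C2\<close> for the \<open>L\<^sup>p\<close> norm.\<close>
  define k where "k = 1 + C2"
  have k: "k \<ge> 1" "C2 \<le> k powr p"
  proof -
    show "k \<ge> 1" using C2 by (simp add: k_def)
    then have "k \<le> k powr p" using powr_mono[of 1 p k] p by simp
    then show "C2 \<le> k powr p" by (simp add: k_def)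
  qed
  have "\<epsilon> / (2 * k) > 0" using \<epsilon> k by simp
  from linearisation_error[OF sobolev_Lebesgue2p[OF u] this]
  obtain \<delta> where \<delta>: "\<delta> > 0" and err: "\<And>h \<rho>. h \<in> Lebesgue2p lebesgue p \<Longrightarrow> 0 < \<rho> \<Longrightarrow> \<rho> \<le> \<delta> \<Longrightarrow>
    (\<integral>x. (h x)\<^sup>2 \<partial>lebesgue) \<le> \<rho>\<^sup>2 \<Longrightarrow> (\<integral>x. \<bar>h x\<bar> powr p \<partial>lebesgue) \<le> \<rho> powr p \<Longrightarrow>
    \<bar>(\<integral>x. G x (u x + h x) \<partial>lebesgue) - (\<integral>x. G x (u x) \<partial>lebesgue) - (\<integral>x. g x (u x) * h x \<partial>lebesgue)\<bar> \<le> \<epsilon> / (2 * k) * \<rho>"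
    by blast
  show "\<exists>\<delta>>0. \<forall>h\<in>sobolev \<alpha>. sobolev_norm \<alpha> h < \<delta> \<longrightarrow>
        \<bar>functional (\<lambda>x. u x + h x) - functional u - derivative u h\<bar> \<le> \<epsilon> * sobolev_norm \<alpha> h"
  proof (intro exI[of _ "min (\<delta> / k) (\<epsilon> / (2 * (C1 + 1)))"] conjI ballI impI)
    show "0 < min (\<delta> / k) (\<epsilon> / (2 * (C1 + 1)))" using \<delta> k \<epsilon> C1 by simp
    fix h :: "real^'n \<Rightarrow> real"
    assume h: "h \<in> sobolev \<alpha>" and n: "sobolev_norm \<alpha> h < min (\<delta> / k) (\<epsilon> / (2 * (C1 + 1)))"
    let ?n = "sobolev_norm \<alpha> h"
    let ?E = "(\<integral>x. G x (u x + h x) \<partial>lebesgue) - (\<integral>x. G x (u x) \<partial>lebesgue) - (\<integral>x. g x (u x) * h x \<partial>lebesgue)"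
    have n0: "?n \<ge> 0" by (rule sobolev_norm_nonneg)
    have split: "functional (\<lambda>x. u x + h x) - functional u - derivative u h = 1/2 * bilinear h h - ?E"
      unfolding functional_def derivative_def bilinear_add_self[OF u h] by (simp add: algebra_simps)
    have "\<bar>bilinear h h\<bar> \<le> C1 * (?n\<^sup>2 + ?n\<^sup>2)" by (rule C1(2)[OF h h])
    also have "\<dots> = 2 * (C1 * ?n) * ?n" by (simp add: power2_eq_square)
    also have "\<dots> \<le> 2 * (\<epsilon> / 2) * ?n"
    proof (intro mult_right_mono mult_left_mono)
      have "?n * (C1 + 1) \<le> \<epsilon> / 2" using n C1(1) by (simp add: field_simps)
      then show "C1 * ?n \<le> \<epsilon> / 2" using n0 by (simp add: algebra_simps)
    qed (use n0 in auto)
    finally have 1: "\<bar>bilinear h h\<bar> \<le> \<epsilon> * ?n" by simp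
    have 2: "\<bar>?E\<bar> \<le> \<epsilon> / 2 * ?n"
    proof (cases "?n = 0")
      case True
      have "AE x in lebesgue. h x = 0" using sobolev_norm_zero_imp[OF h True] .
      note [measurable] = sobolevD(1)[OF u] sobolevD(1)[OF h]
      have "(\<integral>x. G x (u x + h x) \<partial>lebesgue) = (\<integral>x. G x (u x) \<partial>lebesgue)"
        by (rule integral_cong_AE) (auto intro!: meas_G simp: eventually_mono[OF \<open>AE x in lebesgue. h x = 0\<close>])
      moreover have "(\<integral>x. g x (u x) * h x \<partial>lebesgue) = 0"
        by (rule integral_eq_zero_AE) (simp add: eventually_mono[OF \<open>AE x in lebesgue. h x = 0\<close>])
      ultimately show ?thesis using True by simp
    next
      case False
      then have pos: "0 < ?n" using n0 by simp
      have "\<bar>?E\<bar> \<le> \<epsilon> / (2 * k) * (k * ?n)"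
      proof (rule err[OF sobolev_Lebesgue2p[OF h]])
        show "0 < k * ?n" using pos k by simp
        show "k * ?n \<le> \<delta>" using n k by (simp add: field_simps)
        have "(\<integral>x. (h x)\<^sup>2 \<partial>lebesgue) \<le> 1\<^sup>2 * ?n\<^sup>2" using integral_square_le_sobolev_norm[of h \<alpha>] by simp
        also have "\<dots> \<le> k\<^sup>2 * ?n\<^sup>2" using k by (intro mult_right_mono power_mono) auto
        finally show "(\<integral>x. (h x)\<^sup>2 \<partial>lebesgue) \<le> (k * ?n)\<^sup>2" by (simp add: power_mult_distrib)
        have "(\<integral>x. \<bar>h x\<bar> powr p \<partial>lebesgue) \<le> C2 * ?n powr p" by (rule C2(2)[OF h])
        also have "\<dots> \<le> k powr p * ?n powr p" using k by (intro mult_right_mono) auto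
        finally show "(\<integral>x. \<bar>h x\<bar> powr p \<partial>lebesgue) \<le> (k * ?n) powr p" using k n0 by (simp add: powr_mult)
      qed
      then show ?thesis using k by simp
    qed
    show "\<bar>functional (\<lambda>x. u x + h x) - functional u - derivative u h\<bar> \<le> \<epsilon> * ?n"
      unfolding split using 1 2 by linarith
  qed
qed

end

section \<open>Essential bounds and Caratheodory functions\<close>

lemma L_infinityD:
  fixes g :: "real^'n \<Rightarrow> real"
  assumes "g \<in> L_infinity"
  shows "g \<in> borel_measurable lebesgue" "\<exists>C\<ge>0. AE x in lebesgue. \<bar>g x\<bar> \<le> C"
proof -
  show "g \<in> borel_measurable lebesgue" using assms by (simp add: L_infinity_def)
  let ?s = "esssup lebesgue (\<lambda>x. ereal \<bar>g x\<bar>)"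
  have "?s < \<infinity>" using assms by (simp add: L_infinity_def)
  then have "?s \<le> ereal (max 0 (real_of_ereal ?s))" by (cases ?s) auto
  then have "AE x in lebesgue. ereal \<bar>g x\<bar> \<le> ereal (max 0 (real_of_ereal ?s))"
    using esssup_AE[of "\<lambda>x. ereal \<bar>g x\<bar>" lebesgue] by (auto elim!: eventually_mono intro: order_trans)
  then show "\<exists>C\<ge>0. AE x in lebesgue. \<bar>g x\<bar> \<le> C"
    by (intro exI[of _ "max 0 (real_of_ereal ?s)"] conjI) (simp_all only: ereal_less_eq max.cobounded1)
qed

lemma essinf_pos_imp:
  fixes g :: "real^'n \<Rightarrow> real"
  assumes "essinf g > 0"
  shows "\<exists>m>0. AE x in lebesgue. g x \<ge> m"
proof -
  let ?s = "esssup lebesgue (\<lambda>x. ereal (- g x))"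
  have "?s < 0" using assms by (cases ?s) (auto simp: essinf_def)
  then have "\<exists>m>0. ?s \<le> ereal (- m)"
  proof (cases ?s)
    case (real r)
    then show ?thesis using \<open>?s < 0\<close> by (intro exI[of _ "- r"]) auto
  next
    case MInf
    then show ?thesis by (intro exI[of _ 1]) auto
  qed simp
  then obtain m where m: "m > 0" "?s \<le> ereal (- m)" by blast
  have "AE x in lebesgue. g x \<ge> m"
    using esssup_AE[of "\<lambda>x. ereal (- g x)" lebesgue]
  proof eventually_elim
    case (elim x)
    from order_trans[OF elim m(2)] show ?case by simp
  qed
  then show ?thesis using m by blast
qed

text \<open>
  Lebesgue measurability on the product only says that \<open>f\<close> agrees with a Borel function off a null
  set of pairs, hence by Fubini on almost every fibre up to a null set of the fibre. Since this
  cannot be evaluated along a graph \<open>s = u x\<close>, measurability of superpositions is derived from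
  integrals over \<open>s\<close> in the next lemmas.
\<close>

lemma borel_representative:
  fixes f :: "real^'n \<Rightarrow> real \<Rightarrow> real"
  assumes "(\<lambda>(x, s). f x s) \<in> borel_measurable (lebesgue :: ((real^'n) \<times> real) measure)"
  shows "\<exists>k \<in> borel_measurable (borel \<Otimes>\<^sub>M borel). AE x in lebesgue. AE s in lborel. f x s = k (x, s)"
proof -
  obtain k where k: "k \<in> borel_measurable lborel" "AE z in lborel. (\<lambda>(x, s). f x s) z = k z"
    using completion_ex_borel_measurable_real[OF assms] by blast
  from k(2) have "AE z in lborel \<Otimes>\<^sub>M lborel. (\<lambda>(x, s). f x s) z = k z"
    by (simp only: lborel_prod)
  from lborel_pair.AE_pair[OF this] have "AE x in lborel. AE s in lborel. f x s = k (x, s)" by simp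
  then have "AE x in lebesgue. AE s in lborel. f x s = k (x, s)" by (rule AE_completion)
  then show ?thesis using k(1) by (intro bexI[of _ k]) (simp_all add: borel_prod)
qed

lemma primitive_eq:
  fixes f :: "real^'n \<Rightarrow> real \<Rightarrow> real"
  assumes "continuous_on UNIV (f x)"
  shows "primitive f x u = (LBINT s=0..u. f x s)"
proof -
  have [measurable]: "f x \<in> borel_measurable borel"
    using assms by (rule borel_measurable_continuous_onI)
  have "(\<integral>s. indicator (einterval a b) s *\<^sub>R f x s \<partial>lebesgue) = (\<integral>s. indicator (einterval a b) s *\<^sub>R f x s \<partial>lborel)" for a b
    by (rule integral_completion) measurable
  then show ?thesis
    unfolding primitive_def interval_lebesgue_integral_def set_lebesgue_integral_def by simp
qed

lemma primitive_has_derivative: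
  fixes f :: "real^'n \<Rightarrow> real \<Rightarrow> real"
  assumes c: "continuous_on UNIV (f x)"
  shows "(primitive f x has_real_derivative f x s) (at s)"
proof -
  let ?a = "min 0 s - 1" and ?b = "max 0 s + 1"
  have "((\<lambda>u. LBINT t=ereal 0..ereal u. f x t) has_vector_derivative f x s) (at s within {?a..?b})"
    by (rule interval_integral_FTC2) (auto intro: continuous_on_subset[OF c])
  moreover have "at s within {?a..?b} = at s"
    by (rule at_within_interior) (auto simp: interior_atLeastAtMost_real)
  ultimately show ?thesis
    unfolding primitive_eq[where f = f and x = x, OF c, abs_def] by (simp add: has_real_derivative_iff_has_vector_derivative zero_ereal_def)
qed

lemma primitive_zero [simp]: "primitive f x 0 = 0"
  by (simp add: primitive_def interval_lebesgue_integral_def set_lebesgue_integral_def zero_ereal_def)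

text \<open>
  The primitive integrates \<open>f x\<close> over \<open>s\<close>, so it does not change when \<open>f\<close> is replaced by its Borel
  representative; the signed indicator \<open>\<sigma>\<close> makes the limits of integration part of the integrand.
\<close>

lemma primitive_superposition_measurable:
  fixes f :: "real^'n \<Rightarrow> real \<Rightarrow> real"
  assumes f: "(\<lambda>(x, s). f x s) \<in> borel_measurable (lebesgue :: ((real^'n) \<times> real) measure)"
    and cont: "AE x in lebesgue. continuous_on UNIV (f x)"
    and u [measurable]: "u \<in> borel_measurable lebesgue"
  shows "(\<lambda>x. primitive f x (u x)) \<in> borel_measurable lebesgue"
proof -
  obtain k where k [measurable]: "k \<in> borel_measurable (borel \<Otimes>\<^sub>M borel)"
    and eq: "AE x in lebesgue. AE s in lborel. f x s = k (x, s)"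
    using borel_representative[OF f] by blast
  define \<sigma> where "\<sigma> r s = (if 0 < s \<and> s < r then 1 else if r < s \<and> s < 0 then -1 else (0::real))" for r s :: real
  define I where "I x = (\<integral>s. \<sigma> (u x) s * k (x, s) \<partial>lborel)" for x
  have [measurable]: "(\<lambda>z. k (fst z, snd z)) \<in> borel_measurable (lebesgue \<Otimes>\<^sub>M (lborel :: real measure))"
    by (rule measurable_compose[OF measurable_Pair k]) (intro measurable_compose[OF measurable_fst id_measurable_lebesgue_borel], simp)
  have "(\<lambda>z. \<sigma> (u (fst z)) (snd z) * k (fst z, snd z)) \<in> borel_measurable (lebesgue \<Otimes>\<^sub>M lborel)"
    unfolding \<sigma>_def by measurable
  then have I: "I \<in> borel_measurable lebesgue"
    unfolding I_def by (intro lborel.borel_measurable_lebesgue_integral) (simp only: case_prod_unfold)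
  have "AE x in lebesgue. I x = primitive f x (u x)"
    using eq cont
  proof eventually_elim
    case (elim x)
    have [measurable]: "f x \<in> borel_measurable borel"
      using elim(2) by (rule borel_measurable_continuous_onI)
    have "I x = (\<integral>s. \<sigma> (u x) s * f x s \<partial>lborel)"
      unfolding I_def
    proof (rule integral_cong_AE)
      show "(\<lambda>s. \<sigma> (u x) s * k (x, s)) \<in> borel_measurable lborel" unfolding \<sigma>_def by measurable
      show "(\<lambda>s. \<sigma> (u x) s * f x s) \<in> borel_measurable lborel" unfolding \<sigma>_def by measurable
      show "AE s in lborel. \<sigma> (u x) s * k (x, s) = \<sigma> (u x) s * f x s"
        using elim(1) by eventually_elim simp
    qed
    also have "\<dots> = (LBINT s=0..u x. f x s)"
    proof (cases "0 \<le> u x")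
      case True
      have "\<sigma> (u x) s * f x s = indicator (einterval 0 (ereal (u x))) s *\<^sub>R f x s" for s
        using True by (auto simp: \<sigma>_def einterval_def zero_ereal_def)
      then show ?thesis
        unfolding interval_lebesgue_integral_def set_lebesgue_integral_def using True by (simp only:) simp
    next
      case False
      have "\<sigma> (u x) s * f x s = - (indicator (einterval (ereal (u x)) 0) s *\<^sub>R f x s)" for s
        using False by (auto simp: \<sigma>_def einterval_def zero_ereal_def)
      then have "(\<integral>s. \<sigma> (u x) s * f x s \<partial>lborel) = - (\<integral>s. indicator (einterval (ereal (u x)) 0) s *\<^sub>R f x s \<partial>lborel)"
        by (simp only: Bochner_Integration.integral_minus)
      then show ?thesis
        unfolding interval_lebesgue_integral_def set_lebesgue_integral_def using False by (simp only:) simp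
    qed
    also have "\<dots> = primitive f x (u x)" by (rule primitive_eq[where f = f and x = x, OF elim(2), symmetric])
    finally show ?case .
  qed
  then show ?thesis by (rule borel_measurable_AE[OF I])
qed

text \<open>
  By continuity in the second variable, \<open>f x (u x)\<close> is a limit of difference quotients of the
  primitive, whose superpositions are measurable.
\<close>

lemma superposition_measurable:
  fixes f :: "real^'n \<Rightarrow> real \<Rightarrow> real"
  assumes f: "(\<lambda>(x, s). f x s) \<in> borel_measurable (lebesgue :: ((real^'n) \<times> real) measure)"
    and cont: "AE x in lebesgue. continuous_on UNIV (f x)"
    and u [measurable]: "u \<in> borel_measurable lebesgue"
  shows "(\<lambda>x. f x (u x)) \<in> borel_measurable lebesgue"
proof -
  have [measurable]: "(\<lambda>x. primitive f x (v x)) \<in> borel_measurable lebesgue"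
    if "v \<in> borel_measurable lebesgue" for v
    using primitive_superposition_measurable[OF f cont that] .
  define q where "q n x = (primitive f x (u x + 1 / Suc n) - primitive f x (u x)) / (1 / Suc n)" for n x
  have m: "q n \<in> borel_measurable lebesgue" for n
    unfolding q_def by (intro borel_measurable_divide borel_measurable_diff primitive_superposition_measurable[OF f cont]) measurable
  have "AE x in lebesgue. lim (\<lambda>n. q n x) = f x (u x)"
    using cont
  proof eventually_elim
    case (elim x)
    from primitive_has_derivative[where f = f and x = x and s = "u x", OF elim]
    have d: "((\<lambda>h. (primitive f x (u x + h) - primitive f x (u x)) / h) \<longlongrightarrow> f x (u x)) (at 0)"
      by (simp add: DERIV_def)
    have "filterlim (\<lambda>n. 1 / real (Suc n)) (at 0) sequentially"
      unfolding filterlim_at by (intro conjI always_eventually LIMSEQ_Suc[OF lim_1_over_n] allI) simp_all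
    from filterlim_compose[OF d this] show ?case
      by (intro limI) (simp add: q_def)
  qed
  then show ?thesis
    by (rule borel_measurable_AE[OF borel_measurable_lim_metric[OF m]])
qed

section \<open>Rays and the Nehari manifold\<close>

lemma derivative_along_ray:
  fixes \<Phi> :: "(real^'n \<Rightarrow> real) \<Rightarrow> real"
  assumes D: "has_sobolev_derivative \<alpha> \<Phi> L (\<lambda>x. t * u x)" and u: "u \<in> sobolev \<alpha>"
  shows "((\<lambda>t. \<Phi> (\<lambda>x. t * u x)) has_real_derivative L u) (at t)"
  unfolding DERIV_def
proof (rule LIM_I)
  fix r :: real
  assume r: "r > 0"
  let ?n = "sobolev_norm \<alpha> u"
  have n: "?n \<ge> 0" by (rule sobolev_norm_nonneg)
  have "r / (?n + 1) > 0" using r n by simp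
  with D obtain \<delta> where \<delta>: "\<delta> > 0" and err: "\<And>h. h \<in> sobolev \<alpha> \<Longrightarrow> sobolev_norm \<alpha> h < \<delta> \<Longrightarrow>
      \<bar>\<Phi> (\<lambda>x. t * u x + h x) - \<Phi> (\<lambda>x. t * u x) - L h\<bar> \<le> r / (?n + 1) * sobolev_norm \<alpha> h"
    unfolding has_sobolev_derivative_def by blast
  have lin: "L (\<lambda>x. s * u x) = s * L u" for s
  proof -
    have "L (\<lambda>x. s * u x + 0 * u x) = s * L u + 0 * L u"
      using D u unfolding has_sobolev_derivative_def by blast
    then show ?thesis by simp
  qed
  show "\<exists>d>0. \<forall>s. s \<noteq> 0 \<and> norm (s - 0) < d \<longrightarrow>
      norm ((\<Phi> (\<lambda>x. (t + s) * u x) - \<Phi> (\<lambda>x. t * u x)) / s - L u) < r"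
  proof (intro exI[of _ "\<delta> / (?n + 1)"] conjI allI impI)
    show "0 < \<delta> / (?n + 1)" using \<delta> n by simp
    fix s :: real
    assume s: "s \<noteq> 0 \<and> norm (s - 0) < \<delta> / (?n + 1)"
    then have "\<bar>s\<bar> * (?n + 1) < \<delta>" using n by (simp add: field_simps)
    then have "\<bar>s\<bar> * ?n < \<delta>" by (simp add: algebra_simps)
    then have "\<bar>\<Phi> (\<lambda>x. t * u x + s * u x) - \<Phi> (\<lambda>x. t * u x) - s * L u\<bar> \<le> r / (?n + 1) * (\<bar>s\<bar> * ?n)"
      using err[OF sobolev_scale[OF u, of s]] by (simp add: sobolev_norm_scale lin)
    also have "\<dots> = \<bar>s\<bar> * (r * (?n / (?n + 1)))" by simp
    also have "\<dots> < \<bar>s\<bar> * (r * 1)"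
      using s r n by (intro mult_strict_left_mono) (auto simp: divide_less_eq)
    finally have "\<bar>\<Phi> (\<lambda>x. t * u x + s * u x) - \<Phi> (\<lambda>x. t * u x) - s * L u\<bar> / \<bar>s\<bar> < r"
      using s by (simp add: pos_divide_less_eq mult.commute)
    moreover have "(\<Phi> (\<lambda>x. (t + s) * u x) - \<Phi> (\<lambda>x. t * u x)) / s - L u
       = (\<Phi> (\<lambda>x. t * u x + s * u x) - \<Phi> (\<lambda>x. t * u x) - s * L u) / s"
      using s by (simp add: distrib_right diff_divide_distrib)
    ultimately show "norm ((\<Phi> (\<lambda>x. (t + s) * u x) - \<Phi> (\<lambda>x. t * u x)) / s - L u) < r"
      by simp
  qed
qed

text \<open>
  The properties of the nonlinearity that determine the shape of \<open>t \<mapsto> functional (t u)\<close>: the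
  slope divided by \<open>t\<^bsup>q-1\<^esup>\<close> decreases, the function is positive near \<open>0\<close> by \<open>G_small\<close>, and it
  tends to \<open>-\<infinity>\<close> by \<open>G_large\<close>.
\<close>

locale nehari_fibering = semilinear \<alpha> c B w G g a p
  for \<alpha> c B :: real and w :: "real^'n \<Rightarrow> real" and G g :: "real^'n \<Rightarrow> real \<Rightarrow> real" and a p :: real +
  fixes q m :: real
  assumes q: "2 < q" "q \<le> p" and c: "0 \<le> c" and m: "0 < m" "AE x in lebesgue. m \<le> w x"
    and fiber_mono: "AE x in lebesgue. \<forall>r s t. 0 < s \<longrightarrow> s \<le> t \<longrightarrow>
          g x (s * r) * r / s powr (q - 1) \<le> g x (t * r) * r / t powr (q - 1)"
    and G_small: "\<And>\<epsilon>. \<epsilon> > 0 \<Longrightarrow> \<exists>C\<ge>0. AE x in lebesgue. \<forall>s. G x s \<le> \<epsilon> * s\<^sup>2 + C * \<bar>s\<bar> powr p"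
    and G_large: "\<exists>C\<ge>0. AE x in lebesgue. \<forall>s. \<bar>s\<bar> powr q - C * s\<^sup>2 \<le> G x s"
begin

lemma bilinear_scale_left: "bilinear (\<lambda>x. t * u x) h = t * bilinear u h"
proof -
  have "gagliardo_form_kernel \<alpha> (\<lambda>x. t * u x) h = (\<lambda>p. t * gagliardo_form_kernel \<alpha> u h p)"
    by (auto simp: gagliardo_form_kernel_def right_diff_distrib[symmetric])
  moreover have "(\<lambda>x. w x * (t * u x * h x)) = (\<lambda>x. t * (w x * (u x * h x)))" by auto
  ultimately show ?thesis unfolding bilinear_def by (simp only: Bochner_Integration.integral_mult_right_zero distrib_left mult.left_commute[of t c])
qed

lemma bilinear_scale:
  assumes "u \<in> sobolev \<alpha>"
  shows "bilinear (\<lambda>x. t * u x) (\<lambda>x. t * u x) = t\<^sup>2 * bilinear u u"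
proof -
  have "bilinear u (\<lambda>x. t * u x) = t * bilinear u u"
    using bilinear_lincomb_right[OF assms assms assms, of t 0] by simp
  then show ?thesis by (simp add: bilinear_scale_left power2_eq_square)
qed

lemma bilinear_coercive:
  assumes u: "u \<in> sobolev \<alpha>"
  shows "m * (\<integral>x. (u x)\<^sup>2 \<partial>lebesgue) \<le> bilinear u u"
proof -
  have "(\<integral>x. m * (u x)\<^sup>2 \<partial>lebesgue) \<le> (\<integral>x. w x * (u x)\<^sup>2 \<partial>lebesgue)"
  proof (rule integral_mono_AE)
    show "integrable lebesgue (\<lambda>x. m * (u x)\<^sup>2)" using sobolevD(2)[OF u] by simp
    show "integrable lebesgue (\<lambda>x. w x * (u x)\<^sup>2)" using integrable_weight[OF u u] by (simp add: power2_eq_square)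
    show "AE x in lebesgue. m * (u x)\<^sup>2 \<le> w x * (u x)\<^sup>2"
      using m(2) by eventually_elim (rule mult_right_mono, auto)
  qed
  moreover have "0 \<le> c * gagliardo \<alpha> u" by (intro mult_nonneg_nonneg c gagliardo_nonneg)
  ultimately show ?thesis unfolding bilinear_self using sobolevD(2)[OF u] by simp
qed

lemma functional_scale:
  assumes "u \<in> sobolev \<alpha>"
  shows "functional (\<lambda>x. t * u x) = t\<^sup>2 / 2 * bilinear u u - (\<integral>x. G x (t * u x) \<partial>lebesgue)"
  by (simp add: functional_def bilinear_scale[OF assms])

lemma functional_ray_derivative:
  assumes u: "u \<in> sobolev \<alpha>"
  shows "((\<lambda>t. functional (\<lambda>x. t * u x)) has_real_derivative derivative (\<lambda>x. t * u x) u) (at t)"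
  by (rule derivative_along_ray[OF has_sobolev_derivative_functional[OF sobolev_scale[OF u]] u])

text \<open>
  The quadratic part contributes \<open>t\<^bsup>2-q\<^esup> bilinear u u\<close>, decreasing because \<open>q > 2\<close> and the form is
  nonnegative; the nonlinear part decreases by \<open>fiber_mono\<close>.
\<close>

lemma fiber_slope_decreasing:
  assumes u: "u \<in> sobolev \<alpha>" and st: "0 < s" "s \<le> t"
  shows "derivative (\<lambda>x. t * u x) u / t powr (q - 1) \<le> derivative (\<lambda>x. s * u x) u / s powr (q - 1)"
proof -
  have A: "bilinear u u \<ge> 0"
  proof (rule order_trans[OF _ bilinear_coercive[OF u]])
    show "0 \<le> m * (\<integral>x. (u x)\<^sup>2 \<partial>lebesgue)"
      using m(1) by (intro mult_nonneg_nonneg Bochner_Integration.integral_nonneg) auto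
  qed
  have split: "derivative (\<lambda>x. r * u x) u / r powr (q - 1)
     = r powr (2 - q) * bilinear u u - (\<integral>x. g x (r * u x) * u x / r powr (q - 1) \<partial>lebesgue)" if "r > 0" for r
  proof -
    have "r / r powr (q - 1) = r powr (2 - q)"
      using that by (simp add: powr_diff power2_eq_square)
    moreover have "r * b / r powr (q - 1) = r / r powr (q - 1) * b" for b by simp
    ultimately show ?thesis by (simp only: derivative_def bilinear_scale_left diff_divide_distrib) simp
  qed
  have int: "integrable lebesgue (\<lambda>x. g x (r * u x) * u x / r powr (q - 1))" for r
    using integrable_g_mult(1)[OF sobolev_Lebesgue2p[OF sobolev_scale[OF u, of r]] sobolev_Lebesgue2p[OF u]] by simp
  have "(\<integral>x. g x (s * u x) * u x / s powr (q - 1) \<partial>lebesgue) \<le> (\<integral>x. g x (t * u x) * u x / t powr (q - 1) \<partial>lebesgue)"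
  proof (rule integral_mono_AE[OF int int])
    show "AE x in lebesgue. g x (s * u x) * u x / s powr (q - 1) \<le> g x (t * u x) * u x / t powr (q - 1)"
      using fiber_mono by eventually_elim (use st in blast)
  qed
  moreover have "t powr (2 - q) * bilinear u u \<le> s powr (2 - q) * bilinear u u"
    using st q A by (intro mult_right_mono powr_mono2') auto
  ultimately show ?thesis using st by (simp add: split)
qed

text \<open>
  The slope vanishes at \<open>1\<close>, so it is nonnegative before and nonpositive after.
\<close>

lemma critical_point_maximises_ray:
  assumes u: "u \<in> sobolev \<alpha>" and crit: "derivative u u = 0" and t: "t > 0"
  shows "functional (\<lambda>x. t * u x) \<le> functional u"
proof -
  let ?\<phi> = "\<lambda>t. functional (\<lambda>x. t * u x)" and ?d = "\<lambda>t. derivative (\<lambda>x. t * u x) u"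
  note D = functional_ray_derivative[OF u]
  have d_le: "?d z \<le> 0" if "z \<ge> 1" for z
    using fiber_slope_decreasing[OF u, of 1 z] that crit by (simp add: divide_le_0_iff)
  have d_ge: "?d z \<ge> 0" if "0 < z" "z \<le> 1" for z
    using fiber_slope_decreasing[OF u, of z 1] that crit by (simp add: zero_le_divide_iff)
  consider "t < 1" | "t = 1" | "t > 1" by linarith
  then show ?thesis
  proof cases
    case 1
    obtain z where "z > t" "z < 1" "?\<phi> 1 - ?\<phi> t = (1 - t) * ?d z"
      using MVT2[of t 1 ?\<phi> ?d] 1 D by blast
    moreover from this have "0 \<le> (1 - t) * ?d z" using t 1 by (intro mult_nonneg_nonneg d_ge) auto
    ultimately have "?\<phi> t \<le> ?\<phi> 1" by linarith
    then show ?thesis by simp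
  next
    case 3
    obtain z where "z > 1" "z < t" "?\<phi> t - ?\<phi> 1 = (t - 1) * ?d z"
      using MVT2[of 1 t ?\<phi> ?d] 3 D by blast
    moreover from this have "(t - 1) * ?d z \<le> 0" by (intro mult_nonneg_nonpos d_le) auto
    ultimately have "?\<phi> t \<le> ?\<phi> 1" by linarith
    then show ?thesis by simp
  qed simp
qed

text \<open>
  Along the ray the functional is \<open>0\<close> at \<open>0\<close>, positive at some \<open>t0\<close> and negative for all large
  \<open>t\<close>, so it attains its maximum at an interior point, where the slope vanishes.
\<close>

lemma ray_meets_nehari:
  assumes u: "u \<in> sobolev \<alpha>" and nz: "\<not> (AE x in lebesgue. u x = 0)"
  shows "\<exists>t>0. (\<lambda>x. t * u x) \<in> nehari \<alpha> functional"
proof -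
  let ?\<phi> = "\<lambda>t. functional (\<lambda>x. t * u x)"
  note D = functional_ray_derivative[OF u]
  note L = sobolev_Lebesgue2p[OF u]
  note [measurable] = sobolevD(1)[OF u]
  define I where "I = (\<integral>x. (u x)\<^sup>2 \<partial>lebesgue)"
  define P where "P = (\<integral>x. \<bar>u x\<bar> powr p \<partial>lebesgue)"
  define Q where "Q = (\<integral>x. \<bar>u x\<bar> powr q \<partial>lebesgue)"
  define A where "A = bilinear u u"
  have intQ: "integrable lebesgue (\<lambda>x. \<bar>u x\<bar> powr q)"
  proof (rule Bochner_Integration.integrable_bound)
    show "integrable lebesgue (\<lambda>x. (u x)\<^sup>2 + \<bar>u x\<bar> powr p)" using Lebesgue2pD[OF L] by simp
    have "\<bar>r\<bar> powr q \<le> r\<^sup>2 + \<bar>r\<bar> powr p" for r :: real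
      using powr_le_add_powr[of "\<bar>r\<bar>" 2 q p] q by simp
    then show "AE x in lebesgue. norm (\<bar>u x\<bar> powr q) \<le> norm ((u x)\<^sup>2 + \<bar>u x\<bar> powr p)" by simp
  qed measurable
  have P: "P \<ge> 0" unfolding P_def by (rule Bochner_Integration.integral_nonneg) simp
  have I: "I > 0"
  proof -
    have "I \<noteq> 0"
      unfolding I_def using integral_nonneg_eq_0_iff_AE[OF Lebesgue2pD(2)[OF L]] nz by simp
    moreover have "I \<ge> 0" unfolding I_def by (rule Bochner_Integration.integral_nonneg) simp
    ultimately show ?thesis by simp
  qed
  have Q: "Q > 0"
  proof -
    have "Q \<noteq> 0"
      unfolding Q_def using integral_nonneg_eq_0_iff_AE[OF intQ] nz by simp
    moreover have "Q \<ge> 0" unfolding Q_def by (rule Bochner_Integration.integral_nonneg) simp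
    ultimately show ?thesis by simp
  qed
  have intG: "integrable lebesgue (\<lambda>x. G x (t * u x))" for t
    by (rule integrable_G[OF sobolev_Lebesgue2p[OF sobolev_scale[OF u]]])
  obtain C1 where C1: "C1 \<ge> 0" and small: "AE x in lebesgue. \<forall>s. G x s \<le> m / 4 * s\<^sup>2 + C1 * \<bar>s\<bar> powr p"
    using G_small[of "m / 4"] m by auto
  obtain C2 where C2: "C2 \<ge> 0" and large: "AE x in lebesgue. \<forall>s. \<bar>s\<bar> powr q - C2 * s\<^sup>2 \<le> G x s"
    using G_large by auto
  have A: "m * I \<le> A" unfolding A_def I_def by (rule bilinear_coercive[OF u])
  have lower: "?\<phi> t \<ge> t\<^sup>2 * (m * I / 4) - C1 * P * t powr p" if t: "t > 0" for t
  proof -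
    have "(\<integral>x. G x (t * u x) \<partial>lebesgue) \<le> (\<integral>x. m / 4 * t\<^sup>2 * (u x)\<^sup>2 + C1 * t powr p * \<bar>u x\<bar> powr p \<partial>lebesgue)"
    proof (rule integral_mono_AE[OF intG])
      show "integrable lebesgue (\<lambda>x. m / 4 * t\<^sup>2 * (u x)\<^sup>2 + C1 * t powr p * \<bar>u x\<bar> powr p)"
        using Lebesgue2pD[OF L] by auto
      show "AE x in lebesgue. G x (t * u x) \<le> m / 4 * t\<^sup>2 * (u x)\<^sup>2 + C1 * t powr p * \<bar>u x\<bar> powr p"
        using small
      proof eventually_elim
        case (elim x)
        then show ?case using elim[rule_format, of "t * u x"] t
          by (simp add: power_mult_distrib abs_mult powr_mult mult.assoc)
      qed
    qed
    also have "\<dots> = t\<^sup>2 * (m * I / 4) + C1 * P * t powr p"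
      using Lebesgue2pD[OF L] by (simp add: I_def P_def)
    finally have "(\<integral>x. G x (t * u x) \<partial>lebesgue) \<le> t\<^sup>2 * (m * I / 4) + C1 * P * t powr p" .
    moreover have "t\<^sup>2 / 2 * (m * I) \<le> t\<^sup>2 / 2 * A" using A by (intro mult_left_mono) auto
    ultimately show ?thesis unfolding functional_scale[OF u] A_def[symmetric] by simp
  qed
  have upper: "?\<phi> t \<le> t\<^sup>2 * (A / 2 + C2 * I) - t powr q * Q" if t: "t > 0" for t
  proof -
    have "(\<integral>x. t powr q * \<bar>u x\<bar> powr q - C2 * t\<^sup>2 * (u x)\<^sup>2 \<partial>lebesgue) \<le> (\<integral>x. G x (t * u x) \<partial>lebesgue)"
    proof (rule integral_mono_AE[OF _ intG])
      show "integrable lebesgue (\<lambda>x. t powr q * \<bar>u x\<bar> powr q - C2 * t\<^sup>2 * (u x)\<^sup>2)"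
        using Lebesgue2pD[OF L] intQ by auto
      show "AE x in lebesgue. t powr q * \<bar>u x\<bar> powr q - C2 * t\<^sup>2 * (u x)\<^sup>2 \<le> G x (t * u x)"
        using large
      proof eventually_elim
        case (elim x)
        then show ?case using elim[rule_format, of "t * u x"] t
          by (simp add: power_mult_distrib abs_mult powr_mult mult.assoc)
      qed
    qed
    moreover have "(\<integral>x. t powr q * \<bar>u x\<bar> powr q - C2 * t\<^sup>2 * (u x)\<^sup>2 \<partial>lebesgue) = t powr q * Q - C2 * t\<^sup>2 * I"
      using Lebesgue2pD[OF L] intQ by (simp add: I_def Q_def)
    ultimately show ?thesis unfolding functional_scale[OF u] A_def[symmetric] by (simp add: algebra_simps)
  qed
  \<comment> \<open>At \<open>t0\<close> the term of order \<open>p\<close> in \<open>lower\<close> is at most half of the quadratic one.\<close>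
  define t0 where "t0 = (m * I / (8 * (C1 * P + 1))) powr (1 / (p - 2))"
  have C1P: "C1 * P \<ge> 0" using C1 P by simp
  have t0: "t0 > 0" unfolding t0_def using m I C1P by (simp add: powr_gt_zero add_nonneg_eq_0_iff)
  have pos: "?\<phi> t0 > 0"
  proof -
    have "t0 powr (p - 2) = m * I / (8 * (C1 * P + 1))"
      unfolding t0_def powr_powr using p m I C1P by simp
    then have "C1 * P * t0 powr (p - 2) = m * I / 8 * (C1 * P / (C1 * P + 1))" by simp
    also have "\<dots> \<le> m * I / 8 * 1"
      using m I C1P by (intro mult_left_mono) (auto simp: divide_le_eq)
    finally have "C1 * P * t0 powr (p - 2) \<le> m * I / 8" by simp
    moreover have "m * I > 0" using m(1) I by simp
    ultimately have "C1 * P * t0 powr (p - 2) < m * I / 4" by linarith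
    then have "t0\<^sup>2 * (C1 * P * t0 powr (p - 2)) < t0\<^sup>2 * (m * I / 4)"
      using t0 by (intro mult_strict_left_mono) auto
    moreover have "t0\<^sup>2 * (C1 * P * t0 powr (p - 2)) = C1 * P * t0 powr p"
      using t0 by (simp add: powr_diff)
    ultimately show ?thesis using lower[OF t0] by linarith
  qed
  \<comment> \<open>From \<open>T\<close> on, the term of order \<open>q\<close> in \<open>upper\<close> exceeds the quadratic one.\<close>
  define T where "T = ((A / 2 + C2 * I + 1) / Q) powr (1 / (q - 2))"
  have A0: "A \<ge> 0" using A m I by (meson less_imp_le mult_nonneg_nonneg order_trans)
  then have k: "A / 2 + C2 * I + 1 > 0" using C2 I by (simp add: add_nonneg_pos)
  have T: "T > 0" unfolding T_def using k Q by simp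
  have neg: "?\<phi> t < 0" if "t \<ge> T" for t
  proof -
    have t: "t > 0" using that T by simp
    have "(A / 2 + C2 * I + 1) / Q = T powr (q - 2)"
      unfolding T_def powr_powr using k Q q by simp
    also have "\<dots> \<le> t powr (q - 2)" using that T q by (intro powr_mono2) auto
    finally have "A / 2 + C2 * I + 1 \<le> t powr (q - 2) * Q" using Q by (simp add: pos_divide_le_eq)
    then have "t\<^sup>2 * (A / 2 + C2 * I) < t\<^sup>2 * (t powr (q - 2) * Q)"
      using t by (intro mult_strict_left_mono) auto
    also have "\<dots> = t powr q * Q" using t by (simp add: powr_diff)
    finally show ?thesis using upper[OF t] by linarith
  qed
  have "t0 < T" using neg[of t0] pos by (meson not_le order_less_asym)
  have "continuous_on {0..T} ?\<phi>"
    by (intro continuous_at_imp_continuous_on ballI DERIV_isCont[OF D])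
  then obtain t where t: "t \<in> {0..T}" and max: "\<And>s. s \<in> {0..T} \<Longrightarrow> ?\<phi> s \<le> ?\<phi> t"
    using continuous_attains_sup[of "{0..T}" ?\<phi>] T by auto
  have \<phi>t: "?\<phi> t > 0" using max[of t0] pos t0 \<open>t0 < T\<close> by simp
  have "?\<phi> 0 = 0"
  proof -
    have "(\<integral>x. G x 0 \<partial>lebesgue) = 0" by (rule integral_eq_zero_AE[OF zero])
    then show ?thesis using functional_scale[OF u, of 0] by simp
  qed
  then have "t \<noteq> 0" "t \<noteq> T" using \<phi>t neg[of T] by auto
  then have t': "0 < t" "t < T" using t by auto
  have "derivative (\<lambda>x. t * u x) u = 0"
  proof (rule DERIV_local_max[OF D])
    show "0 < min t (T - t)" using t' by simp
    show "\<forall>s. \<bar>t - s\<bar> < min t (T - t) \<longrightarrow> ?\<phi> s \<le> ?\<phi> t"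
      by (intro allI impI max) (auto simp: abs_if split: if_splits)
  qed
  moreover have "derivative (\<lambda>x. t * u x) (\<lambda>x. t * u x) = t * derivative (\<lambda>x. t * u x) u"
    using derivative_lincomb[OF sobolev_scale[OF u, of t] u u, of t 0] by simp
  ultimately have "derivative (\<lambda>x. t * u x) (\<lambda>x. t * u x) = 0" by simp
  moreover have "\<not> (AE x in lebesgue. t * u x = 0)" using nz t' by simp
  ultimately have "(\<lambda>x. t * u x) \<in> nehari \<alpha> functional"
    unfolding nehari_def using sobolev_scale[OF u, of t] has_sobolev_derivative_functional[OF sobolev_scale[OF u, of t]] by blast
  then show ?thesis using t' by blast
qed

end

section \<open>Mass moved to infinity\<close>

definition diagonal_point :: "nat \<Rightarrow> real^'n" where
  "diagonal_point n = (\<chi> i. real n)"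

lemma diagonal_point_lattice: "diagonal_point n \<in> integer_lattice"
  by (simp add: diagonal_point_def integer_lattice_def)

lemma norm_diagonal_point: "real n \<le> norm (diagonal_point n :: real^'n)"
  using component_le_norm_cart[of "diagonal_point n :: real^'n" undefined] by (simp add: diagonal_point_def)

lemma local_energy_tendsto_0:
  fixes u :: "real^'n \<Rightarrow> real"
  assumes u: "u \<in> sobolev \<alpha>"
  shows "(\<lambda>n. local_energy \<alpha> u (ball (diagonal_point n) R)) \<longlonglongrightarrow> 0"
proof -
  note [measurable] = sobolevD(1)[OF u]
  let ?B = "\<lambda>n. ball (diagonal_point n :: real^'n) R"
  have fin: "local_energy \<alpha> u UNIV < \<infinity>" by (simp add: local_energy_UNIV[OF u])
  have ev: "\<forall>\<^sub>F n in sequentially. x \<notin> ?B n" for x :: "real^'n"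
  proof -
    obtain N :: nat where N: "norm x + R < real N" using reals_Archimedean2 by blast
    show ?thesis
      using eventually_ge_at_top[of N]
    proof eventually_elim
      case (elim n)
      have "real n \<le> norm x + dist (diagonal_point n) x"
        using norm_diagonal_point[of n, where 'n='n] norm_triangle_sub[of "diagonal_point n" x]
        by (simp add: dist_norm)
      then show ?case using N elim by simp
    qed
  qed
  have "(\<lambda>n. \<integral>\<^sup>+x. ennreal ((u x)\<^sup>2) * indicator (?B n) x \<partial>lebesgue) \<longlonglongrightarrow> (\<integral>\<^sup>+x. 0 \<partial>(lebesgue :: (real^'n) measure))"
  proof (rule nn_integral_dominated_convergence[where w = "\<lambda>x. ennreal ((u x)\<^sup>2)"])
    show "(\<integral>\<^sup>+x. ennreal ((u x)\<^sup>2) \<partial>lebesgue) < \<infinity>"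
      using fin by (simp add: local_energy_def)
    show "AE x in lebesgue. (\<lambda>n. ennreal ((u x)\<^sup>2) * indicator (?B n) x) \<longlonglongrightarrow> 0"
    proof (rule AE_I2, rule tendsto_eventually)
      fix x
      show "\<forall>\<^sub>F n in sequentially. ennreal ((u x)\<^sup>2) * indicator (?B n) x = 0"
        using ev[of x] by eventually_elim simp
    qed
  qed (auto split: split_indicator)
  moreover have "(\<lambda>n. \<integral>\<^sup>+z. ennreal (gagliardo_kernel \<alpha> u z) * indicator (?B n \<times> ?B n) z \<partial>(lebesgue \<Otimes>\<^sub>M lebesgue))
      \<longlonglongrightarrow> (\<integral>\<^sup>+z. 0 \<partial>(lebesgue \<Otimes>\<^sub>M lebesgue :: ((real^'n) \<times> (real^'n)) measure))"
  proof (rule nn_integral_dominated_convergence[where w = "\<lambda>z. ennreal (gagliardo_kernel \<alpha> u z)"])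
    show "(\<integral>\<^sup>+z. ennreal (gagliardo_kernel \<alpha> u z) \<partial>(lebesgue \<Otimes>\<^sub>M lebesgue)) < \<infinity>"
      using fin by (simp add: local_energy_def)
    show "AE z in lebesgue \<Otimes>\<^sub>M lebesgue. (\<lambda>n. ennreal (gagliardo_kernel \<alpha> u z) * indicator (?B n \<times> ?B n) z) \<longlonglongrightarrow> 0"
    proof (rule AE_I2, rule tendsto_eventually)
      fix z :: "(real^'n) \<times> (real^'n)"
      show "\<forall>\<^sub>F n in sequentially. ennreal (gagliardo_kernel \<alpha> u z) * indicator (?B n \<times> ?B n) z = 0"
        using ev[of "fst z"] by eventually_elim (auto simp: indicator_def)
    qed
  qed (measurable, auto split: split_indicator)
  ultimately show ?thesis
    unfolding local_energy_def using tendsto_add by fastforce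
qed

text \<open>
  Outside a large ball \<open>ball 0 R\<close> the weight is at most \<open>2\<epsilon>\<close>. Inside, \<open>Vloc\<close> is bounded, and by the
  local Hardy inequality the singular part costs no more than the local energy of \<open>u\<close> on
  \<open>ball z R\<close>, which tends to \<open>0\<close> as \<open>z\<close> goes to infinity. The integral is taken in the extended
  sense, so that integrability is not presupposed.
\<close>

lemma weight_escapes:
  fixes u Vloc :: "real^'n \<Rightarrow> real" and \<alpha> \<mu> :: real
  assumes \<alpha>: "0 < \<alpha>" "\<alpha> < real CARD('n)" and u: "u \<in> sobolev \<alpha>"
    and [measurable]: "Vloc \<in> borel_measurable lebesgue" and C: "C \<ge> 0" "AE x in lebesgue. \<bar>Vloc x\<bar> \<le> C"
    and van: "ae_vanishes_at_infinity Vloc" and \<eta>: "\<eta> > 0"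
  shows "\<exists>z\<in>integer_lattice. (\<integral>\<^sup>+x. ennreal ((Vloc x - \<mu> / norm x powr \<alpha>) * (u (z + x))\<^sup>2) \<partial>lebesgue) < ennreal \<eta>"
proof -
  obtain H where H: "H \<ge> 0" and hardy: "\<And>u. u \<in> borel_measurable lebesgue \<Longrightarrow>
     (\<integral>\<^sup>+x. ennreal ((u x)\<^sup>2 / norm x powr \<alpha>) * indicator (ball 0 1) x \<partial>lebesgue)
       \<le> ennreal H * local_energy \<alpha> u (ball (0 :: real^'n) 1)"
    using local_Hardy[OF \<alpha>] by blast
  note [measurable] = sobolevD(1)[OF u]
  define I where "I = (\<integral>x. (u x)\<^sup>2 \<partial>lebesgue)"
  have I: "I \<ge> 0" unfolding I_def by (rule Bochner_Integration.integral_nonneg) simp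
  define \<epsilon> where "\<epsilon> = \<eta> / (4 * (I + 1))"
  have \<epsilon>: "\<epsilon> > 0" using \<eta> I by (simp add: \<epsilon>_def)
  obtain R1 where R1: "AE x in lebesgue. norm x \<ge> R1 \<longrightarrow> \<bar>Vloc x\<bar> < \<epsilon>"
    using van \<epsilon> unfolding ae_vanishes_at_infinity_def by blast
  define R where "R = max 1 (max R1 ((\<bar>\<mu>\<bar> / \<epsilon>) powr (1 / \<alpha>)))"
  have R: "R \<ge> 1" "R \<ge> R1" by (simp_all add: R_def)
  have far: "\<bar>\<mu>\<bar> / norm x powr \<alpha> \<le> \<epsilon>" if "norm x \<ge> R" for x :: "real^'n"
  proof -
    have "\<bar>\<mu>\<bar> / \<epsilon> = ((\<bar>\<mu>\<bar> / \<epsilon>) powr (1 / \<alpha>)) powr \<alpha>" using \<alpha> \<epsilon> by (simp add: powr_powr)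
    also have "\<dots> \<le> norm x powr \<alpha>" using that \<alpha> by (intro powr_mono2) (auto simp: R_def)
    finally have "\<bar>\<mu>\<bar> / \<epsilon> \<le> norm x powr \<alpha>" .
    moreover have "norm x powr \<alpha> > 0" using that R by auto
    ultimately show ?thesis using \<epsilon> by (simp add: field_simps)
  qed
  define D where "D = C + \<bar>\<mu>\<bar> + \<bar>\<mu>\<bar> * H"
  have D: "D \<ge> 0" using C H by (simp add: D_def)
  have bound: "(\<integral>\<^sup>+x. ennreal ((Vloc x - \<mu> / norm x powr \<alpha>) * (u (z + x))\<^sup>2) \<partial>lebesgue)
     \<le> ennreal (\<eta> / 2) + ennreal D * local_energy \<alpha> u (ball z R)" for z
  proof -
    let ?v = "\<lambda>x. u (z + x)"
    have "(\<integral>\<^sup>+x. ennreal ((Vloc x - \<mu> / norm x powr \<alpha>) * (?v x)\<^sup>2) \<partial>lebesgue)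
      \<le> (\<integral>\<^sup>+x. ennreal (2 * \<epsilon>) * ennreal ((?v x)\<^sup>2) + (ennreal (C + \<bar>\<mu>\<bar>) * (ennreal ((?v x)\<^sup>2) * indicator (ball 0 R) x)
         + ennreal \<bar>\<mu>\<bar> * (ennreal ((?v x)\<^sup>2 / norm x powr \<alpha>) * indicator (ball 0 1) x)) \<partial>lebesgue)"
    proof (rule nn_integral_mono_AE)
      show "AE x in lebesgue. ennreal ((Vloc x - \<mu> / norm x powr \<alpha>) * (?v x)\<^sup>2)
        \<le> ennreal (2 * \<epsilon>) * ennreal ((?v x)\<^sup>2) + (ennreal (C + \<bar>\<mu>\<bar>) * (ennreal ((?v x)\<^sup>2) * indicator (ball 0 R) x)
         + ennreal \<bar>\<mu>\<bar> * (ennreal ((?v x)\<^sup>2 / norm x powr \<alpha>) * indicator (ball 0 1) x))"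
        using C(2) R1
      proof eventually_elim
        case (elim x)
        have m: "- \<mu> / norm x powr \<alpha> \<le> \<bar>\<mu>\<bar> / norm x powr \<alpha>" by (intro divide_right_mono) auto
        consider "norm x < 1" | "1 \<le> norm x" "norm x < R" | "R \<le> norm x" by linarith
        then show ?case
        proof cases
          case 1
          have "Vloc x - \<mu> / norm x powr \<alpha> \<le> (C + \<bar>\<mu>\<bar>) + \<bar>\<mu>\<bar> / norm x powr \<alpha>"
            using elim(1) m by simp
          then have "(Vloc x - \<mu> / norm x powr \<alpha>) * (?v x)\<^sup>2 \<le> ((C + \<bar>\<mu>\<bar>) + \<bar>\<mu>\<bar> / norm x powr \<alpha>) * (?v x)\<^sup>2"
            by (rule mult_right_mono) simp
          also have "\<dots> = (C + \<bar>\<mu>\<bar>) * (?v x)\<^sup>2 + \<bar>\<mu>\<bar> * ((?v x)\<^sup>2 / norm x powr \<alpha>)"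
            by (simp add: distrib_right)
          finally have "ennreal ((Vloc x - \<mu> / norm x powr \<alpha>) * (?v x)\<^sup>2)
             \<le> ennreal (C + \<bar>\<mu>\<bar>) * ennreal ((?v x)\<^sup>2) + ennreal \<bar>\<mu>\<bar> * ennreal ((?v x)\<^sup>2 / norm x powr \<alpha>)"
            using C(1) by (subst (1 2) ennreal_mult[symmetric]) (auto simp flip: ennreal_plus intro!: ennreal_leI)
          then show ?thesis using 1 R by (simp add: add_increasing)
        next
          case 2
          have "1 \<le> norm x powr \<alpha>" using 2 \<alpha> by (intro ge_one_powr_ge_zero) auto
          then have "\<bar>\<mu>\<bar> / norm x powr \<alpha> \<le> \<bar>\<mu>\<bar>" 
            using mult_left_mono[of 1 "norm x powr \<alpha>" "\<bar>\<mu>\<bar>"] by (subst pos_divide_le_eq) auto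
          then have "Vloc x - \<mu> / norm x powr \<alpha> \<le> C + \<bar>\<mu>\<bar>" using elim(1) m by simp
          then have "(Vloc x - \<mu> / norm x powr \<alpha>) * (?v x)\<^sup>2 \<le> (C + \<bar>\<mu>\<bar>) * (?v x)\<^sup>2"
            by (rule mult_right_mono) simp
          then have "ennreal ((Vloc x - \<mu> / norm x powr \<alpha>) * (?v x)\<^sup>2) \<le> ennreal (C + \<bar>\<mu>\<bar>) * ennreal ((?v x)\<^sup>2)"
            using C(1) by (subst ennreal_mult[symmetric]) (auto intro!: ennreal_leI)
          then show ?thesis using 2 by (simp add: add_increasing)
        next
          case 3
          have "Vloc x - \<mu> / norm x powr \<alpha> \<le> 2 * \<epsilon>" using elim(2) far[OF 3] m 3 R by simp
          then have "(Vloc x - \<mu> / norm x powr \<alpha>) * (?v x)\<^sup>2 \<le> 2 * \<epsilon> * (?v x)\<^sup>2"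
            by (rule mult_right_mono) simp
          then have "ennreal ((Vloc x - \<mu> / norm x powr \<alpha>) * (?v x)\<^sup>2) \<le> ennreal (2 * \<epsilon>) * ennreal ((?v x)\<^sup>2)"
            using \<epsilon> by (subst ennreal_mult[symmetric]) (auto intro!: ennreal_leI)
          then show ?thesis using 3 R by (simp add: add_increasing2)
        qed
      qed
    qed
    also have "\<dots> = ennreal (2 * \<epsilon>) * (\<integral>\<^sup>+x. ennreal ((?v x)\<^sup>2) \<partial>lebesgue)
       + (ennreal (C + \<bar>\<mu>\<bar>) * (\<integral>\<^sup>+x. ennreal ((?v x)\<^sup>2) * indicator (ball 0 R) x \<partial>lebesgue)
         + ennreal \<bar>\<mu>\<bar> * (\<integral>\<^sup>+x. ennreal ((?v x)\<^sup>2 / norm x powr \<alpha>) * indicator (ball 0 1) x \<partial>lebesgue))"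
      by (simp add: nn_integral_add nn_integral_cmult)
    also have "\<dots> \<le> ennreal (2 * \<epsilon>) * ennreal I + (ennreal (C + \<bar>\<mu>\<bar>) * local_energy \<alpha> ?v (ball 0 R)
         + ennreal \<bar>\<mu>\<bar> * (ennreal H * local_energy \<alpha> ?v (ball 0 R)))"
    proof (intro add_mono mult_left_mono)
      have "(\<integral>\<^sup>+x. ennreal ((?v x)\<^sup>2) \<partial>lebesgue) = (\<integral>\<^sup>+x. ennreal ((u x)\<^sup>2) \<partial>lebesgue)"
        by (rule nn_integral_lebesgue_translation) measurable
      also have "\<dots> = ennreal I"
        unfolding I_def by (rule nn_integral_eq_integral) (use sobolevD(2)[OF u] in auto)
      finally show "(\<integral>\<^sup>+x. ennreal ((?v x)\<^sup>2) \<partial>lebesgue) \<le> ennreal I" by simp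
      show "(\<integral>\<^sup>+x. ennreal ((?v x)\<^sup>2) * indicator (ball 0 R) x \<partial>lebesgue) \<le> local_energy \<alpha> ?v (ball 0 R)"
        by (simp add: local_energy_def)
      have "ball 0 1 \<subseteq> ball (0::real^'n) R" using R by auto
      then show "(\<integral>\<^sup>+x. ennreal ((?v x)\<^sup>2 / norm x powr \<alpha>) * indicator (ball 0 1) x \<partial>lebesgue) \<le> ennreal H * local_energy \<alpha> ?v (ball 0 R)"
        by (intro order_trans[OF hardy] mult_left_mono local_energy_mono) auto
    qed auto
    also have "\<dots> = ennreal (2 * \<epsilon> * I) + ennreal D * local_energy \<alpha> ?v (ball 0 R)"
      using \<epsilon> I H C by (simp add: D_def ennreal_mult ennreal_plus distrib_right mult.assoc)
    also have "local_energy \<alpha> ?v (ball 0 R) = local_energy \<alpha> u (ball z R)"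
      using local_energy_translation[OF sobolevD(1)[OF u], of "ball z R" \<alpha> z, unfolded translate_ball] by simp
    also have "ennreal (2 * \<epsilon> * I) \<le> ennreal (\<eta> / 2)"
    proof (rule ennreal_leI)
      have "2 * \<epsilon> * I = \<eta> / 2 * (I / (I + 1))"
        unfolding \<epsilon>_def using I by (simp add: divide_simps)
      also have "\<dots> \<le> \<eta> / 2 * 1" using I \<eta> by (intro mult_left_mono) (auto simp: divide_le_eq)
      finally show "2 * \<epsilon> * I \<le> \<eta> / 2" by simp
    qed
    finally show ?thesis by (simp add: add_right_mono)
  qed
  have "(\<lambda>n. ennreal D * local_energy \<alpha> u (ball (diagonal_point n) R)) \<longlonglongrightarrow> ennreal D * 0"
    by (rule ennreal_tendsto_cmult[OF _ local_energy_tendsto_0[OF u]]) simp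
  then have "\<forall>\<^sub>F n in sequentially. ennreal D * local_energy \<alpha> u (ball (diagonal_point n) R) < ennreal (\<eta> / 2)"
    using \<eta> by (intro order_tendstoD(2)) auto
  then obtain n where n: "ennreal D * local_energy \<alpha> u (ball (diagonal_point n) R) < ennreal (\<eta> / 2)"
    using eventually_happens'[OF sequentially_bot] by blast
  show ?thesis
  proof (intro bexI[of _ "diagonal_point n"] diagonal_point_lattice)
    have "ennreal (\<eta> / 2) + ennreal D * local_energy \<alpha> u (ball (diagonal_point n) R) < ennreal (\<eta> / 2) + ennreal (\<eta> / 2)"
      using n by (simp add: ennreal_add_left_cancel_less)
    also have "\<dots> = ennreal \<eta>" using \<eta> by (simp flip: ennreal_plus)
    finally show "(\<integral>\<^sup>+x. ennreal ((Vloc x - \<mu> / norm x powr \<alpha>) * (u (diagonal_point n + x))\<^sup>2) \<partial>lebesgue) < ennreal \<eta>"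
      by (rule le_less_trans[OF bound])
  qed
qed

section \<open>The nonlinearity of the equation\<close>

lemma abs_powr_has_derivative:
  fixes q :: real
  assumes q: "2 < q"
  shows "((\<lambda>s. \<bar>s\<bar> powr q / q) has_real_derivative \<bar>s\<bar> powr (q - 2) * s) (at s)"
proof -
  consider "s > 0" | "s < 0" | "s = 0" by linarith
  then show ?thesis
  proof cases
    case 1
    have "((\<lambda>s. s powr q / q) has_real_derivative \<bar>s\<bar> powr (q - 2) * s) (at s)"
      using 1 q by (auto intro!: derivative_eq_intros simp: powr_diff power2_eq_square)
    then show ?thesis
      by (rule has_field_derivative_transform_within_open[of _ _ _ "{0<..}"]) (use 1 in auto)
  next
    case 2
    have "((\<lambda>s. (- s) powr q / q) has_real_derivative \<bar>s\<bar> powr (q - 2) * s) (at s)"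
      using 2 q by (auto intro!: derivative_eq_intros simp: powr_diff power2_eq_square)
    then show ?thesis
      by (rule has_field_derivative_transform_within_open[of _ _ _ "{..<0}"]) (use 2 in auto)
  next
    case 3
    have "(\<lambda>h :: real. \<bar>h\<bar> powr (q - 1) / q) \<midarrow>0\<rightarrow> 0"
      using q by (auto intro!: tendsto_eq_intros tendsto_zero_powrI)
    then have "(\<lambda>h :: real. \<bar>h\<bar> powr q / q / h) \<midarrow>0\<rightarrow> 0"
    proof (rule Lim_null_comparison[rotated])
      show "\<forall>\<^sub>F h in at 0. norm (\<bar>h\<bar> powr q / q / h) \<le> \<bar>h\<bar> powr (q - 1) / q"
        unfolding eventually_at_filter
        using q by (intro always_eventually allI impI) (simp add: abs_mult powr_diff mult.commute)
    qed
    then show ?thesis using 3 by (simp add: DERIV_def)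
  qed
qed

text \<open>
  (F2) controls small arguments and (F1) the others; the value at \<open>0\<close> is excluded because (F2) says
  nothing about it. Continuity settles it in the following lemma.
\<close>

lemma growth_near_zero:
  fixes f :: "real^'n \<Rightarrow> real \<Rightarrow> real"
  assumes F2: "cond_F2 f" and c: "c \<ge> 0" and p: "p > 1" and growth: "\<And>x s. \<bar>f x s\<bar> \<le> c * (1 + \<bar>s\<bar> powr (p - 1))"
    and \<epsilon>: "\<epsilon> > 0"
  shows "\<exists>C\<ge>0. \<forall>x s. s \<noteq> 0 \<longrightarrow> \<bar>f x s\<bar> \<le> \<epsilon> * \<bar>s\<bar> + C * \<bar>s\<bar> powr (p - 1)"
proof -
  have "\<forall>\<^sub>F s in at 0. \<forall>x\<in>UNIV. dist (f x s / \<bar>s\<bar>) 0 < \<epsilon>"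
    using F2 \<epsilon> unfolding cond_F2_def by (rule uniform_limitD)
  then obtain d where d: "d > 0" and small: "\<And>s x. s \<noteq> 0 \<Longrightarrow> \<bar>s\<bar> < d \<Longrightarrow> \<bar>f x s / \<bar>s\<bar>\<bar> < \<epsilon>"
    unfolding eventually_at by (auto simp: dist_real_def)
  show ?thesis
  proof (intro exI[of _ "c * (d powr (1 - p) + 1)"] conjI allI impI)
    show "0 \<le> c * (d powr (1 - p) + 1)" using c by simp
    fix x :: "real^'n" and s :: real
    assume s: "s \<noteq> 0"
    show "\<bar>f x s\<bar> \<le> \<epsilon> * \<bar>s\<bar> + c * (d powr (1 - p) + 1) * \<bar>s\<bar> powr (p - 1)"
    proof (cases "\<bar>s\<bar> < d")
      case True
      then have "\<bar>f x s\<bar> \<le> \<epsilon> * \<bar>s\<bar>" using small[OF s True, of x] s by (simp add: abs_divide pos_divide_less_eq)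
      moreover have "0 \<le> c * (d powr (1 - p) + 1) * \<bar>s\<bar> powr (p - 1)" using c by simp
      ultimately show ?thesis by linarith
    next
      case False
      have "1 = d powr (1 - p) * d powr (p - 1)" using d by (simp flip: powr_add)
      also have "\<dots> \<le> d powr (1 - p) * \<bar>s\<bar> powr (p - 1)"
        using False d p by (intro mult_left_mono powr_mono2) auto
      finally have "c * (1 + \<bar>s\<bar> powr (p - 1)) \<le> c * (d powr (1 - p) * \<bar>s\<bar> powr (p - 1) + \<bar>s\<bar> powr (p - 1))"
        using c by (intro mult_left_mono) auto
      then have "\<bar>f x s\<bar> \<le> c * (d powr (1 - p) + 1) * \<bar>s\<bar> powr (p - 1)"
        using growth[of x s] by (simp add: distrib_right distrib_left mult.assoc)
      moreover have "0 \<le> \<epsilon> * \<bar>s\<bar>" using \<epsilon> by simp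
      ultimately show ?thesis by linarith
    qed
  qed
qed

lemma continuous_zero_at_zero:
  fixes h :: "real \<Rightarrow> real"
  assumes c: "continuous_on UNIV h" and b: "\<And>s. s \<noteq> 0 \<Longrightarrow> \<bar>h s\<bar> \<le> \<epsilon> * \<bar>s\<bar> + C * \<bar>s\<bar> powr r" and r: "r > 0"
  shows "h 0 = 0"
proof -
  have 1: "h \<midarrow>0\<rightarrow> h 0" using c by (simp add: continuous_on_eq_continuous_at isCont_def)
  have "(\<lambda>s :: real. \<epsilon> * \<bar>s\<bar> + C * \<bar>s\<bar> powr r) \<midarrow>0\<rightarrow> 0"
    using r by (auto intro!: tendsto_eq_intros tendsto_zero_powrI)
  then have "h \<midarrow>0\<rightarrow> 0"
    by (rule Lim_null_comparison[rotated]) (use b in \<open>auto simp: eventually_at_filter\<close>)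
  with 1 show ?thesis by (rule LIM_unique)
qed

lemma primitive_bound:
  fixes f :: "real^'n \<Rightarrow> real \<Rightarrow> real"
  assumes c: "continuous_on UNIV (f x)" and b: "\<And>s. \<bar>f x s\<bar> \<le> \<epsilon> * \<bar>s\<bar> + C * \<bar>s\<bar> powr (p - 1)"
    and "\<epsilon> \<ge> 0" "C \<ge> 0" "p > 1"
  shows "\<bar>primitive f x s\<bar> \<le> \<epsilon> * s\<^sup>2 + C * \<bar>s\<bar> powr p"
proof -
  have "norm (primitive f x s - primitive f x 0) \<le> (\<epsilon> * \<bar>s\<bar> + C * \<bar>s\<bar> powr (p - 1)) * norm (s - 0)"
  proof (rule field_differentiable_bound[of "cball 0 \<bar>s\<bar>"])
    fix z :: real assume z: "z \<in> cball 0 \<bar>s\<bar>"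
    then have "\<bar>z\<bar> \<le> \<bar>s\<bar>" by simp
    then have "\<epsilon> * \<bar>z\<bar> + C * \<bar>z\<bar> powr (p - 1) \<le> \<epsilon> * \<bar>s\<bar> + C * \<bar>s\<bar> powr (p - 1)"
      using assms by (intro add_mono mult_left_mono powr_mono2) auto
    then show "norm (f x z) \<le> \<epsilon> * \<bar>s\<bar> + C * \<bar>s\<bar> powr (p - 1)" using b[of z] by simp
    show "(primitive f x has_field_derivative f x z) (at z within cball 0 \<bar>s\<bar>)"
      using primitive_has_derivative[where f = f and x = x, OF c] by (rule has_field_derivative_at_within)
  qed auto
  also have "\<dots> = \<epsilon> * s\<^sup>2 + C * \<bar>s\<bar> powr p"
    by (cases "s = 0") (simp_all add: powr_diff power2_eq_square distrib_right)
  finally show ?thesis by simp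
qed

lemma frac_const_nonneg:
  fixes \<alpha> :: real
  assumes "0 < \<alpha>"
  shows "frac_const TYPE('n::finite) \<alpha> \<ge> 0"
proof -
  have "Gamma ((real CARD('n) + \<alpha>) / 2) > 0" using assms by (intro Gamma_real_pos) simp
  then show ?thesis unfolding frac_const_def by (intro divide_nonneg_nonneg mult_nonneg_nonneg) auto
qed

definition net_potential :: "(real^'n \<Rightarrow> real \<Rightarrow> real) \<Rightarrow> (real^'n \<Rightarrow> real) \<Rightarrow> real \<Rightarrow> real^'n \<Rightarrow> real \<Rightarrow> real" where
  "net_potential f K q x s = primitive f x s - 1/q * K x * \<bar>s\<bar> powr q"

definition net_nonlinearity :: "(real^'n \<Rightarrow> real \<Rightarrow> real) \<Rightarrow> (real^'n \<Rightarrow> real) \<Rightarrow> real \<Rightarrow> real^'n \<Rightarrow> real \<Rightarrow> real" where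
  "net_nonlinearity f K q x s = f x s - K x * (\<bar>s\<bar> powr (q - 2) * s)"

text \<open>
  The absorption term \<open>K \<bar>s\<bar>\<^bsup>q-2\<^esup> s\<close> is homogeneous of degree \<open>q - 1\<close>, so it drops out of the
  comparison, and (F4) remains. For \<open>r < 0\<close> the argument moves to the left as the factor grows, but
  multiplication by \<open>r\<close> restores the direction.
\<close>

lemma fiber_monotone:
  fixes f :: "real^'n \<Rightarrow> real \<Rightarrow> real"
  assumes F4: "cond_F4 q f" and q: "q > 2" and st: "0 < s" "s \<le> t"
  shows "net_nonlinearity f K q x (s * r) * r / s powr (q - 1) \<le> net_nonlinearity f K q x (t * r) * r / t powr (q - 1)"
proof (cases "r = 0")
  case False
  let ?F = "\<lambda>u. f x u / \<bar>u\<bar> powr (q - 1)"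
  have mono: "mono_on {..<0} ?F" "mono_on {0<..} ?F" using F4 by (auto simp: cond_F4_def)
  have f: "f x (z * r) * r / z powr (q - 1) = ?F (z * r) * r * \<bar>r\<bar> powr (q - 1)" if "z > 0" for z
    using that False by (simp add: abs_mult powr_mult)
  have k: "K x * (\<bar>z * r\<bar> powr (q - 2) * (z * r)) * r / z powr (q - 1) = K x * \<bar>r\<bar> powr (q - 2) * r\<^sup>2" if "z > 0" for z
  proof -
    have "z powr (q - 1) = z powr (q - 2) * z" using that by (simp add: powr_diff power2_eq_square)
    then show ?thesis using that by (simp add: abs_mult powr_mult power2_eq_square)
  qed
  have "?F (s * r) * r \<le> ?F (t * r) * r"
  proof (cases "r > 0")
    case True
    then have "?F (s * r) \<le> ?F (t * r)"
      using st by (intro mono_onD[OF mono(2)]) (auto intro: mult_right_mono)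
    then show ?thesis using True by (intro mult_right_mono) auto
  next
    case r: False
    then have "?F (t * r) \<le> ?F (s * r)"
      using st False by (intro mono_onD[OF mono(1)]) (auto simp: mult_pos_neg intro: mult_right_mono_neg)
    then show ?thesis using r by (intro mult_right_mono_neg) auto
  qed
  then have "?F (s * r) * r * \<bar>r\<bar> powr (q - 1) \<le> ?F (t * r) * r * \<bar>r\<bar> powr (q - 1)"
    by (rule mult_right_mono) simp
  then show ?thesis
    unfolding net_nonlinearity_def left_diff_distrib diff_divide_distrib
    using st k[of s] k[of t] f[of s] f[of t] by simp
qed simp

text \<open>
  (F1) and (F2) give the growth bounds, (F4) the monotone slope. For \<open>G_large\<close>, (F3) is used with
  \<open>M = 1 + k / q\<close>, where \<open>k\<close> bounds \<open>K\<close>, so that one power \<open>\<bar>s\<bar>\<^sup>q\<close> is left after the absorption term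
  has been paid for.
\<close>

lemma nehari_fibering_data:
  fixes \<alpha> \<mu> q :: real and V K :: "real^'n \<Rightarrow> real" and f :: "real^'n \<Rightarrow> real \<Rightarrow> real"
  assumes \<alpha>: "0 < \<alpha>" "\<alpha> < real CARD('n)"
    and V: "V \<in> L_infinity" "essinf V > 0" and K: "cond_K K"
    and F1: "cond_F1 \<alpha> q f" and F2: "cond_F2 f" and F3: "cond_F3 q f" and F4: "cond_F4 q f"
    and \<mu>: "\<mu> < 0"
  shows "\<exists>B a p m. nehari_fibering \<alpha> (frac_const TYPE('n) \<alpha>) B (\<lambda>x. V x - \<mu> / norm x powr \<alpha>)
     (net_potential f K q) (net_nonlinearity f K q) a p q m"
proof -
  obtain c p where c: "c > 0" and q: "2 < q" and p: "q < p" "p < critical_exponent TYPE('n) \<alpha>"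
    and growth: "\<And>x u. \<bar>f x u\<bar> \<le> c * (1 + \<bar>u\<bar> powr (p - 1))"
    using F1 unfolding cond_F1_def by blast
  have fm: "(\<lambda>(x, s). f x s) \<in> borel_measurable (lebesgue :: ((real^'n) \<times> real) measure)"
    and cont: "AE x in lebesgue. continuous_on UNIV (f x)"
    using F1 unfolding cond_F1_def by blast+
  have p2: "2 < p" using p q by simp
  have [measurable]: "V \<in> borel_measurable lebesgue" using L_infinityD(1)[OF V(1)] .
  obtain Cv where Cv: "Cv \<ge> 0" "AE x in lebesgue. \<bar>V x\<bar> \<le> Cv" using L_infinityD(2)[OF V(1)] by blast
  obtain m where m: "m > 0" "AE x in lebesgue. m \<le> V x" using essinf_pos_imp[OF V(2)] by blast
  have Km[measurable]: "K \<in> borel_measurable lebesgue" and K0: "AE x in lebesgue. K x \<ge> 0"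
    using K L_infinityD(1) by (auto simp: cond_K_def)
  obtain k where k: "k \<ge> 0" "AE x in lebesgue. \<bar>K x\<bar> \<le> k"
    using K L_infinityD(2) unfolding cond_K_def by blast
  have near: "\<exists>C\<ge>0. AE x in lebesgue. \<forall>s. \<bar>f x s\<bar> \<le> \<epsilon> * \<bar>s\<bar> + C * \<bar>s\<bar> powr (p - 1)" if \<epsilon>: "\<epsilon> > 0" for \<epsilon>
  proof -
    obtain C where C: "C \<ge> 0" and b: "\<And>x s. s \<noteq> 0 \<Longrightarrow> \<bar>f x s\<bar> \<le> \<epsilon> * \<bar>s\<bar> + C * \<bar>s\<bar> powr (p - 1)"
      using growth_near_zero[OF F2 _ _ growth \<epsilon>] c p2 by auto
    have "AE x in lebesgue. \<forall>s. \<bar>f x s\<bar> \<le> \<epsilon> * \<bar>s\<bar> + C * \<bar>s\<bar> powr (p - 1)"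
      using cont
    proof eventually_elim
      case (elim x)
      have "f x 0 = 0"
        by (rule continuous_zero_at_zero[where r = "p - 1" and \<epsilon> = \<epsilon> and C = C, OF elim]) (use b p2 in auto)
      then show ?case using b by (metis abs_zero add_0 mult_zero_right order_refl powr_0)
    qed
    then show ?thesis using C by blast
  qed
  have prim_near: "\<exists>C\<ge>0. AE x in lebesgue. \<forall>s. \<bar>primitive f x s\<bar> \<le> \<epsilon> * s\<^sup>2 + C * \<bar>s\<bar> powr p" if \<epsilon>: "\<epsilon> > 0" for \<epsilon>
  proof -
    obtain C where C: "C \<ge> 0" "AE x in lebesgue. \<forall>s. \<bar>f x s\<bar> \<le> \<epsilon> * \<bar>s\<bar> + C * \<bar>s\<bar> powr (p - 1)"
      using near[OF \<epsilon>] by blast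
    have "AE x in lebesgue. \<forall>s. \<bar>primitive f x s\<bar> \<le> \<epsilon> * s\<^sup>2 + C * \<bar>s\<bar> powr p"
      using cont C(2)
    proof eventually_elim
      case (elim x)
      show ?case
        using primitive_bound[where f = f and x = x, OF elim(1)] elim(2) \<epsilon> C(1) p2 by auto
    qed
    then show ?thesis using C(1) by blast
  qed
  obtain C1 where C1: "C1 \<ge> 0" "AE x in lebesgue. \<forall>s. \<bar>f x s\<bar> \<le> 1 * \<bar>s\<bar> + C1 * \<bar>s\<bar> powr (p - 1)"
    using near[of 1] by auto
  have interp: "\<bar>s\<bar> powr (q - 1) \<le> \<bar>s\<bar> + \<bar>s\<bar> powr (p - 1)" for s :: real
    using powr_le_add_powr[of "\<bar>s\<bar>" 1 "q - 1" "p - 1"] q p by simp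
  define a where "a = 1 + C1 + k"
  define B where "B = Cv + \<bar>\<mu>\<bar>"
  have "nehari_fibering \<alpha> (frac_const TYPE('n) \<alpha>) B (\<lambda>x. V x - \<mu> / norm x powr \<alpha>)
     (net_potential f K q) (net_nonlinearity f K q) a p q m"
  proof
    show "0 < \<alpha>" "\<alpha> < real CARD('n)" by (rule \<alpha>)+
    show "(\<lambda>x. V x - \<mu> / norm x powr \<alpha>) \<in> borel_measurable lebesgue" by measurable
    show "0 \<le> B" using Cv by (simp add: B_def)
    show "AE x in lebesgue. \<bar>V x - \<mu> / norm x powr \<alpha>\<bar> \<le> B * (1 + 1 / norm x powr \<alpha>)"
      using Cv(2)
    proof eventually_elim
      case (elim x)
      have "\<bar>V x - \<mu> / norm x powr \<alpha>\<bar> \<le> \<bar>V x\<bar> + \<bar>\<mu>\<bar> / norm x powr \<alpha>"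
        using abs_triangle_ineq4[of "V x" "\<mu> / norm x powr \<alpha>"] by (simp add: abs_divide)
      also have "\<dots> \<le> B * 1 + B * (1 / norm x powr \<alpha>)"
      proof (rule add_mono)
        show "\<bar>V x\<bar> \<le> B * 1" using elim by (simp add: B_def)
        have "\<bar>\<mu>\<bar> * (1 / norm x powr \<alpha>) \<le> B * (1 / norm x powr \<alpha>)" using Cv by (intro mult_right_mono) (auto simp: B_def)
        then show "\<bar>\<mu>\<bar> / norm x powr \<alpha> \<le> B * (1 / norm x powr \<alpha>)" by simp
      qed
      finally show ?case by (simp only: distrib_left)
    qed
    show "2 < p" by (rule p2)
    show "0 \<le> a" using C1 k by (simp add: a_def)
    show "AE x in lebesgue. \<forall>s. (net_potential f K q x has_real_derivative net_nonlinearity f K q x s) (at s)"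
      using cont
    proof eventually_elim
      case (elim x)
      show ?case
      proof
        fix s
        have "((\<lambda>s. primitive f x s - K x * (\<bar>s\<bar> powr q / q)) has_real_derivative f x s - K x * (\<bar>s\<bar> powr (q - 2) * s)) (at s)"
          by (intro DERIV_diff DERIV_cmult abs_powr_has_derivative q primitive_has_derivative[where f = f and x = x, OF elim])
        then show "(net_potential f K q x has_real_derivative net_nonlinearity f K q x s) (at s)"
          by (simp add: net_potential_def[abs_def] net_nonlinearity_def)
      qed
    qed
    show "AE x in lebesgue. \<forall>s. \<bar>net_nonlinearity f K q x s\<bar> \<le> a * (\<bar>s\<bar> + \<bar>s\<bar> powr (p - 1))"
      using C1(2) k(2)
    proof eventually_elim
      case (elim x)
      show ?case
      proof
        fix s :: real
        have "\<bar>K x * (\<bar>s\<bar> powr (q - 2) * s)\<bar> = \<bar>K x\<bar> * \<bar>s\<bar> powr (q - 1)"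
          by (cases "s = 0") (simp_all add: abs_mult powr_diff power2_eq_square)
        also have "\<dots> \<le> k * (\<bar>s\<bar> + \<bar>s\<bar> powr (p - 1))"
          using elim(2) k(1) by (intro mult_mono interp) auto
        finally have 1: "\<bar>K x * (\<bar>s\<bar> powr (q - 2) * s)\<bar> \<le> k * \<bar>s\<bar> + k * \<bar>s\<bar> powr (p - 1)"
          by (simp add: distrib_left)
        have 2: "\<bar>f x s\<bar> \<le> \<bar>s\<bar> + C1 * \<bar>s\<bar> powr (p - 1)" using elim(1) by simp
        have "0 \<le> C1 * \<bar>s\<bar>" "0 \<le> \<bar>s\<bar> powr (p - 1)" using C1 by auto
        then show "\<bar>net_nonlinearity f K q x s\<bar> \<le> a * (\<bar>s\<bar> + \<bar>s\<bar> powr (p - 1))"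
          using 1 2 unfolding net_nonlinearity_def a_def distrib_right distrib_left by linarith
      qed
    qed
    show "AE x in lebesgue. net_potential f K q x 0 = 0"
      by (simp add: net_potential_def)
    show "(\<lambda>x. net_potential f K q x (u x)) \<in> borel_measurable lebesgue"
      if [measurable]: "u \<in> borel_measurable lebesgue" for u
    proof -
      have [measurable]: "(\<lambda>x. primitive f x (u x)) \<in> borel_measurable lebesgue"
        by (rule primitive_superposition_measurable[OF fm cont that])
      show ?thesis unfolding net_potential_def by measurable
    qed
    show "(\<lambda>x. net_nonlinearity f K q x (u x)) \<in> borel_measurable lebesgue"
      if [measurable]: "u \<in> borel_measurable lebesgue" for u
    proof -
      have [measurable]: "(\<lambda>x. f x (u x)) \<in> borel_measurable lebesgue"
        by (rule superposition_measurable[OF fm cont that])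
      show ?thesis unfolding net_nonlinearity_def by measurable
    qed
    show "p \<le> critical_exponent TYPE('n) \<alpha>" using p by simp
    show "2 < q" "q \<le> p" using q p by auto
    show "0 \<le> frac_const TYPE('n) \<alpha>" by (rule frac_const_nonneg[OF \<alpha>(1)])
    show "0 < m" by (rule m)
    show "AE x in lebesgue. m \<le> V x - \<mu> / norm x powr \<alpha>"
      using m(2)
    proof eventually_elim
      case (elim x)
      have "\<mu> / norm x powr \<alpha> \<le> 0" using \<mu> by (simp add: divide_nonpos_nonneg)
      then show ?case using elim by simp
    qed
    show "AE x in lebesgue. \<forall>r s t. 0 < s \<longrightarrow> s \<le> t \<longrightarrow>
          net_nonlinearity f K q x (s * r) * r / s powr (q - 1) \<le> net_nonlinearity f K q x (t * r) * r / t powr (q - 1)"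
      using fiber_monotone[OF F4 q] by auto
    show "\<exists>C\<ge>0. AE x in lebesgue. \<forall>s. net_potential f K q x s \<le> \<epsilon> * s\<^sup>2 + C * \<bar>s\<bar> powr p" if \<epsilon>: "\<epsilon> > 0" for \<epsilon>
    proof -
      obtain C where C: "C \<ge> 0" "AE x in lebesgue. \<forall>s. \<bar>primitive f x s\<bar> \<le> \<epsilon> * s\<^sup>2 + C * \<bar>s\<bar> powr p"
        using prim_near[OF \<epsilon>] by blast
      have "AE x in lebesgue. \<forall>s. net_potential f K q x s \<le> \<epsilon> * s\<^sup>2 + C * \<bar>s\<bar> powr p"
        using C(2) K0
      proof eventually_elim
        case (elim x)
        show ?case
        proof
          fix s
          have "0 \<le> 1 / q * K x * \<bar>s\<bar> powr q" using elim(2) q by simp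
          then show "net_potential f K q x s \<le> \<epsilon> * s\<^sup>2 + C * \<bar>s\<bar> powr p"
            using elim(1)[rule_format, of s] unfolding net_potential_def by linarith
        qed
      qed
      then show ?thesis using C(1) by blast
    qed
    show "\<exists>C\<ge>0. AE x in lebesgue. \<forall>s. \<bar>s\<bar> powr q - C * s\<^sup>2 \<le> net_potential f K q x s"
    proof -
      define M where "M = 1 + k / q"
      have M: "M \<ge> 0" using k q by (simp add: M_def)
      obtain C where C: "C \<ge> 0" "AE x in lebesgue. \<forall>s. \<bar>primitive f x s\<bar> \<le> 1 * s\<^sup>2 + C * \<bar>s\<bar> powr p"
        using prim_near[of 1] by auto
      from F3 obtain R0 where R0: "\<And>s x. norm s \<ge> R0 \<Longrightarrow> M \<le> primitive f x s / \<bar>s\<bar> powr q"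
        unfolding cond_F3_def eventually_at_infinity by blast
      define R where "R = max 1 R0"
      have R: "R \<ge> 1" "R \<ge> R0" by (simp_all add: R_def)
      \<comment> \<open>On \<open>\<bar>s\<bar> \<le> R\<close> all powers above \<open>2\<close> are absorbed by a multiple of \<open>s\<^sup>2\<close>.\<close>
      define C' where "C' = 1 + C * R powr (p - 2) + M * R powr (q - 2)"
      have C': "C' \<ge> 0" using C M by (simp add: C'_def)
      have le_sq: "\<bar>s\<bar> powr r \<le> R powr (r - 2) * s\<^sup>2" if "\<bar>s\<bar> \<le> R" "r > 2" for s r :: real
      proof (cases "s = 0")
        case False
        have "\<bar>s\<bar> powr r = \<bar>s\<bar> powr (r - 2) * s\<^sup>2" using False by (simp add: powr_diff)
        also have "\<dots> \<le> R powr (r - 2) * s\<^sup>2" using that by (intro mult_right_mono powr_mono2) auto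
        finally show ?thesis .
      qed simp
      have "AE x in lebesgue. \<forall>s. \<bar>s\<bar> powr q - C' * s\<^sup>2 \<le> net_potential f K q x s"
        using C(2) k(2)
      proof eventually_elim
        case (elim x)
        show ?case
        proof
          fix s :: real
          have "1 / q * K x * \<bar>s\<bar> powr q \<le> 1 / q * k * \<bar>s\<bar> powr q"
            using elim(2) q by (intro mult_right_mono mult_left_mono) auto
          then have Kle: "1 / q * K x * \<bar>s\<bar> powr q \<le> M * \<bar>s\<bar> powr q - \<bar>s\<bar> powr q"
            by (simp add: M_def distrib_right)
          show "\<bar>s\<bar> powr q - C' * s\<^sup>2 \<le> net_potential f K q x s"
          proof (cases "\<bar>s\<bar> \<ge> R")
            case True
            then have "M * \<bar>s\<bar> powr q \<le> primitive f x s"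
              using R0[of s x] R by (simp add: pos_le_divide_eq)
            moreover have "0 \<le> C' * s\<^sup>2" using C' by simp
            ultimately show ?thesis using Kle unfolding net_potential_def by linarith
          next
            case False
            have 1: "C * \<bar>s\<bar> powr p \<le> C * (R powr (p - 2) * s\<^sup>2)"
              using False C p2 by (intro mult_left_mono le_sq) auto
            have 2: "M * \<bar>s\<bar> powr q \<le> M * (R powr (q - 2) * s\<^sup>2)"
              using False M q by (intro mult_left_mono le_sq) auto
            have "C' * s\<^sup>2 = s\<^sup>2 + C * (R powr (p - 2) * s\<^sup>2) + M * (R powr (q - 2) * s\<^sup>2)"
              by (simp add: C'_def distrib_right mult.assoc)
            then show ?thesis using 1 2 Kle elim(1)[rule_format, of s] unfolding net_potential_def by linarith
          qed
        qed
      qed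
      then show ?thesis using C' by blast
    qed
  qed
  then show ?thesis by blast
qed

section \<open>Nonexistence of ground states\<close>

lemma has_sobolev_derivative_cong:
  assumes eq: "\<And>v. v \<in> sobolev \<alpha> \<Longrightarrow> \<Phi> v = \<Phi>' v" and u: "u \<in> sobolev \<alpha>"
  shows "has_sobolev_derivative \<alpha> \<Phi> L u \<longleftrightarrow> has_sobolev_derivative \<alpha> \<Phi>' L u"
proof -
  have "\<Phi> (\<lambda>x. u x + h x) = \<Phi>' (\<lambda>x. u x + h x)" if "h \<in> sobolev \<alpha>" for h
    by (rule eq[OF sobolev_add[OF u that]])
  then show ?thesis
    unfolding has_sobolev_derivative_def using eq[OF u] by (simp cong: ball_cong)
qed

lemma nehari_cong:
  assumes eq: "\<And>v. v \<in> sobolev \<alpha> \<Longrightarrow> \<Phi> v = \<Phi>' v"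
  shows "nehari \<alpha> \<Phi> = nehari \<alpha> \<Phi>'"
  unfolding nehari_def using has_sobolev_derivative_cong[of \<alpha> \<Phi> \<Phi>', OF eq] by blast

theorem theorem1p2:
  fixes \<alpha> \<mu> q :: real
    and V Vloc Vper K :: "real ^ 'n \<Rightarrow> real"
    and f :: "real ^ 'n \<Rightarrow> real \<Rightarrow> real"
  assumes "0 < \<alpha>" and "\<alpha> < 2" and "\<alpha> < real CARD('n)"
    and "cond_V \<alpha> V Vloc Vper"
    and "cond_K K"
    and "cond_F1 \<alpha> q f" and "cond_F2 f" and "cond_F3 q f" and "cond_F4 q f"
    and "\<mu> < 0"
    and "AE x in lebesgue. x \<noteq> 0 \<longrightarrow> Vloc x > \<mu> / norm x powr \<alpha>"
  shows "\<not> (\<exists>u. ground_state \<alpha> (energy \<alpha> \<mu> q V K f) u)"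
proof
  let ?J = "energy \<alpha> \<mu> q V K f"
  let ?w = "\<lambda>x. V x - \<mu> / norm x powr \<alpha>" and ?W = "\<lambda>x. Vloc x - \<mu> / norm x powr \<alpha>"
  let ?G = "net_potential f K q" and ?c = "frac_const TYPE('n) \<alpha>"
  note \<alpha> = assms(1,3)
  have V: "V \<in> L_infinity" "essinf V > 0" and Vsum: "AE x in lebesgue. V x = Vloc x + Vper x"
    and Vper: "Vper \<in> L_infinity" "ae_periodic Vper" and van: "ae_vanishes_at_infinity Vloc"
    and Vloc_m: "Vloc \<in> borel_measurable lebesgue"
    using assms(4) by (auto simp: cond_V_def L_space_def)
  note [measurable] = L_infinityD(1)[OF V(1)] L_infinityD(1)[OF Vper(1)] Vloc_m
  obtain Cv where Cv: "Cv \<ge> 0" "AE x in lebesgue. \<bar>V x\<bar> \<le> Cv" using L_infinityD(2)[OF V(1)] by blast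
  obtain Cp where Cp: "Cp \<ge> 0" "AE x in lebesgue. \<bar>Vper x\<bar> \<le> Cp" using L_infinityD(2)[OF Vper(1)] by blast
  have Vloc_bd: "AE x in lebesgue. \<bar>Vloc x\<bar> \<le> Cv + Cp"
    using Cv(2) Cp(2) Vsum by eventually_elim auto
  obtain B a p m where "nehari_fibering \<alpha> ?c B ?w ?G (net_nonlinearity f K q) a p q m"
    using nehari_fibering_data[OF \<alpha> V assms(5-10)] by blast
  then interpret nehari_fibering \<alpha> ?c B ?w ?G "net_nonlinearity f K q" a p q m .
  have W_pos: "AE x in lebesgue. ?W x > 0"
  proof -
    have "AE x in lebesgue. x \<noteq> (0::real^'n)"
      using AE_lborel_singleton[of "0::real^'n"] by (rule AE_completion)
    then show ?thesis using assms(11) by eventually_elim simp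
  qed
  have int_per: "integrable lebesgue (\<lambda>x. Vper x * (v x)\<^sup>2)" "integrable lebesgue (\<lambda>x. V x * (v x)\<^sup>2)"
    if v: "v \<in> sobolev \<alpha>" for v
  proof -
    note [measurable] = sobolevD(1)[OF v]
    show "integrable lebesgue (\<lambda>x. Vper x * (v x)\<^sup>2)"
    proof (rule Bochner_Integration.integrable_bound)
      show "integrable lebesgue (\<lambda>x. Cp * (v x)\<^sup>2)" using sobolevD(2)[OF v] by simp
      show "AE x in lebesgue. norm (Vper x * (v x)\<^sup>2) \<le> norm (Cp * (v x)\<^sup>2)"
        using Cp(2) by eventually_elim (use Cp(1) in \<open>auto simp: abs_mult intro: mult_right_mono\<close>)
    qed measurable
    show "integrable lebesgue (\<lambda>x. V x * (v x)\<^sup>2)"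
    proof (rule Bochner_Integration.integrable_bound)
      show "integrable lebesgue (\<lambda>x. Cv * (v x)\<^sup>2)" using sobolevD(2)[OF v] by simp
      show "AE x in lebesgue. norm (V x * (v x)\<^sup>2) \<le> norm (Cv * (v x)\<^sup>2)"
        using Cv(2) by eventually_elim (use Cv(1) in \<open>auto simp: abs_mult intro: mult_right_mono\<close>)
    qed measurable
  qed
  have int_w: "integrable lebesgue (\<lambda>x. ?w x * (v x)\<^sup>2)" if v: "v \<in> sobolev \<alpha>" for v
    using integrable_weight[OF v v] by (simp add: power2_eq_square)
  have int_W: "integrable lebesgue (\<lambda>x. ?W x * (v x)\<^sup>2)"
    and w_split: "(\<integral>x. ?w x * (v x)\<^sup>2 \<partial>lebesgue) = (\<integral>x. Vper x * (v x)\<^sup>2 \<partial>lebesgue) + (\<integral>x. ?W x * (v x)\<^sup>2 \<partial>lebesgue)"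
    if v: "v \<in> sobolev \<alpha>" for v
  proof -
    note [measurable] = sobolevD(1)[OF v]
    have eq: "AE x in lebesgue. ?w x * (v x)\<^sup>2 - Vper x * (v x)\<^sup>2 = ?W x * (v x)\<^sup>2"
      using Vsum by eventually_elim (simp add: algebra_simps)
    have int: "integrable lebesgue (\<lambda>x. ?w x * (v x)\<^sup>2 - Vper x * (v x)\<^sup>2)"
      using int_w[OF v] int_per(1)[OF v] by (rule Bochner_Integration.integrable_diff)
    show "integrable lebesgue (\<lambda>x. ?W x * (v x)\<^sup>2)"
      by (rule integrable_cong_AE_imp[OF int _ eq]) measurable
    have "(\<integral>x. ?W x * (v x)\<^sup>2 \<partial>lebesgue) = (\<integral>x. ?w x * (v x)\<^sup>2 - Vper x * (v x)\<^sup>2 \<partial>lebesgue)"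
      by (rule integral_cong_AE[OF _ _ AE_symmetric[OF eq]]) measurable
    then show "(\<integral>x. ?w x * (v x)\<^sup>2 \<partial>lebesgue) = (\<integral>x. Vper x * (v x)\<^sup>2 \<partial>lebesgue) + (\<integral>x. ?W x * (v x)\<^sup>2 \<partial>lebesgue)"
      using Bochner_Integration.integral_diff[OF int_w[OF v] int_per(1)[OF v]] by simp
  qed
  have J: "?J v = functional v" if v: "v \<in> sobolev \<alpha>" for v
  proof -
    have "(\<integral>x. ?w x * (v x)\<^sup>2 \<partial>lebesgue) = (\<integral>x. V x * (v x)\<^sup>2 \<partial>lebesgue) - (\<integral>x. \<mu> / norm x powr \<alpha> * (v x)\<^sup>2 \<partial>lebesgue)"
    proof -
      have "integrable lebesgue (\<lambda>x. \<mu> / norm x powr \<alpha> * (v x)\<^sup>2)"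
        using Bochner_Integration.integrable_diff[OF int_per(2)[OF v] int_w[OF v]] by (simp add: algebra_simps)
      from Bochner_Integration.integral_diff[OF int_per(2)[OF v] this] show ?thesis
        by (simp add: algebra_simps)
    qed
    then show ?thesis
      unfolding energy_def functional_def bilinear_self net_potential_def by (simp add: algebra_simps)
  qed
  assume "\<exists>u. ground_state \<alpha> ?J u"
  then obtain u where gs: "ground_state \<alpha> ?J u" by blast
  then have u: "u \<in> sobolev \<alpha>" and crit: "has_sobolev_derivative \<alpha> ?J (\<lambda>_. 0) u"
    and uN: "u \<in> nehari \<alpha> ?J" and inf: "ereal (?J u) = (INF v\<in>nehari \<alpha> ?J. ereal (?J v))"
    by (auto simp: ground_state_def critical_point_def)
  note [measurable] = sobolevD(1)[OF u]
  have nz: "\<not> (AE x in lebesgue. u x = 0)" using uN by (simp add: nehari_def)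
  have least: "?J u \<le> ?J v" if "v \<in> nehari \<alpha> ?J" for v
    using INF_lower[OF that, of "\<lambda>v. ereal (?J v)"] unfolding inf[symmetric] by simp
  have nehari_eq: "nehari \<alpha> ?J = nehari \<alpha> functional" by (rule nehari_cong[OF J])
  have "derivative u u = 0"
  proof -
    have "has_sobolev_derivative \<alpha> functional (\<lambda>_. 0) (\<lambda>x. 1 * u x)"
      using crit has_sobolev_derivative_cong[OF J u] by simp
    from DERIV_unique[OF functional_ray_derivative[OF u, of 1] derivative_along_ray[OF this u]]
    show ?thesis by simp
  qed
  note max = critical_point_maximises_ray[OF u this]
  define \<eta> where "\<eta> = (\<integral>x. ?W x * (u x)\<^sup>2 \<partial>lebesgue)"
  have \<eta>: "\<eta> > 0"
  proof -
    have nonneg: "AE x in lebesgue. 0 \<le> ?W x * (u x)\<^sup>2"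
      using W_pos by eventually_elim simp
    have "\<eta> \<noteq> 0"
    proof
      assume "\<eta> = 0"
      then have "AE x in lebesgue. ?W x * (u x)\<^sup>2 = 0"
        using integral_nonneg_eq_0_iff_AE[OF int_W[OF u] nonneg] by (simp add: \<eta>_def)
      then have "AE x in lebesgue. u x = 0"
        using W_pos by eventually_elim auto
      then show False using nz by simp
    qed
    moreover have "\<eta> \<ge> 0" unfolding \<eta>_def by (rule integral_nonneg_AE[OF nonneg])
    ultimately show ?thesis by simp
  qed
  have "Cv + Cp \<ge> 0" using Cv Cp by simp
  from weight_escapes[OF \<alpha> u Vloc_m this Vloc_bd van \<eta>, of \<mu>]
  obtain z where z: "z \<in> integer_lattice"
    and zW: "(\<integral>\<^sup>+x. ennreal (?W x * (u (z + x))\<^sup>2) \<partial>lebesgue) < ennreal \<eta>" by blast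
  define v where "v x = u (z + x)" for x
  have v: "v \<in> sobolev \<alpha>" and gag: "gagliardo \<alpha> v = gagliardo \<alpha> u"
    using sobolev_translation[OF u, of z] by (simp_all add: v_def[abs_def])
  have less: "(\<integral>x. ?W x * (v x)\<^sup>2 \<partial>lebesgue) < \<eta>"
  proof -
    have "AE x in lebesgue. 0 \<le> ?W x * (v x)\<^sup>2" using W_pos by eventually_elim simp
    then have "ennreal (\<integral>x. ?W x * (v x)\<^sup>2 \<partial>lebesgue) < ennreal \<eta>"
      using zW nn_integral_eq_integral[OF int_W[OF v]] by (simp add: v_def)
    then show ?thesis by (meson ennreal_leI not_le)
  qed
  have per: "(\<integral>x. Vper x * (v x)\<^sup>2 \<partial>lebesgue) = (\<integral>x. Vper x * (u x)\<^sup>2 \<partial>lebesgue)"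
  proof -
    have "AE x in lebesgue. Vper (x + z) = Vper x" using Vper(2) z by (simp add: ae_periodic_def)
    then have "AE x in lebesgue. Vper x * (v x)\<^sup>2 = Vper (z + x) * (u (z + x))\<^sup>2"
      by eventually_elim (simp add: v_def add.commute)
    then have "(\<integral>x. Vper x * (v x)\<^sup>2 \<partial>lebesgue) = (\<integral>x. Vper (z + x) * (u (z + x))\<^sup>2 \<partial>lebesgue)"
      unfolding v_def by (intro integral_cong_AE) measurable
    also have "\<dots> = (\<integral>x. Vper x * (u x)\<^sup>2 \<partial>lebesgue)"
      by (rule integrable_lebesgue_translation(2)) measurable
    finally show ?thesis .
  qed
  have Gper: "(\<integral>x. ?G x (t * v x) \<partial>lebesgue) = (\<integral>x. ?G x (t * u x) \<partial>lebesgue)" for t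
  proof -
    have "f (x + z) = f x" for x using assms(6) z by (auto simp: cond_F1_def)
    then have F: "primitive f (x + z) = primitive f x" for x by (auto simp: primitive_def)
    have "AE x in lebesgue. K (x + z) = K x" using assms(5) z by (simp add: cond_K_def ae_periodic_def)
    then have eq: "AE x in lebesgue. ?G x (t * v x) = ?G (z + x) (t * u (z + x))"
      by eventually_elim (simp add: v_def net_potential_def F add.commute[of z])
    have m: "(\<lambda>x. ?G x (t * u x)) \<in> borel_measurable lebesgue" by (rule meas_G) measurable
    have "(\<integral>x. ?G x (t * v x) \<partial>lebesgue) = (\<integral>x. ?G (z + x) (t * u (z + x)) \<partial>lebesgue)"
    proof (rule integral_cong_AE[OF _ _ eq])
      show "(\<lambda>x. ?G x (t * v x)) \<in> borel_measurable lebesgue"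
        by (rule meas_G) (use sobolevD(1)[OF v] in measurable)
      show "(\<lambda>x. ?G (z + x) (t * u (z + x))) \<in> borel_measurable lebesgue"
        using measurable_lebesgue_translate[OF m] .
    qed
    also have "\<dots> = (\<integral>x. ?G x (t * u x) \<partial>lebesgue)"
      using integrable_lebesgue_translation(2)[OF m] .
    finally show ?thesis .
  qed
  have "\<not> (AE x in lebesgue. v x = 0)"
  proof
    assume "AE x in lebesgue. v x = 0"
    from AE_lebesgue_translation[OF this, of "- z"] show False using nz by (simp add: v_def)
  qed
  from ray_meets_nehari[OF v this] obtain t where t: "t > 0" and tN: "(\<lambda>x. t * v x) \<in> nehari \<alpha> functional"
    by blast
  \<comment> \<open>The Gagliardo and periodic parts agree, so the forms compare as the integrals against the positive weight.\<close>
  have "bilinear v v < bilinear u u"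
    unfolding bilinear_self w_split[OF u] w_split[OF v] gag per using less by (simp add: \<eta>_def)
  then have "t\<^sup>2 / 2 * bilinear v v < t\<^sup>2 / 2 * bilinear u u"
    using t by (intro mult_strict_left_mono) auto
  then have "functional (\<lambda>x. t * v x) < functional (\<lambda>x. t * u x)"
    unfolding functional_scale[OF u] functional_scale[OF v] Gper by simp
  also have "\<dots> \<le> functional u" by (rule max[OF t])
  also have "\<dots> \<le> functional (\<lambda>x. t * v x)"
    using least[of "\<lambda>x. t * v x"] tN unfolding nehari_eq J[OF u] J[OF sobolev_scale[OF v, of t]] by simp
  finally show False by simp
qed

end
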